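(* Let $k,l\ge1$, $n=k+l$, $0<k<n-1$, and let $u(t)=\|u_{ij}(t)\|$ be an $(l,k)$-matrix of real polynomials in $t=(t_1,\dots,t_k)\in\mathbb{R}^k$ such that the map $t\mapsto u(t)$ is nonsingular and the associated Crofton function $\mathrm{Cr}_K(\eta,\xi)$ is finite and nonzero almost everywhere. Let $a(s,t)$ be a generalized function of $s\in\mathbb{R}^l$, $t\in\mathbb{R}^k$, whose Fourier transform $\widetilde a(\xi,t)$ with respect to $s$ is an ordinary function satisfying, for almost every $(\xi,t)$, $$|\widetilde a(\xi,t)|=\mathrm{Cr}_K^{-1/2}(-\xi u(t),\xi)\,|\omega(\xi,t)|^{1/2},\qquad \omega(\xi,t)=\frac{\partial(\xi u(t))}{\partial t}.$$ Then the integral transform $$(J_af)(\alpha,t)=\int_{\mathbb{R}^n}f(x,y)\,a(y-u(t)x-\alpha,t)\,d\mu(x)\,d\mu(y)$$ is a generalized Fourier transform (GFT), i.e. for all $f,g\in\mathcal{S}(\mathbb{R}^n)$, $$f(x,y)=\int (J_af)(\alpha,t)\,\overline{a(y-u(t)x-\alpha,t)}\,d\mu(\alpha)\,d\mu(t),\qquad \int f\,\overline g\,d\mu(x)\,d\mu(y)=\int J_af\;\overline{J_ag}\;d\mu(\alpha)\,d\mu(t).$$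
   Context: Points of $\mathbb{R}^n=\mathbb{R}^k\oplus\mathbb{R}^l$ are written $(x,y)$, $x\in\mathbb{R}^k$, $y\in\mathbb{R}^l$; $\alpha,s,\xi\in\mathbb{R}^l$; $\langle s,\xi\rangle=\sum_ps_p\xi_p$; $u(t)x\in\mathbb{R}^l$ is matrix times column, $\xi u(t)\in\mathbb{R}^k$ is row times matrix. $K$ is the family (complex) of $k$-planes $y=u(t)x+\alpha$ with parameters $(\alpha,t)\in\mathbb{R}^l\times\mathbb{R}^k$. $\omega(\xi,t)$ is the Jacobian determinant of $t\mapsto\xi u(t)$, $\mathbb{R}^k\to\mathbb{R}^k$. Crofton function: $\mathrm{Cr}_K(\eta,\xi)$ on $\mathbb{R}^k\oplus\mathbb{R}^l$ is the number of solutions $t\in\mathbb{R}^k$ of $\eta=-\xi u(t)$. Normalization: on $\mathbb{R}^m$, $d\mu$ is $(2\pi)^{-m/2}$ times Lebesgue measure, and $\widetilde a(\xi,t)=\int_{\mathbb{R}^l}a(s,t)e^{i\langle s,\xi\rangle}d\mu(s)$ (for tempered generalized functions of $s$). GFT: an integral transform $f(x)\mapsto\hat f(y)=\int_Xf(x)e(x,y)dx$ between functions on spaces $X,\hat X$ with fixed measures, $e$ a generalized function, is a generalized Fourier transform if the inversion formula $f(x)=\int\hat f(y)\overline{e(x,y)}dy$, and hence the Plancherel formula $\int f\overline g\,dx=\int\hat f\,\overline{\hat g}\,dy$, is valid. Meaning of the integrals: for fixed $t$, $(J_af)(\alpha,t)$ is the pairing in $p\in\mathbb{R}^l$ of $a(p-\alpha,t)$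 with the Schwartz function $p\mapsto\int f(x,u(t)x+p)\,d\mu(x)$. Let $\widetilde\phi(\xi,t)$ be the Fourier transform in $\alpha$ of $\phi=J_af$. For a kernel $V(s,t)=\int M(\xi,t)e^{i\langle s,\xi\rangle}d\mu(\xi)$, the expression $\int\phi(\alpha,t)V(y-u(t)x-\alpha,t)\,d\mu(\alpha)\,d\mu(t)$ means $\int\int\widetilde\phi(-\xi,t)M(\xi,t)e^{i\langle y-u(t)x,\xi\rangle}d\mu(\xi)\,d\mu(t)$; for $V=\overline a$ one has $M=\overline{\widetilde a}$. *)

theory Defs
  imports "HOL-Analysis.Analysis"
begin

section \<open>Normalized Lebesgue measure, Schwartz functions, tempered distributions\<close>

text \<open>The factor is $(2\pi)^{-m/2}$ on $\mathbf{R}^m$. On a product type the dimensions add up,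
  so that \<open>mu\<close> on \<open>'a \<times> 'b\<close> is the (completed) product $d\mu(x)\,d\mu(y)$.\<close>

definition mu :: "'a::euclidean_space measure" where
  "mu = density lebesgue (\<lambda>_. ennreal ((2 * pi) powr (- real DIM('a) / 2)))"

primrec pderivs :: "'a::euclidean_space list \<Rightarrow> ('a \<Rightarrow> complex) \<Rightarrow> 'a \<Rightarrow> complex" where
  "pderivs [] f = f"
| "pderivs (b # bs) f = (\<lambda>x. frechet_derivative (pderivs bs f) (at x) b)"

definition schwartz :: "('a::euclidean_space \<Rightarrow> complex) set" where
  "schwartz = {f. \<forall>bs. set bs \<subseteq> Basis \<longrightarrow>
     (\<forall>x. pderivs bs f differentiable (at x)) \<and>
     (\<forall>N::nat. bounded (range (\<lambda>x. (1 + norm x) ^ N * norm (pderivs bs f x))))}"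

definition schwartz_norm :: "nat \<Rightarrow> ('a::euclidean_space \<Rightarrow> complex) \<Rightarrow> real" where
  "schwartz_norm m f =
     (\<Sum>bs | set bs \<subseteq> Basis \<and> length bs \<le> m. SUP x. (1 + norm x) ^ m * norm (pderivs bs f x))"

text \<open>Distributions are functionals on all functions, but only their values on \<open>schwartz\<close>
  are ever used.\<close>

type_synonym 'a distr = "('a \<Rightarrow> complex) \<Rightarrow> complex"

definition tempered_distribution :: "'a::euclidean_space distr \<Rightarrow> bool" where
  "tempered_distribution T \<longleftrightarrow>
     (\<forall>f\<in>schwartz. \<forall>g\<in>schwartz. T (\<lambda>x. f x + g x) = T f + T g) \<and>
     (\<forall>f\<in>schwartz. \<forall>c. T (\<lambda>x. c * f x) = c * T f) \<and>
     (\<exists>m C. \<forall>f\<in>schwartz. norm (T f) \<le> C * schwartz_norm m f)"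

text \<open>The distribution \<open>T\<close> is the ordinary function \<open>h\<close>; pairings are taken with respect
  to the normalized measure \<open>mu\<close>.\<close>

definition distr_is_function :: "'a::euclidean_space distr \<Rightarrow> ('a \<Rightarrow> complex) \<Rightarrow> bool" where
  "distr_is_function T h \<longleftrightarrow>
     (\<forall>f\<in>schwartz. has_bochner_integral mu (\<lambda>x. h x * f x) (T f))"

definition fourier :: "('a::euclidean_space \<Rightarrow> complex) \<Rightarrow> 'a \<Rightarrow> complex" where
  "fourier f \<xi> = (\<integral>s. f s * exp (\<i> * of_real (s \<bullet> \<xi>)) \<partial>mu)"

definition distr_fourier :: "'a::euclidean_space distr \<Rightarrow> 'a distr" where
  "distr_fourier T f = T (fourier f)"

definition distr_cnj :: "'a distr \<Rightarrow> 'a distr" where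
  "distr_cnj T f = cnj (T (\<lambda>x. cnj (f x)))"

text \<open>If \<open>T\<close> is the generalized function \<open>a(s)\<close>, then this is \<open>a(p - \<alpha>)\<close>
  as a generalized function of \<open>p\<close>.\<close>

definition distr_translate :: "'a::plus \<Rightarrow> 'a distr \<Rightarrow> 'a distr" where
  "distr_translate \<alpha> T f = T (\<lambda>s. f (s + \<alpha>))"


section \<open>The family of planes \<open>y = u(t)x + \<alpha>\<close>\<close>

definition polynomial_matrix :: "(real^'k \<Rightarrow> real^'k^'l) \<Rightarrow> bool" where
  "polynomial_matrix u \<longleftrightarrow> (\<forall>i j. real_polynomial_function (\<lambda>t. u t $ i $ j))"

text \<open>The differential of \<open>t \<mapsto> u t\<close> has maximal rank at every point.\<close>

definition nonsingular_map ::
    "('a::real_normed_vector \<Rightarrow> 'b::real_normed_vector) \<Rightarrow> bool" where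
  "nonsingular_map u \<longleftrightarrow> (\<forall>t. u differentiable (at t) \<and> inj (frechet_derivative u (at t)))"

text \<open>The number of solutions is counted in \<open>ennreal\<close>, with value \<open>\<infinity>\<close> for infinitely
  many solutions.\<close>

definition crofton ::
    "(real^'k \<Rightarrow> real^'k^'l) \<Rightarrow> real^'k \<Rightarrow> real^'l \<Rightarrow> ennreal" where
  "crofton u \<eta> \<xi> = emeasure (count_space UNIV) {t. \<eta> = - (\<xi> v* u t)}"

definition omega ::
    "(real^'k \<Rightarrow> real^'k^'l) \<Rightarrow> real^'l \<Rightarrow> real^'k \<Rightarrow> real" where
  "omega u \<xi> t = det (matrix (frechet_derivative (\<lambda>t. \<xi> v* u t) (at t)))"


section \<open>The integral transform and its inversion\<close>

text \<open>A generalized function \<open>a(s,t)\<close> is a family of tempered distributions \<open>a t\<close> in \<open>s\<close>.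
  The following says that its Fourier transform with respect to \<open>s\<close> is the ordinary function
  \<open>A(\<xi>,t)\<close>.\<close>

definition partial_fourier_is_function ::
    "(real^'k \<Rightarrow> (real^'l) distr) \<Rightarrow> (real^'l \<Rightarrow> real^'k \<Rightarrow> complex) \<Rightarrow> bool" where
  "partial_fourier_is_function a A \<longleftrightarrow>
     (\<lambda>(\<xi>, t). A \<xi> t) \<in> borel_measurable lebesgue \<and>
     (AE t in lebesgue. tempered_distribution (a t) \<and>
        distr_is_function (distr_fourier (a t)) (\<lambda>\<xi>. A \<xi> t))"

definition J_transform ::
    "(real^'k \<Rightarrow> real^'k^'l) \<Rightarrow> (real^'k \<Rightarrow> (real^'l) distr) \<Rightarrow>
     ((real^'k) \<times> (real^'l) \<Rightarrow> complex) \<Rightarrow> real^'l \<Rightarrow> real^'k \<Rightarrow> complex" where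
  "J_transform u a f \<alpha> t =
     distr_translate \<alpha> (a t) (\<lambda>p. \<integral>x. f (x, u t *v x + p) \<partial>mu)"

text \<open>The kernel is $V(s,t) = \int M(\xi,t)\,e^{i\langle s,\xi\rangle}\,d\mu(\xi)$, in the sense of
  tempered distributions in \<open>s\<close>.\<close>

definition kernel_has_spectrum ::
    "(real^'k \<Rightarrow> (real^'l) distr) \<Rightarrow> (real^'l \<Rightarrow> real^'k \<Rightarrow> complex) \<Rightarrow> bool" where
  "kernel_has_spectrum V M \<longleftrightarrow>
     (\<lambda>(\<xi>, t). M \<xi> t) \<in> borel_measurable lebesgue \<and>
     (AE t in lebesgue. \<forall>f\<in>schwartz.
        has_bochner_integral mu (\<lambda>\<xi>. M \<xi> t * fourier f \<xi>) (V t f))"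

text \<open>The expression $\int \phi(\alpha,t)\,V(y-u(t)x-\alpha,t)\,d\mu(\alpha)\,d\mu(t)$ is defined and
  has value \<open>c\<close>, where the expression stands for
  $\int\int \widetilde\phi(-\xi,t)\,M(\xi,t)\,e^{i\langle y-u(t)x,\xi\rangle}\,d\mu(\xi)\,d\mu(t)$ with
  $\widetilde\phi$ the Fourier transform of $\phi$ in $\alpha$. In general $\phi(\cdot,t)$ is not
  integrable, so its Fourier transform is taken in the sense of tempered distributions.
  Both $\widetilde\phi$ and $M$ are determined almost everywhere, so \<open>c\<close> is unique.\<close>

definition has_kernel_integral ::
    "(real^'k \<Rightarrow> real^'k^'l) \<Rightarrow> (real^'l \<Rightarrow> real^'k \<Rightarrow> complex) \<Rightarrow>
     (real^'k \<Rightarrow> (real^'l) distr) \<Rightarrow> real^'k \<Rightarrow> real^'l \<Rightarrow> complex \<Rightarrow> bool" where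
  "has_kernel_integral u \<phi> V x y c \<longleftrightarrow>
     (\<exists>T \<Phi> M.
        (AE t in lebesgue. distr_is_function (T t) (\<lambda>\<alpha>. \<phi> \<alpha> t)) \<and>
        partial_fourier_is_function T \<Phi> \<and>
        kernel_has_spectrum V M \<and>
        has_bochner_integral mu
          (\<lambda>(\<xi>, t). \<Phi> (- \<xi>) t * M \<xi> t * exp (\<i> * of_real ((y - u t *v x) \<bullet> \<xi>))) c)"

text \<open>The transform \<open>J_transform u a\<close> is a generalized Fourier transform: inversion formula
  and Plancherel formula. The integral in the Plancherel formula converges absolutely.\<close>

definition generalized_fourier_transform ::
    "(real^'k \<Rightarrow> real^'k^'l) \<Rightarrow> (real^'k \<Rightarrow> (real^'l) distr) \<Rightarrow> bool" where
  "generalized_fourier_transform u a \<longleftrightarrow>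
     (\<forall>f\<in>schwartz. \<forall>x y.
        has_kernel_integral u (J_transform u a f) (\<lambda>t. distr_cnj (a t)) x y (f (x, y))) \<and>
     (\<forall>f\<in>schwartz. \<forall>g\<in>schwartz.
        has_bochner_integral mu
          (\<lambda>(\<alpha>, t). J_transform u a f \<alpha> t * cnj (J_transform u a g \<alpha> t))
          (\<integral>z. f z * cnj (g z) \<partial>mu))"

end

theory Submission
  imports Defs "HOL-Probability.Characteristic_Functions" "HOL-Probability.Sinc_Integral"
begin

text \<open>On the Fourier side the transform is multiplication by \<open>a~(\<xi>, t)\<close>. By the projection-slice theorem,
  the Fourier transform in \<open>p\<close> of the integral of \<open>f\<close> over the plane \<open>y = u(t)x + p\<close> is the restriction
  of the Fourier transform of \<open>f\<close> to the frequencies \<open>(- \<xi> u(t), \<xi>)\<close>. For fixed \<open>\<xi>\<close> the map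
  \<open>t \<mapsto> - \<xi> u(t)\<close> covers almost every frequency \<open>\<eta>\<close> exactly \<open>Cr(\<eta>, \<xi>)\<close> times, so the area formula says
  that it transports \<open>|a~|\<^sup>2 dt = |\<omega>| / Cr dt\<close> to Lebesgue measure. Inversion and Plancherel for the
  transform thus reduce to those for the Fourier transform. Since \<open>a~\<close> is only measurable, Plancherel in
  \<open>\<alpha>\<close> is needed for arbitrary functions in \<open>L\<^sup>1 \<inter> L\<^sup>2\<close>.\<close>

section \<open>Normalized Borel measure\<close>

text \<open>Only the modulus of \<open>A\<close> is prescribed, and only the modulus can matter: the
  inversion formula multiplies \<open>A\<close> by its conjugate, and Plancherel squares its norm.
  Since neither phase nor regularity is controlled, the transform of a Schwartz function need not
  decay in \<alpha> or be smooth. Two facts remain. For almost every t the product of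
  \<open>A\<close> with a Schwartz function of \<xi> is integrable, which is part of
  \<open>distr_is_function\<close>; and its product with the restricted transform of f is square
  integrable for almost every t, by Tonelli from the transported measure. The first makes the
  transform an honest bounded function of \<alpha>, the second gives it a square norm.

  The frequency (-\<xi>u(t), \<xi>) is forced: its pairing with (x, y) is the phase of the kernel at
  y - u(t)x.

  All integrals are computed with a Borel measure whose completion is \<open>mu\<close>. Products of
  such Borel measures are again of this kind (\<open>bmu_prod\<close>), so Fubini applies directly;
  statements about \<open>mu\<close> and Lebesgue measurable spectra are reached through Borel
  representatives.\<close>

definition bmu :: "'a::euclidean_space measure" where
  "bmu = density lborel (\<lambda>_. ennreal ((2 * pi) powr (- real DIM('a) / 2)))"

lemma sets_bmu [simp, measurable_cong]: "sets bmu = sets borel"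
  and space_bmu [simp]: "space bmu = UNIV"
  by (simp_all add: bmu_def)

lemma measurable_bmu [simp]: "measurable bmu M = measurable borel M"
  by (intro measurable_cong_sets) auto

lemma mu_eq_completion: "mu = completion bmu"
  unfolding mu_def bmu_def by (intro completion_density_eq[symmetric]) auto

lemma AE_bmu_iff: "(AE x in bmu. P x) \<longleftrightarrow> (AE x in lborel. P x)"
  unfolding bmu_def by (subst AE_density) auto

lemma AE_mu_iff: "(AE x in mu. P x) \<longleftrightarrow> (AE x in lborel. P x)"
  unfolding mu_eq_completion AE_completion_iff AE_bmu_iff ..

lemma sets_mu [simp, measurable_cong]: "sets mu = sets lebesgue"
  by (simp add: mu_def)

lemma borel_measurable_mu_iff: "f \<in> borel_measurable mu \<longleftrightarrow> f \<in> borel_measurable lebesgue"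
  by (simp add: mu_def)

lemma has_bochner_integral_mu:
  fixes f :: "'a::euclidean_space \<Rightarrow> 'b::{banach, second_countable_topology}"
  assumes "has_bochner_integral bmu f c"
  shows "has_bochner_integral mu f c"
proof -
  have "f \<in> borel_measurable bmu" using assms by (rule borel_measurable_has_bochner_integral)
  then show ?thesis
    using assms unfolding has_bochner_integral_iff mu_eq_completion
    by (simp only: integrable_completion integral_completion)
qed

text \<open>The return from the Borel measure to \<open>mu\<close>: completeness makes
  \<open>f\<close> measurable as soon as it agrees almost everywhere with \<open>g\<close>, so no
  measurability of \<open>f\<close> has to be assumed.\<close>

lemma has_bochner_integral_mu_AE:
  fixes f :: "'a::euclidean_space \<Rightarrow> 'b::euclidean_space"
  assumes "has_bochner_integral bmu g c" and "AE x in lborel. f x = g x"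
  shows "has_bochner_integral mu f c"
proof -
  have g: "has_bochner_integral mu g c" by (rule has_bochner_integral_mu) fact
  have ae: "AE x in mu. f x = g x" using assms(2) by (simp add: AE_mu_iff)
  have gm: "g \<in> borel_measurable lebesgue"
    using borel_measurable_has_bochner_integral[OF g] by (simp add: borel_measurable_mu_iff)
  have "f \<in> borel_measurable lebesgue"
    using assms(2) by (intro borel_measurable_AE[OF gm]) (auto simp: AE_completion_iff eq_commute)
  then have "f \<in> borel_measurable mu" "g \<in> borel_measurable mu"
    using gm by (simp_all only: borel_measurable_mu_iff)
  then have "has_bochner_integral mu f c \<longleftrightarrow> has_bochner_integral mu g c"
    using ae by (rule has_bochner_integral_cong_AE)
  then show ?thesis using g by simp
qed

lemma integral_mu_eq:
  fixes f :: "'a::euclidean_space \<Rightarrow> 'b::{banach, second_countable_topology}"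
  shows "f \<in> borel_measurable borel \<Longrightarrow> integral\<^sup>L mu f = integral\<^sup>L bmu f"
  by (simp add: mu_eq_completion integral_completion)

lemma bmu_integral_eq:
  fixes f :: "'a::euclidean_space \<Rightarrow> 'b::{banach, second_countable_topology}"
  assumes "f \<in> borel_measurable borel"
  shows "integral\<^sup>L bmu f = (2 * pi) powr (- real DIM('a) / 2) *\<^sub>R integral\<^sup>L lborel f"
  using assms unfolding bmu_def by (subst integral_density) auto

lemma bmu_integrable_iff:
  fixes f :: "'a::euclidean_space \<Rightarrow> 'b::{banach, second_countable_topology}"
  shows "integrable bmu f \<longleftrightarrow> integrable lborel f"
proof (cases "f \<in> borel_measurable borel")
  case True
  let ?c = "(2 * pi) powr (- real DIM('a) / 2)"
  have "integrable bmu f \<longleftrightarrow> integrable lborel (\<lambda>x. ?c *\<^sub>R f x)"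
    using True unfolding bmu_def by (subst integrable_density) auto
  also have "\<dots> \<longleftrightarrow> integrable lborel f"
    using integrable_scaleR_right[of "inverse ?c" lborel "\<lambda>x. ?c *\<^sub>R f x"]
      integrable_scaleR_right[of ?c lborel f] by auto
  finally show ?thesis .
next
  case False
  then show ?thesis by (auto simp: integrable_iff_bounded)
qed

lemma sigma_finite_bmu: "sigma_finite_measure (bmu :: 'a::euclidean_space measure)"
  unfolding bmu_def by (subst sigma_finite_measure.sigma_finite_iff_density_finite'[OF sigma_finite_lborel]) auto

interpretation bmu: sigma_finite_measure bmu
  by (rule sigma_finite_bmu)

interpretation bmu_pair: pair_sigma_finite bmu bmu ..

lemma bmu_prod:
  "bmu \<Otimes>\<^sub>M bmu = (bmu :: ('a::euclidean_space \<times> 'b::euclidean_space) measure)"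
proof -
  have "bmu \<Otimes>\<^sub>M bmu = density (lborel \<Otimes>\<^sub>M lborel :: ('a \<times> 'b) measure)
      (\<lambda>(x, y). ennreal ((2 * pi) powr (- real DIM('a) / 2)) * ennreal ((2 * pi) powr (- real DIM('b) / 2)))"
    unfolding bmu_def using sigma_finite_bmu[where 'a='b]
    by (intro pair_measure_density) (auto simp: bmu_def sigma_finite_lborel)
  also have "\<dots> = bmu"
    unfolding bmu_def lborel_prod
    by (simp add: ennreal_mult[symmetric] powr_add[symmetric] add_divide_distrib diff_divide_distrib split_beta')
  finally show ?thesis .
qed

section \<open>Translations, dilations and reflections\<close>

lemma bmu_affine:
  assumes "c \<noteq> 0"
  shows "bmu = density (distr bmu borel (\<lambda>x::'a::euclidean_space. t + c *\<^sub>R x)) (\<lambda>_. ennreal (\<bar>c\<bar> ^ DIM('a)))"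
proof -
  let ?k = "ennreal ((2 * pi) powr (- real DIM('a) / 2))"
  have *: "distr bmu borel (\<lambda>x::'a. t + c *\<^sub>R x)
      = density (distr lborel borel (\<lambda>x::'a. t + c *\<^sub>R x)) (\<lambda>_. ?k)"
    unfolding bmu_def by (subst density_distr) (auto simp: o_def)
  have "bmu = density (density (distr lborel borel (\<lambda>x::'a. t + c *\<^sub>R x)) (\<lambda>_. ennreal (\<bar>c\<bar> ^ DIM('a)))) (\<lambda>_. ?k)"
    unfolding bmu_def lborel_affine[OF assms, of t, symmetric] ..
  also have "\<dots> = density (density (distr lborel borel (\<lambda>x::'a. t + c *\<^sub>R x)) (\<lambda>_. ?k)) (\<lambda>_. ennreal (\<bar>c\<bar> ^ DIM('a)))"
    by (subst (1 2) density_density_eq) (auto simp: mult.commute)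
  finally show ?thesis unfolding * .
qed

lemma integral_bmu_affine:
  fixes f :: "'a::euclidean_space \<Rightarrow> 'b::{banach, second_countable_topology}"
  assumes "c \<noteq> 0" and [measurable]: "f \<in> borel_measurable borel"
  shows "(\<integral>x. f x \<partial>bmu) = \<bar>c\<bar> ^ DIM('a) *\<^sub>R (\<integral>x. f (t + c *\<^sub>R x) \<partial>bmu)"
  by (subst bmu_affine[OF assms(1), of t]) (simp add: integral_density integral_distr)

lemma integrable_bmu_affine:
  fixes f :: "'a::euclidean_space \<Rightarrow> 'b::{banach, second_countable_topology}"
  assumes "c \<noteq> 0" and f: "integrable bmu f"
  shows "integrable bmu (\<lambda>x. f (t + c *\<^sub>R x))"
proof -
  have [measurable]: "f \<in> borel_measurable borel" using f by auto
  have "integrable (density (distr bmu borel (\<lambda>x. t + c *\<^sub>R x)) (\<lambda>_. ennreal (\<bar>c\<bar> ^ DIM('a)))) f"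
    using f bmu_affine[OF assms(1), of t] by simp
  then show ?thesis
    using assms(1) integrable_scaleR_right[of "inverse (\<bar>c\<bar> ^ DIM('a))" bmu "\<lambda>x. \<bar>c\<bar> ^ DIM('a) *\<^sub>R f (t + c *\<^sub>R x)"]
    by (subst (asm) integrable_density) (auto simp: integrable_distr_eq)
qed

lemma nn_integral_bmu_affine:
  assumes "c \<noteq> 0" and [measurable]: "f \<in> borel_measurable borel"
  shows "(\<integral>\<^sup>+x. f x \<partial>bmu) = ennreal (\<bar>c\<bar> ^ DIM('a)) * (\<integral>\<^sup>+x. f (t + c *\<^sub>R (x::'a::euclidean_space)) \<partial>bmu)"
  by (subst bmu_affine[OF assms(1), of t]) (simp add: nn_integral_density nn_integral_distr nn_integral_cmult)

lemma bmu_translate: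
  fixes f :: "'a::euclidean_space \<Rightarrow> 'b::{banach, second_countable_topology}"
  assumes "f \<in> borel_measurable borel"
  shows "(\<integral>x. f (t + x) \<partial>bmu) = (\<integral>x. f x \<partial>bmu)"
  using integral_bmu_affine[of 1 f t] assms by simp

lemma bmu_reflect:
  fixes f :: "'a::euclidean_space \<Rightarrow> 'b::{banach, second_countable_topology}"
  assumes "f \<in> borel_measurable borel"
  shows "(\<integral>x. f (- x) \<partial>bmu) = (\<integral>x. f x \<partial>bmu)"
  using integral_bmu_affine[of "-1" f 0] assms by simp

lemma integrable_bmu_translate:
  fixes f :: "'a::euclidean_space \<Rightarrow> 'b::{banach, second_countable_topology}"
  shows "integrable bmu f \<Longrightarrow> integrable bmu (\<lambda>x. f (t + x))"
  using integrable_bmu_affine[of 1 f t] by simp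

lemma integrable_bmu_reflect:
  fixes f :: "'a::euclidean_space \<Rightarrow> 'b::{banach, second_countable_topology}"
  shows "integrable bmu f \<Longrightarrow> integrable bmu (\<lambda>x. f (- x))"
  using integrable_bmu_affine[of "-1" f 0] by simp

subsection \<open>Product integrands and Gaussians\<close>

lemma
  fixes f :: "'a::euclidean_space \<Rightarrow> real \<Rightarrow> 'b::{real_normed_field, banach, second_countable_topology}"
  assumes f: "\<And>b. b \<in> Basis \<Longrightarrow> integrable lborel (f b)"
  shows integrable_lborel_prod: "integrable lborel (\<lambda>x::'a. \<Prod>b\<in>Basis. f b (x \<bullet> b))"
    and integral_lborel_prod:
      "(\<integral>x. (\<Prod>b\<in>Basis. f b (x \<bullet> b)) \<partial>lborel) = (\<Prod>b\<in>Basis. (\<integral>x. f b x \<partial>lborel))"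
proof -
  interpret product_sigma_finite "\<lambda>_::'a. lborel :: real measure" ..
  have [measurable]: "f b \<in> borel_measurable borel" if "b \<in> Basis" for b
    using f[OF that] by auto
  have coord: "(\<Sum>b'\<in>Basis. w b' *\<^sub>R b') \<bullet> b = w b" if "b \<in> Basis" for w and b :: 'a
    using that by (simp add: inner_sum_left inner_Basis if_distrib sum.delta cong: if_cong)
  have m: "(\<lambda>f. \<Sum>b\<in>Basis. f b *\<^sub>R b) \<in> (\<Pi>\<^sub>M b\<in>Basis. (lborel :: real measure)) \<rightarrow>\<^sub>M (borel :: 'a measure)"
    by measurable
  have m2: "(\<lambda>x::'a. \<Prod>b\<in>Basis. f b (x \<bullet> b)) \<in> borel_measurable borel"
    by measurable
  have int: "integrable (\<Pi>\<^sub>M b\<in>Basis. lborel) (\<lambda>x. \<Prod>b\<in>Basis. f b (x b))"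
    using f by (intro product_integrable_prod) auto
  show "integrable lborel (\<lambda>x::'a. \<Prod>b\<in>Basis. f b (x \<bullet> b))"
    unfolding lborel_eq[where 'a='a]
    by (subst integrable_distr_eq[OF m m2]) (use int in \<open>simp add: coord\<close>)
  show "(\<integral>x. (\<Prod>b\<in>Basis. f b (x \<bullet> b)) \<partial>lborel) = (\<Prod>b\<in>Basis. (\<integral>x. f b x \<partial>lborel))"
    unfolding lborel_eq[where 'a='a]
    by (subst integral_distr[OF m m2]) (use f in \<open>simp add: coord product_integral_prod\<close>)
qed

text \<open>With this variance the function is its own Fourier transform and has mass 1 for
  \<open>bmu\<close>, so regularizations by it carry no constants.\<close>

definition gauss :: "'a::euclidean_space \<Rightarrow> real" where
  "gauss x = exp (- (x \<bullet> x) / 2)"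

lemma gauss_measurable [measurable]: "gauss \<in> borel_measurable borel"
  unfolding gauss_def by measurable

lemma gauss_pos: "0 < gauss x" and gauss_le_1: "gauss x \<le> 1"
  by (auto simp: gauss_def)

lemma gauss_uminus [simp]: "gauss (- x) = gauss x"
  by (simp add: gauss_def)

lemma continuous_gauss: "continuous_on UNIV (gauss :: 'a::euclidean_space \<Rightarrow> real)"
  unfolding gauss_def by (intro continuous_intros) auto

text \<open>The integrand factors over the coordinates, and each factor integrates to
  \<open>sqrt (2 * pi)\<close> times the characteristic function of the standard normal
  distribution; the \<open>DIM('a)\<close> square roots cancel the normalization of
  \<open>bmu\<close>.\<close>

lemma
  fixes \<xi> :: "'a::euclidean_space"
  shows integrable_gauss_exp: "integrable bmu (\<lambda>x. of_real (gauss x) * exp (\<i> * of_real (x \<bullet> \<xi>)))"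
    and integral_gauss_exp: "(\<integral>x. of_real (gauss x) * exp (\<i> * of_real (x \<bullet> \<xi>)) \<partial>bmu) = of_real (gauss \<xi>)"
proof -
  define f where "f b x = of_real (exp (- x\<^sup>2 / 2)) * exp (\<i> * of_real (x * (\<xi> \<bullet> b)))" for b :: 'a and x
  have fs: "f b x = sqrt (2 * pi) *\<^sub>R (std_normal_density x *\<^sub>R iexp ((\<xi> \<bullet> b) * x))" for b x
    by (simp add: f_def std_normal_density_def scaleR_conv_of_real mult_ac)
  have ib: "integrable lborel (\<lambda>x. std_normal_density x *\<^sub>R iexp (t * x))" for t :: real
    using integrable_normal_density[of 1 0]
    by (rule Bochner_Integration.integrable_bound) auto
  have intf: "integrable lborel (f b)" for b
    unfolding fs[abs_def] by (intro integrable_scaleR_right ib)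
  have fi: "(\<integral>x. f b x \<partial>lborel) = of_real (sqrt (2 * pi) * exp (- (\<xi> \<bullet> b)\<^sup>2 / 2))" for b
  proof -
    have "char std_normal_distribution t = (\<integral>x. std_normal_density x *\<^sub>R iexp (t * x) \<partial>lborel)" for t
      unfolding char_def by (subst integral_density) auto
    from this[of "\<xi> \<bullet> b"] have "(\<integral>x. f b x \<partial>lborel) = sqrt (2 * pi) *\<^sub>R char std_normal_distribution (\<xi> \<bullet> b)"
      unfolding fs[abs_def] integral_scaleR_right by simp
    also have "\<dots> = of_real (sqrt (2 * pi) * exp (- (\<xi> \<bullet> b)\<^sup>2 / 2))"
      by (simp add: char_std_normal_distribution scaleR_conv_of_real)
    finally show ?thesis .
  qed
  have inner: "x \<bullet> y = (\<Sum>b\<in>Basis. (x \<bullet> b) * (y \<bullet> b))" for x y :: 'a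
    by (rule euclidean_inner)
  have prod: "of_real (gauss x) * exp (\<i> * of_real (x \<bullet> \<xi>)) = (\<Prod>b\<in>Basis. f b (x \<bullet> b))" for x
  proof -
    have "(\<Prod>b\<in>Basis. f b (x \<bullet> b)) =
      (\<Prod>b\<in>Basis. of_real (exp (- (x \<bullet> b)\<^sup>2 / 2))) * (\<Prod>b\<in>Basis. exp (\<i> * of_real ((x \<bullet> b) * (\<xi> \<bullet> b))))"
      by (simp add: f_def prod.distrib)
    also have "(\<Prod>b\<in>Basis. exp (\<i> * of_real ((x \<bullet> b) * (\<xi> \<bullet> b)))) = exp (\<i> * of_real (x \<bullet> \<xi>))"
      by (simp only: exp_sum[symmetric] finite_Basis of_real_sum sum_distrib_left inner[of x \<xi>])
    also have "(\<Prod>b\<in>Basis. complex_of_real (exp (- (x \<bullet> b)\<^sup>2 / 2))) = of_real (gauss x)"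
      by (simp only: of_real_prod[symmetric] exp_sum[symmetric] finite_Basis gauss_def inner[of x x] power2_eq_square
          sum_negf[symmetric] sum_divide_distrib)
    finally show ?thesis by simp
  qed
  show "integrable bmu (\<lambda>x. of_real (gauss x) * exp (\<i> * of_real (x \<bullet> \<xi>)))"
    unfolding bmu_integrable_iff prod by (intro integrable_lborel_prod intf)
  have "(\<integral>x. of_real (gauss x) * exp (\<i> * of_real (x \<bullet> \<xi>)) \<partial>bmu) =
     ((2 * pi) powr (- real DIM('a) / 2)) *\<^sub>R (\<Prod>b\<in>Basis. of_real (sqrt (2 * pi) * exp (- (\<xi> \<bullet> b)\<^sup>2 / 2)))"
    using intf
    by (subst bmu_integral_eq, measurable) (simp only: prod integral_lborel_prod fi)
  also have "(\<Prod>b\<in>Basis. complex_of_real (sqrt (2 * pi) * exp (- (\<xi> \<bullet> b)\<^sup>2 / 2))) =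
     of_real (sqrt (2 * pi) ^ DIM('a) * gauss \<xi>)"
    by (simp only: of_real_prod[symmetric] prod.distrib exp_sum[symmetric] finite_Basis gauss_def inner[of \<xi> \<xi>]
        power2_eq_square sum_negf[symmetric] sum_divide_distrib prod_constant)
  also have "sqrt (2 * pi) ^ DIM('a) = (2 * pi) powr (real DIM('a) / 2)"
    by (simp add: powr_half_sqrt[symmetric] powr_powr powr_realpow[symmetric])
  finally have "(\<integral>x. of_real (gauss x) * exp (\<i> * of_real (x \<bullet> \<xi>)) \<partial>bmu) =
     of_real ((2 * pi) powr (- real DIM('a) / 2) * ((2 * pi) powr (real DIM('a) / 2) * gauss \<xi>))"
    by (simp only: scaleR_conv_of_real of_real_mult)
  also have "(2 * pi) powr (- real DIM('a) / 2) * ((2 * pi) powr (real DIM('a) / 2) * gauss \<xi>) = gauss \<xi>"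
    by (simp only: mult.assoc[symmetric] powr_add[symmetric]) simp
  finally show "(\<integral>x. of_real (gauss x) * exp (\<i> * of_real (x \<bullet> \<xi>)) \<partial>bmu) = of_real (gauss \<xi>)" .
qed

lemma
  shows integrable_gauss: "integrable bmu (gauss :: 'a::euclidean_space \<Rightarrow> real)"
    and integral_gauss: "(\<integral>x. gauss (x::'a) \<partial>bmu) = 1"
proof -
  have "integrable bmu (\<lambda>x::'a. complex_of_real (gauss x))"
    using integrable_gauss_exp[of "0::'a"] by simp
  then show *: "integrable bmu (gauss :: 'a \<Rightarrow> real)"
    by (subst (asm) complex_of_real_integrable_eq)
  have "(\<integral>x. complex_of_real (gauss (x::'a)) \<partial>bmu) = 1"
    using integral_gauss_exp[of "0::'a"] by (simp add: gauss_def)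
  then show "(\<integral>x. gauss (x::'a) \<partial>bmu) = 1"
    by simp
qed

subsection \<open>An integrable polynomial weight\<close>

text \<open>A product of one-dimensional weights rather than a power of the norm, so that
  integrability follows coordinate by coordinate. Decay of order \<open>2 * DIM('a)\<close>, two for
  each coordinate, is enough to be dominated by it.\<close>

definition weight :: "'a::euclidean_space \<Rightarrow> real" where
  "weight x = (\<Prod>b\<in>Basis. inverse (1 + (x \<bullet> b)\<^sup>2))"

lemma integrable_weight: "integrable bmu (weight :: 'a::euclidean_space \<Rightarrow> real)"
proof -
  have "integrable lborel (\<lambda>x::real. inverse (1 + x\<^sup>2))"
    using integrable_inverse_1_plus_square by (simp add: set_integrable_def einterval_def)
  then show ?thesis
    unfolding weight_def bmu_integrable_iff by (intro integrable_lborel_prod[where f="\<lambda>_ x. inverse (1 + x\<^sup>2)"])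
qed

lemma weight_lower: "1 \<le> weight x * (1 + norm x) ^ (2 * DIM('a))" for x :: "'a::euclidean_space"
proof -
  have "(\<Prod>b\<in>(Basis::'a set). 1 + (x \<bullet> b)\<^sup>2) \<le> (\<Prod>b\<in>(Basis::'a set). (1 + norm x)\<^sup>2)"
  proof (intro prod_mono conjI)
    fix b :: 'a assume "b \<in> Basis"
    then have "\<bar>x \<bullet> b\<bar> \<le> norm x" by (rule Basis_le_norm)
    then have "(x \<bullet> b)\<^sup>2 \<le> (norm x)\<^sup>2" using abs_le_square_iff[of "x \<bullet> b" "norm x"] by simp
    then show "1 + (x \<bullet> b)\<^sup>2 \<le> (1 + norm x)\<^sup>2" by (simp add: power2_sum add_increasing2)
  qed simp
  also have "\<dots> = (1 + norm x) ^ (2 * DIM('a))" by (simp add: power_mult)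
  finally have le: "(\<Prod>b\<in>(Basis::'a set). 1 + (x \<bullet> b)\<^sup>2) \<le> (1 + norm x) ^ (2 * DIM('a))" .
  have pos: "0 < (\<Prod>b\<in>(Basis::'a set). 1 + (x \<bullet> b)\<^sup>2)"
    by (intro prod_pos) (auto intro: add_pos_nonneg)
  have "weight x = inverse (\<Prod>b\<in>(Basis::'a set). 1 + (x \<bullet> b)\<^sup>2)"
    by (simp add: weight_def prod_inversef[symmetric] o_def)
  then show ?thesis using le pos by (simp add: field_simps)
qed

lemma weight_pos: "0 < weight x"
  unfolding weight_def by (intro prod_pos) (auto intro: add_pos_nonneg)

lemma le_weightI:
  fixes x :: "'a::euclidean_space"
  assumes "(1 + norm x) ^ (2 * DIM('a)) * r \<le> C" "0 \<le> r"
  shows "r \<le> C * weight x"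
proof -
  have "r \<le> (weight x * (1 + norm x) ^ (2 * DIM('a))) * r"
    using mult_right_mono[OF weight_lower[of x] assms(2)] by simp
  also have "\<dots> \<le> weight x * C"
    using mult_left_mono[OF assms(1), of "weight x"] weight_pos[of x] by (simp add: mult_ac)
  finally show ?thesis by (simp add: mult.commute)
qed

lemma integrable_rapid:
  fixes f :: "'a::euclidean_space \<Rightarrow> 'b::{banach, second_countable_topology}"
  assumes [measurable]: "f \<in> borel_measurable borel"
    and le: "\<And>x. (1 + norm x) ^ (2 * DIM('a)) * norm (f x) \<le> C"
  shows "integrable bmu f" and "(\<integral>x. norm (f x) \<partial>bmu) \<le> C * (\<integral>x. weight (x::'a) \<partial>bmu)"
proof -
  have b: "norm (f x) \<le> C * weight x" for x
    using le by (rule le_weightI) simp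
  have i: "integrable bmu (\<lambda>x. C * weight (x::'a))" by (intro integrable_mult_right integrable_weight)
  show f: "integrable bmu f"
    using i by (rule Bochner_Integration.integrable_bound) (auto intro: b order_trans[OF _ abs_ge_self])
  have "(\<integral>x. norm (f x) \<partial>bmu) \<le> (\<integral>x. C * weight (x::'a) \<partial>bmu)"
    using f i b by (intro integral_mono) auto
  then show "(\<integral>x. norm (f x) \<partial>bmu) \<le> C * (\<integral>x. weight (x::'a) \<partial>bmu)" by simp
qed

section \<open>Schwartz functions\<close>

text \<open>\<open>pderivs\<close> applies the head of the list last, so the final entry is the
  innermost derivative; peeling it off leaves the other derivatives acting on a first derivative of
  \<open>f\<close>.\<close>

lemma pderivs_append: "pderivs (bs @ [b]) f = pderivs bs (\<lambda>x. frechet_derivative f (at x) b)"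
  by (induction bs) auto

text \<open>The Schwartz space is the largest class of rapidly decreasing differentiable functions that is
  closed under the basic directional derivatives.\<close>

lemma schwartz_coinduct [consumes 1, case_names differentiable decay deriv]:
  assumes "f \<in> X"
    and diff: "\<And>f x. f \<in> X \<Longrightarrow> f differentiable (at x)"
    and decay: "\<And>f N. f \<in> X \<Longrightarrow> \<exists>C. \<forall>x. (1 + norm x) ^ N * norm (f x) \<le> C"
    and deriv: "\<And>f b. f \<in> X \<Longrightarrow> b \<in> Basis \<Longrightarrow> (\<lambda>x. frechet_derivative f (at x) b) \<in> X"
  shows "f \<in> (schwartz :: ('a::euclidean_space \<Rightarrow> complex) set)"
proof -
  have "pderivs bs f \<in> X" if "set bs \<subseteq> Basis" for bs
    using that \<open>f \<in> X\<close>
    by (induction bs arbitrary: f rule: rev_induct) (auto simp: pderivs_append deriv)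
  moreover have "bounded (range (\<lambda>x. (1 + norm x) ^ N * norm (g x)))" if g: "g \<in> X" for g :: "'a \<Rightarrow> complex" and N :: nat
  proof -
    obtain C where "\<And>x. (1 + norm x) ^ N * norm (g x) \<le> C" using decay[OF g] by blast
    then show ?thesis by (intro boundedI[of _ C]) auto
  qed
  ultimately show ?thesis using diff by (auto simp: schwartz_def)
qed

lemma schwartz_differentiable: "f \<in> schwartz \<Longrightarrow> f differentiable (at x)"
proof -
  assume "f \<in> schwartz"
  then have "pderivs [] f differentiable (at x)"
    unfolding schwartz_def by (auto simp del: pderivs.simps)
  then show ?thesis by simp
qed

lemma schwartz_has_derivative: "f \<in> schwartz \<Longrightarrow> (f has_derivative frechet_derivative f (at x)) (at x)"
  using schwartz_differentiable frechet_derivative_works by blast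

lemma schwartz_decay:
  assumes "f \<in> schwartz" obtains C where "\<And>x. (1 + norm x) ^ N * norm (f x) \<le> C"
proof -
  have "bounded (range (\<lambda>x. (1 + norm x) ^ N * norm (pderivs [] f x)))"
    using assms unfolding schwartz_def by (auto simp del: pderivs.simps)
  then obtain C where "\<And>x. norm ((1 + norm x) ^ N * norm (f x)) \<le> C"
    unfolding bounded_iff by auto
  then show ?thesis using that by (metis abs_le_D1 real_norm_def)
qed

lemma schwartz_deriv:
  assumes "f \<in> schwartz" "b \<in> Basis"
  shows "(\<lambda>x. frechet_derivative f (at x) b) \<in> schwartz"
  using assms unfolding schwartz_def by (auto simp flip: pderivs_append)

lemma schwartz_continuous: "f \<in> schwartz \<Longrightarrow> continuous_on A f"
  by (meson continuous_at_imp_continuous_on differentiable_imp_continuous_within schwartz_differentiable)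

lemma schwartz_measurable: "f \<in> schwartz \<Longrightarrow> f \<in> borel_measurable borel"
  by (intro borel_measurable_continuous_onI schwartz_continuous)

lemma schwartz_integrable: "f \<in> schwartz \<Longrightarrow> integrable bmu f"
  by (meson integrable_rapid(1) schwartz_decay schwartz_measurable)

lemma schwartz_bounded:
  assumes "f \<in> schwartz" obtains B where "\<And>x. norm (f x) \<le> B"
  using schwartz_decay[OF assms, of 0] by auto

section \<open>Operations preserving the Schwartz space\<close>

lemma schwartz_add: 
  assumes "f \<in> schwartz" "g \<in> schwartz" shows "(\<lambda>x. f x + g x) \<in> schwartz"
proof -
  define X where "X = {\<lambda>x::'a. f x + g x | f g. f \<in> schwartz \<and> g \<in> schwartz}"
  have "(\<lambda>x. f x + g x) \<in> X" using assms by (auto simp: X_def)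
  then show ?thesis
  proof (cases rule: schwartz_coinduct)
    case (differentiable h x)
    then show ?case by (auto simp: X_def dest!: schwartz_differentiable[where x=x] intro!: differentiable_add)
  next
    case (decay h N)
    then obtain f g where h: "h = (\<lambda>x. f x + g x)" "f \<in> schwartz" "g \<in> schwartz" by (auto simp: X_def)
    obtain C D where "\<And>x. (1 + norm x) ^ N * norm (f x) \<le> C" "\<And>x. (1 + norm x) ^ N * norm (g x) \<le> D"
      using h by (meson schwartz_decay)
    moreover have "(1 + norm x) ^ N * norm (h x) \<le> (1 + norm x) ^ N * norm (f x) + (1 + norm x) ^ N * norm (g x)" for x
      unfolding h by (simp flip: distrib_left add: mult_left_mono norm_triangle_ineq)
    ultimately show ?case by (meson add_mono order_trans)
  next
    case (deriv h b)
    then obtain f g where h: "h = (\<lambda>x. f x + g x)" "f \<in> schwartz" "g \<in> schwartz" by (auto simp: X_def)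
    have "frechet_derivative h (at x) = (\<lambda>v. frechet_derivative f (at x) v + frechet_derivative g (at x) v)" for x
      unfolding h by (intro frechet_derivative_at[symmetric] derivative_intros schwartz_has_derivative h)
    then show ?case
      unfolding X_def
      by (intro CollectI exI[of _ "\<lambda>x. frechet_derivative f (at x) b"] exI[of _ "\<lambda>x. frechet_derivative g (at x) b"])
         (simp add: schwartz_deriv deriv(2) h(2,3))
  qed
qed

lemma schwartz_bounded_linear:
  assumes "f \<in> schwartz" and L: "bounded_linear L" shows "(\<lambda>x. L (f x)) \<in> schwartz"
proof -
  define X where "X = {\<lambda>x::'a. L (f x) | f. f \<in> schwartz}"
  have D: "((\<lambda>x. L (f x)) has_derivative (\<lambda>v. L (frechet_derivative f (at x) v))) (at x)" if "f \<in> schwartz" for f x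
    by (rule bounded_linear.has_derivative[OF L schwartz_has_derivative[OF that]])
  have "(\<lambda>x. L (f x)) \<in> X" using assms by (auto simp: X_def)
  then show ?thesis
  proof (cases rule: schwartz_coinduct)
    case (differentiable h x)
    then show ?case using D[THEN differentiableI] by (auto simp: X_def)
  next
    case (decay h N)
    then obtain f where h: "h = (\<lambda>x. L (f x))" "f \<in> schwartz" by (auto simp: X_def)
    obtain C where C: "\<And>x. (1 + norm x) ^ N * norm (f x) \<le> C"
      using h by (meson schwartz_decay)
    obtain K where K: "\<And>z. norm (L z) \<le> norm z * K" "K \<ge> 0"
      using bounded_linear.nonneg_bounded[OF L] by blast
    have "(1 + norm x) ^ N * norm (h x) \<le> C * K" for x
    proof -
      have "(1 + norm x) ^ N * norm (h x) \<le> (1 + norm x) ^ N * (norm (f x) * K)"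
        unfolding h by (intro mult_left_mono K) simp
      also have "\<dots> \<le> C * K"
        using mult_right_mono[OF C[of x] K(2)] by (simp add: mult.assoc)
      finally show ?thesis .
    qed
    then show ?case by blast
  next
    case (deriv h b)
    then obtain f where h: "h = (\<lambda>x. L (f x))" "f \<in> schwartz" by (auto simp: X_def)
    have "frechet_derivative h (at x) = (\<lambda>v. L (frechet_derivative f (at x) v))" for x
      unfolding h by (intro frechet_derivative_at[symmetric] D h)
    then show ?case using schwartz_deriv[OF _ deriv(2)] h by (auto simp: X_def)
  qed
qed

lemma schwartz_cmult: "f \<in> schwartz \<Longrightarrow> (\<lambda>x. c * f x) \<in> schwartz"
  by (rule schwartz_bounded_linear[OF _ bounded_linear_mult_right])

lemma schwartz_cnj: "f \<in> schwartz \<Longrightarrow> (\<lambda>x. cnj (f x)) \<in> schwartz"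
  by (rule schwartz_bounded_linear[OF _ bounded_linear_cnj])

lemma schwartz_zero: "(\<lambda>x. 0) \<in> (schwartz :: ('a::euclidean_space \<Rightarrow> complex) set)"
proof -
  have "(\<lambda>x. 0) \<in> {\<lambda>x::'a. 0::complex}" by simp
  then show ?thesis
    by (rule schwartz_coinduct) (auto intro!: exI[of _ 0])
qed

lemma schwartz_sum: "(\<And>i. i \<in> I \<Longrightarrow> f i \<in> schwartz) \<Longrightarrow> (\<lambda>x. \<Sum>i\<in>I. f i x) \<in> schwartz"
  by (induction I rule: infinite_finite_induct) (auto intro: schwartz_zero schwartz_add)

lemma schwartz_mult_inner:
  assumes "f \<in> schwartz" shows "(\<lambda>x. of_real (x \<bullet> c) * f x) \<in> schwartz"
proof -
  \<comment> \<open>Differentiating the linear factor leaves a term without that factor. The summand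
    \<open>g\<close> absorbs it; without it the class would not be closed under derivatives.\<close>
  define X where "X = {\<lambda>x::'a. of_real (x \<bullet> c) * f x + g x | f g. f \<in> schwartz \<and> g \<in> schwartz}"
  have "(\<lambda>x. of_real (x \<bullet> c) * f x + 0) \<in> X" unfolding X_def
    by (intro CollectI exI[of _ f] exI[of _ "\<lambda>x. 0"]) (use assms schwartz_zero in auto)
  then have "(\<lambda>x. of_real (x \<bullet> c) * f x) \<in> X" by simp
  moreover have D: "((\<lambda>x. of_real (x \<bullet> c) * f x + g x) has_derivative (\<lambda>v. (of_real (x \<bullet> c) * frechet_derivative f (at x) v +
        of_real (v \<bullet> c) * f x) + frechet_derivative g (at x) v)) (at x)"
    if fg: "f \<in> schwartz" "g \<in> schwartz" for x f g
  proof -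
    have "((\<lambda>x. complex_of_real (x \<bullet> c)) has_derivative (\<lambda>v. of_real (v \<bullet> c))) (at x)"
      by (rule has_derivative_of_real, rule has_derivative_inner_left, rule has_derivative_ident)
    then show ?thesis
      by (rule has_derivative_add[OF has_derivative_mult schwartz_has_derivative[OF fg(2)]])
         (rule schwartz_has_derivative[OF fg(1)])
  qed
  ultimately show ?thesis
  proof (cases rule: schwartz_coinduct)
    case (differentiable h x)
    then show ?case using D[THEN differentiableI] by (auto simp: X_def)
  next
    case (decay h N)
    then obtain f g where h: "h = (\<lambda>x. of_real (x \<bullet> c) * f x + g x)" "f \<in> schwartz" "g \<in> schwartz" by (auto simp: X_def)
    obtain C D where C: "\<And>x. (1 + norm x) ^ Suc N * norm (f x) \<le> C" and D: "\<And>x. (1 + norm x) ^ N * norm (g x) \<le> D"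
      using h by (meson schwartz_decay)
    have "(1 + norm x) ^ N * norm (h x) \<le> norm c * C + D" for x
    proof -
      have "norm (h x) \<le> \<bar>x \<bullet> c\<bar> * norm (f x) + norm (g x)"
        unfolding h using norm_triangle_ineq[of "of_real (x \<bullet> c) * f x" "g x"] by (simp add: norm_mult)
      also have "\<bar>x \<bullet> c\<bar> * norm (f x) \<le> ((1 + norm x) * norm c) * norm (f x)"
        using Cauchy_Schwarz_ineq2[of x c]
        by (intro mult_right_mono) (auto simp: distrib_right intro: order_trans)
      finally have "(1 + norm x) ^ N * norm (h x) \<le> (1 + norm x) ^ N * (((1 + norm x) * norm c) * norm (f x) + norm (g x))"
        by (intro mult_left_mono) auto
      also have "\<dots> = norm c * ((1 + norm x) ^ Suc N * norm (f x)) + (1 + norm x) ^ N * norm (g x)"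
        by (simp add: algebra_simps)
      also have "\<dots> \<le> norm c * C + D"
        using C D by (intro add_mono mult_left_mono) auto
      finally show ?thesis .
    qed
    then show ?case by blast
  next
    case (deriv h b)
    then obtain f g where h: "h = (\<lambda>x. of_real (x \<bullet> c) * f x + g x)" "f \<in> schwartz" "g \<in> schwartz" by (auto simp: X_def)
    have "frechet_derivative h (at x) = (\<lambda>v. of_real (x \<bullet> c) * frechet_derivative f (at x) v +
        of_real (v \<bullet> c) * f x + frechet_derivative g (at x) v)" for x
      unfolding h(1) by (rule frechet_derivative_at[symmetric]) (rule D[OF h(2,3)])
    then have "(\<lambda>x. frechet_derivative h (at x) b) =
      (\<lambda>x. of_real (x \<bullet> c) * frechet_derivative f (at x) b + (of_real (b \<bullet> c) * f x + frechet_derivative g (at x) b))"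
      by (simp add: add.assoc)
    then show ?case
      unfolding X_def
      by (intro CollectI exI[of _ "\<lambda>x. frechet_derivative f (at x) b"]
          exI[of _ "\<lambda>x. of_real (b \<bullet> c) * f x + frechet_derivative g (at x) b"])
         (simp add: schwartz_add schwartz_cmult schwartz_deriv deriv(2) h(2,3))
  qed
qed

definition ker :: "'a::euclidean_space \<Rightarrow> 'a \<Rightarrow> complex" where
  "ker s \<xi> = exp (\<i> * of_real (s \<bullet> \<xi>))"

lemma norm_ker [simp]: "norm (ker s \<xi>) = 1"
  by (simp add: ker_def)

lemma ker_commute: "ker s \<xi> = ker \<xi> s"
  by (simp add: ker_def inner_commute)

lemma ker_add_right: "ker s (\<xi> + \<xi>') = ker s \<xi> * ker s \<xi>'"
  by (simp add: ker_def inner_add_right distrib_left exp_add)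

lemma ker_minus: "ker (- s) \<xi> = cnj (ker s \<xi>)" "ker s (- \<xi>) = cnj (ker s \<xi>)"
  by (simp_all add: ker_def exp_cnj)

lemma ker_measurable [measurable (raw)]:
  "f \<in> borel_measurable M \<Longrightarrow> g \<in> borel_measurable M \<Longrightarrow> (\<lambda>x. ker (f x) (g x)) \<in> borel_measurable M"
  unfolding ker_def by measurable

lemma ker_has_derivative:
  "((\<lambda>x. ker c x) has_derivative (\<lambda>v. \<i> * of_real (c \<bullet> v) * ker c x)) (at x)"
proof -
  have "((\<lambda>x. exp (\<i> * of_real (c \<bullet> x))) has_derivative (\<lambda>v. exp (\<i> * of_real (c \<bullet> x)) * (\<i> * of_real (c \<bullet> v)))) (at x)"
    by (rule has_derivative_compose[where f="\<lambda>x. \<i> * of_real (c \<bullet> x)" and g=exp and g'="\<lambda>v. exp (\<i> * of_real (c \<bullet> x)) * v"])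
       (auto intro!: derivative_eq_intros has_field_derivative_imp_has_derivative[OF DERIV_exp])
  then show ?thesis by (simp add: ker_def mult_ac)
qed

lemma schwartz_modulate:
  assumes "f \<in> schwartz" shows "(\<lambda>x. ker c x * f x) \<in> schwartz"
proof -
  define X where "X = {\<lambda>x::'a. ker c x * f x | f. f \<in> schwartz}"
  have "(\<lambda>x. ker c x * f x) \<in> X" using assms by (auto simp: X_def)
  then show ?thesis
  proof (cases rule: schwartz_coinduct)
    case (differentiable h x)
    then obtain f where h: "h = (\<lambda>x. ker c x * f x)" "f \<in> schwartz" by (auto simp: X_def)
    show ?case unfolding h
      by (rule differentiableI, rule has_derivative_mult, rule ker_has_derivative, rule schwartz_has_derivative, rule h)
  next
    case (decay h N)
    then show ?case by (auto simp: X_def norm_mult) (meson schwartz_decay)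
  next
    case (deriv h b)
    then obtain f where h: "h = (\<lambda>x. ker c x * f x)" "f \<in> schwartz" by (auto simp: X_def)
    have "frechet_derivative h (at x) = (\<lambda>v. ker c x * frechet_derivative f (at x) v + \<i> * of_real (c \<bullet> v) * ker c x * f x)" for x
      unfolding h
      by (intro frechet_derivative_at[symmetric] has_derivative_mult ker_has_derivative schwartz_has_derivative h)
    then have "(\<lambda>x. frechet_derivative h (at x) b) =
      (\<lambda>x. ker c x * (frechet_derivative f (at x) b + \<i> * of_real (c \<bullet> b) * f x))"
      by (simp add: algebra_simps)
    then show ?case
      unfolding X_def
      by (intro CollectI exI[of _ "\<lambda>x. frechet_derivative f (at x) b + \<i> * of_real (c \<bullet> b) * f x"])
         (simp add: schwartz_add schwartz_cmult schwartz_deriv deriv(2) h(2))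
  qed
qed

text \<open>An injective linear map satisfies \<open>B * norm x \<le> norm (L x)\<close> with
  positive \<open>B\<close>, and this lower bound transfers the decay. The target may have larger
  dimension, as in the restriction of a transform to a subspace of frequencies.\<close>

lemma schwartz_comp_linear:
  fixes L :: "'a::euclidean_space \<Rightarrow> 'b::euclidean_space"
  assumes f: "f \<in> schwartz" and L: "linear L" and inj: "inj L"
  shows "(\<lambda>x. f (L x)) \<in> schwartz"
proof -
  have bl: "bounded_linear L" using L by (simp add: linear_conv_bounded_linear)
  obtain B where B: "B > 0" "\<And>x. B * norm x \<le> norm (L x)"
    using linear_inj_bounded_below_pos[OF L inj] by metis
  define X where "X = {\<lambda>x::'a. f (L x) | f. f \<in> schwartz}"
  have "(\<lambda>x. f (L x)) \<in> X" using f by (auto simp: X_def)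
  then show ?thesis
  proof (cases rule: schwartz_coinduct)
    case (differentiable h x)
    then obtain f where h: "h = (\<lambda>x. f (L x))" "f \<in> schwartz" by (auto simp: X_def)
    show ?case unfolding h
      by (intro differentiableI[OF has_derivative_compose[OF bounded_linear_imp_has_derivative[OF bl] schwartz_has_derivative[OF h(2)]]])
  next
    case (decay h N)
    then obtain f where h: "h = (\<lambda>x. f (L x))" "f \<in> schwartz" by (auto simp: X_def)
    obtain C where C: "\<And>x. (1 + norm x) ^ N * norm (f x) \<le> C"
      using h by (meson schwartz_decay)
    have "(1 + norm x) ^ N * norm (h x) \<le> (1 + 1 / B) ^ N * C" for x
    proof -
      have "norm x \<le> (1 / B) * norm (L x)"
        using B by (simp add: field_simps)
      then have "1 + norm x \<le> (1 + 1 / B) * (1 + norm (L x))"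
        using B(1) by (simp add: algebra_simps add_increasing2 add_increasing)
      then have "(1 + norm x) ^ N \<le> (1 + 1 / B) ^ N * (1 + norm (L x)) ^ N"
        unfolding power_mult_distrib[symmetric] by (intro power_mono) auto
      then have "(1 + norm x) ^ N * norm (h x) \<le> ((1 + 1 / B) ^ N * (1 + norm (L x)) ^ N) * norm (f (L x))"
        unfolding h by (intro mult_right_mono) auto
      also have "\<dots> \<le> (1 + 1 / B) ^ N * C"
        using C[of "L x"] B(1) by (simp add: mult.assoc mult_left_mono)
      finally show ?thesis .
    qed
    then show ?case by blast
  next
    case (deriv h b)
    then obtain f where h: "h = (\<lambda>x. f (L x))" "f \<in> schwartz" by (auto simp: X_def)
    \<comment> \<open>The chain rule differentiates \<open>f\<close> in the direction
      \<open>L b\<close>, in general not a basis vector; its expansion in the basis shows that the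
      derivative is again a Schwartz function composed with \<open>L\<close>.\<close>
    have "frechet_derivative h (at x) b = (\<Sum>c\<in>Basis. of_real (L b \<bullet> c) * frechet_derivative f (at (L x)) c)" for x
    proof -
      have "(h has_derivative (\<lambda>v. frechet_derivative f (at (L x)) (L v))) (at x)"
        unfolding h(1)
        by (rule has_derivative_compose[OF bounded_linear_imp_has_derivative[OF bl] schwartz_has_derivative[OF h(2)]])
      then have "frechet_derivative h (at x) b = frechet_derivative f (at (L x)) (L b)"
        by (simp add: frechet_derivative_at[symmetric])
      also have "\<dots> = frechet_derivative f (at (L x)) (\<Sum>c\<in>Basis. (L b \<bullet> c) *\<^sub>R c)"
        by (simp add: euclidean_representation)
      also have "\<dots> = (\<Sum>c\<in>Basis. of_real (L b \<bullet> c) * frechet_derivative f (at (L x)) c)"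
        using has_derivative_linear[OF schwartz_has_derivative[OF h(2), of "L x"]]
        by (simp add: linear_sum linear_cmul scaleR_conv_of_real)
      finally show ?thesis .
    qed
    moreover have "(\<lambda>y. \<Sum>c\<in>Basis. of_real (L b \<bullet> c) * frechet_derivative f (at y) c) \<in> schwartz"
      by (intro schwartz_sum schwartz_cmult schwartz_deriv h)
    ultimately show ?case unfolding X_def by (auto intro!: exI[of _ "\<lambda>y. \<Sum>c\<in>Basis. of_real (L b \<bullet> c) * frechet_derivative f (at y) c"])
  qed
qed

lemma schwartz_reflect: "f \<in> schwartz \<Longrightarrow> (\<lambda>x. f (- x)) \<in> schwartz"
  by (erule schwartz_comp_linear) (auto intro!: linearI injI)

section \<open>The Fourier transform\<close>

definition ft :: "('a::euclidean_space \<Rightarrow> complex) \<Rightarrow> 'a \<Rightarrow> complex" where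
  "ft f \<xi> = (\<integral>s. f s * ker s \<xi> \<partial>bmu)"

lemma fourier_eq_ft:
  assumes [measurable]: "f \<in> borel_measurable borel"
  shows "fourier f = ft f"
  unfolding fourier_def ft_def ker_def[symmetric] by (intro ext integral_mu_eq) measurable

lemma integrable_mult_ker:
  assumes f: "integrable bmu f" and [measurable]: "h \<in> borel_measurable borel" "g \<in> borel_measurable borel"
  shows "integrable bmu (\<lambda>s. f s * ker (h s) (g s))"
proof -
  have [measurable]: "f \<in> borel_measurable borel" using f by auto
  show ?thesis
    using f by (rule Bochner_Integration.integrable_bound) (auto simp: norm_mult)
qed

lemma norm_ft_le: "norm (ft f \<xi>) \<le> (\<integral>s. norm (f s) \<partial>bmu)"
  unfolding ft_def using integral_norm_bound[of bmu "\<lambda>s. f s * ker s \<xi>"] by (simp add: norm_mult)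

lemma ft_measurable [measurable]:
  assumes [measurable]: "f \<in> borel_measurable borel" shows "ft f \<in> borel_measurable borel"
  unfolding ft_def by measurable

lemma ft_add:
  assumes "integrable bmu f" "integrable bmu g"
  shows "ft (\<lambda>s. f s + g s) \<xi> = ft f \<xi> + ft g \<xi>"
  unfolding ft_def distrib_right using assms
  by (intro Bochner_Integration.integral_add integrable_mult_ker) auto

lemma ft_cmult: "ft (\<lambda>s. c * f s) \<xi> = c * ft f \<xi>"
  unfolding ft_def mult.assoc by simp

lemma ft_cnj: "ft (\<lambda>s. cnj (f s)) \<xi> = cnj (ft f (- \<xi>))"
proof -
  have "(\<integral>s. cnj (f s * ker s (- \<xi>)) \<partial>bmu) = cnj (\<integral>s. f s * ker s (- \<xi>) \<partial>bmu)" by (rule Bochner_Integration.integral_cnj)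
  then show ?thesis unfolding ft_def complex_cnj_mult ker_minus complex_cnj_cnj .
qed

text \<open>The first-order expansion of the exponential has error at most
  \<open>(s \<bullet> v)\<^sup>2 / 2\<close>. Integrated against \<open>f\<close>, this is a
  quadratic bound in \<open>norm v\<close> whose constant is half the second moment, which gives
  differentiability directly.\<close>

lemma ft_has_derivative:
  assumes f: "integrable bmu f" and f1: "integrable bmu (\<lambda>s. norm s * norm (f s))"
    and f2: "integrable bmu (\<lambda>s. (norm s)\<^sup>2 * norm (f s))"
  shows "(ft f has_derivative (\<lambda>v. ft (\<lambda>s. \<i> * of_real (s \<bullet> v) * f s) \<xi>)) (at \<xi>)"
proof -
  have [measurable]: "f \<in> borel_measurable borel" using f by auto
  have i1: "integrable bmu (\<lambda>s. \<i> * of_real (s \<bullet> v) * f s)" for v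
    using integrable_mult_left[OF f1, of "norm v"]
  proof (rule Bochner_Integration.integrable_bound)
    show "AE s in bmu. norm (\<i> * of_real (s \<bullet> v) * f s) \<le> norm (norm s * norm (f s) * norm v)"
    proof (rule AE_I2)
      fix s :: 'a
      show "norm (\<i> * of_real (s \<bullet> v) * f s) \<le> norm (norm s * norm (f s) * norm v)"
        using mult_right_mono[OF Cauchy_Schwarz_ineq2[of s v] norm_ge_zero[of "f s"]]
        by (simp add: norm_mult abs_mult mult_ac)
    qed
  qed measurable
  define C where "C = (\<integral>s. (norm s)\<^sup>2 * norm (f s) \<partial>bmu) / 2"
  let ?D = "\<lambda>v. ft (\<lambda>s. \<i> * of_real (s \<bullet> v) * f s) \<xi>"
  have lin: "linear ?D"
  proof (rule linearI)
    show "?D (v + w) = ?D v + ?D w" for v w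
      using ft_add[OF i1[of v] i1[of w], of \<xi>] by (simp add: inner_add_right algebra_simps)
    show "?D (r *\<^sub>R v) = r *\<^sub>R ?D v" for r v
      using ft_cmult[of "of_real r" "\<lambda>s. \<i> * of_real (s \<bullet> v) * f s" \<xi>]
      by (simp add: scaleR_conv_of_real mult_ac)
  qed
  have est: "norm (ft f (\<xi> + v) - ft f \<xi> - ?D v) \<le> C * (norm v)\<^sup>2" for v
  proof -
    let ?d = "\<lambda>s. f s * ker s (\<xi> + v) - f s * ker s \<xi> - \<i> * of_real (s \<bullet> v) * f s * ker s \<xi>"
    have pt: "norm (?d s) \<le> ((norm s)\<^sup>2 * norm (f s)) * ((norm v)\<^sup>2 / 2)" for s
    proof -
      have "?d s =
          f s * ker s \<xi> * (iexp (s \<bullet> v) - (1 + \<i> * of_real (s \<bullet> v)))"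
        by (simp add: ker_add_right ker_def[of s v] algebra_simps)
      then have eq: "norm (?d s) =
          norm (f s) * norm (iexp (s \<bullet> v) - (1 + \<i> * of_real (s \<bullet> v)))"
        by (simp add: norm_mult)
      have "norm (iexp (s \<bullet> v) - (1 + \<i> * of_real (s \<bullet> v))) \<le> (norm s * norm v)\<^sup>2 / 2"
      proof -
        have "norm (iexp (s \<bullet> v) - (1 + \<i> * of_real (s \<bullet> v))) \<le> \<bar>s \<bullet> v\<bar>\<^sup>2 / 2"
          using iexp_approx1[of "s \<bullet> v" 1] by (simp add: power2_eq_square)
        also have "\<bar>s \<bullet> v\<bar>\<^sup>2 / 2 \<le> (norm s * norm v)\<^sup>2 / 2"
          using Cauchy_Schwarz_ineq2[of s v] by (intro divide_right_mono power_mono) auto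
        finally show ?thesis .
      qed
      then have "norm (f s) * norm (iexp (s \<bullet> v) - (1 + \<i> * of_real (s \<bullet> v))) \<le> norm (f s) * ((norm s * norm v)\<^sup>2 / 2)"
        by (intro mult_left_mono) auto
      then show ?thesis unfolding eq by (simp add: power_mult_distrib mult_ac)
    qed
    have int: "integrable bmu (\<lambda>s. ((norm s)\<^sup>2 * norm (f s)) * ((norm v)\<^sup>2 / 2))"
      by (intro integrable_mult_left f2)
    have eq: "ft f (\<xi> + v) - ft f \<xi> - ?D v =
       (\<integral>s. ?d s \<partial>bmu)"
    proof -
      have i: "integrable bmu (\<lambda>s. f s * ker s (\<xi> + v))" "integrable bmu (\<lambda>s. f s * ker s \<xi>)"
        "integrable bmu (\<lambda>s. \<i> * of_real (s \<bullet> v) * f s * ker s \<xi>)"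
        by (rule integrable_mult_ker, use f i1[of v] in auto)+
      show ?thesis
        unfolding ft_def
        by (simp only: Bochner_Integration.integral_diff[OF Bochner_Integration.integrable_diff[OF i(1,2)] i(3)]
            Bochner_Integration.integral_diff[OF i(1,2)])
    qed
    have "norm (ft f (\<xi> + v) - ft f \<xi> - ?D v) \<le> (\<integral>s. norm (?d s) \<partial>bmu)"
      unfolding eq by (rule integral_norm_bound)
    also have "\<dots> \<le> (\<integral>s. ((norm s)\<^sup>2 * norm (f s)) * ((norm v)\<^sup>2 / 2) \<partial>bmu)"
      by (rule integral_mono'[OF int pt]) simp
    also have "\<dots> = C * (norm v)\<^sup>2" by (simp add: C_def)
    finally show ?thesis .
  qed
  show ?thesis
    unfolding has_derivative_at
  proof (rule conjI)
    show "bounded_linear ?D" by (rule linear_conv_bounded_linear[THEN iffD1, OF lin])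
    have lim: "((\<lambda>v::'a. C * norm v) \<longlongrightarrow> 0) (at 0)"
      by (rule tendsto_mult_right_zero, rule tendsto_norm_zero, rule tendsto_ident_at)
    show "(\<lambda>v. norm (ft f (\<xi> + v) - ft f \<xi> - ?D v) / norm v) \<midarrow>0\<rightarrow> 0"
    proof (rule Lim_null_comparison[OF _ lim], rule always_eventually, rule allI)
      fix v :: 'a
      show "norm (norm (ft f (\<xi> + v) - ft f \<xi> - ?D v) / norm v) \<le> C * norm v"
        using est[of v] by (cases "v = 0") (auto simp: field_simps power2_eq_square)
    qed
  qed
qed

lemma schwartz_norm_mult_integrable:
  fixes f :: "'a::euclidean_space \<Rightarrow> complex"
  assumes "f \<in> schwartz"
  shows "integrable bmu (\<lambda>s. norm s ^ j * norm (f s))"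
proof -
  obtain C where C: "\<And>x::'a. (1 + norm x) ^ (2 * DIM('a) + j) * norm (f x) \<le> C"
    using schwartz_decay[OF assms] by blast
  note [measurable] = schwartz_measurable[OF assms]
  show ?thesis
  proof (rule integrable_rapid)
    fix x :: 'a
    have "norm x ^ j \<le> (1 + norm x) ^ j" by (intro power_mono) auto
    then have "(1 + norm x) ^ (2 * DIM('a)) * norm (norm x ^ j * norm (f x)) \<le>
      (1 + norm x) ^ (2 * DIM('a)) * ((1 + norm x) ^ j * norm (f x))"
      by (intro mult_left_mono) (auto simp: mult_right_mono abs_mult)
    also have "\<dots> \<le> C" using C[of x] by (simp add: power_add mult_ac)
    finally show "(1 + norm x) ^ (2 * DIM('a)) * norm (norm x ^ j * norm (f x)) \<le> C" .
  qed measurable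
qed

lemma schwartz_ft_has_derivative:
  "f \<in> schwartz \<Longrightarrow> (ft f has_derivative (\<lambda>v. ft (\<lambda>s. \<i> * of_real (s \<bullet> v) * f s) \<xi>)) (at \<xi>)"
  using schwartz_norm_mult_integrable[of f 1] schwartz_norm_mult_integrable[of f 2]
  by (intro ft_has_derivative schwartz_integrable) auto

text \<open>Every difference quotient has integral 0 by translation invariance. Dominated
  convergence passes this to the derivative, and the mean value inequality provides the
  majorant.\<close>

lemma schwartz_integral_deriv:
  fixes h :: "'a::euclidean_space \<Rightarrow> complex"
  assumes h: "h \<in> schwartz" and b: "b \<in> Basis"
  shows "(\<integral>x. frechet_derivative h (at x) b \<partial>bmu) = 0"
proof -
  let ?h' = "\<lambda>x. frechet_derivative h (at x) b"
  let ?N = "2 * DIM('a)"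
  let ?e = "\<lambda>n. inverse (real (Suc n))"
  note [measurable] = schwartz_measurable[OF h]
  have h': "?h' \<in> schwartz" using h b by (rule schwartz_deriv)
  obtain C where C: "\<And>x. (1 + norm x) ^ ?N * norm (?h' x) \<le> C"
    using schwartz_decay[OF h'] by blast
  define q where "q n x = of_nat (Suc n) * (h (x + ?e n *\<^sub>R b) - h x)" for n x
  have shift: "integrable bmu (\<lambda>x. h (x + c))" "(\<integral>x. h (x + c) \<partial>bmu) = (\<integral>x. h x \<partial>bmu)" for c
    using integrable_bmu_translate[OF schwartz_integrable[OF h], of c] bmu_translate[of h c]
    by (simp_all add: add.commute)
  have q0: "(\<integral>x. q n x \<partial>bmu) = 0" for n
    unfolding q_def using shift schwartz_integrable[OF h] by simp
  have nb: "norm b = 1" using b by simp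
  have lim: "(\<lambda>n. q n x) \<longlonglongrightarrow> ?h' x" for x
  proof -
    have "((\<lambda>r. h (x + r *\<^sub>R b)) has_derivative (\<lambda>r. frechet_derivative h (at x) (r *\<^sub>R b))) (at 0)"
      by (rule has_derivative_compose[where f="\<lambda>r. x + r *\<^sub>R b"])
         (auto intro!: derivative_eq_intros schwartz_has_derivative h)
    then have "((\<lambda>r. norm (h (x + r *\<^sub>R b) - h x - r *\<^sub>R ?h' x) / norm r) \<longlongrightarrow> 0) (at 0)"
      using linear_cmul[OF has_derivative_linear[OF schwartz_has_derivative[OF h]]]
      by (simp add: has_derivative_at)
    moreover have "filterlim (\<lambda>n. ?e n) (at 0) sequentially"
      using LIMSEQ_inverse_real_of_nat by (auto simp: filterlim_at)
    ultimately have "(\<lambda>n. norm (h (x + ?e n *\<^sub>R b) - h x - ?e n *\<^sub>R ?h' x)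
        / norm (?e n)) \<longlonglongrightarrow> 0"
      by (rule filterlim_compose)
    also have "(\<lambda>n. norm (h (x + ?e n *\<^sub>R b) - h x - ?e n *\<^sub>R ?h' x)
        / norm (?e n)) = (\<lambda>n. norm (q n x - ?h' x))"
    proof
      fix n
      have "q n x - ?h' x = of_nat (Suc n) * (h (x + ?e n *\<^sub>R b) - h x - ?e n *\<^sub>R ?h' x)"
        by (simp add: q_def scaleR_conv_of_real right_diff_distrib del: of_nat_Suc)
      then show "norm (h (x + ?e n *\<^sub>R b) - h x - ?e n *\<^sub>R ?h' x)
        / norm (?e n) = norm (q n x - ?h' x)"
        by (simp add: norm_mult divide_inverse mult.commute del: of_nat_Suc)
    qed
    finally show ?thesis by (simp only: tendsto_norm_zero_iff LIM_zero_iff)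
  qed
  \<comment> \<open>The mean value point lies within distance 1 of \<open>x\<close>, so
    \<open>1 + norm x\<close> is at most twice its value there; this is the origin of the factor
    \<open>2 ^ ?N\<close>.\<close>
  have bound: "norm (q n x) \<le> (2 ^ ?N * C) * weight x" for n x
  proof -
    let ?r = "?e n"
    have r: "0 < ?r" "?r \<le> 1" by (auto simp: field_simps)
    have "\<exists>\<theta>\<in>{0<..<?r}. norm (h (x + ?r *\<^sub>R b) - h (x + 0 *\<^sub>R b)) \<le> norm (frechet_derivative h (at (x + \<theta> *\<^sub>R b)) ((?r - 0) *\<^sub>R b))"
    proof (rule mvt_general[where f="\<lambda>r. h (x + r *\<^sub>R b)" and f'="\<lambda>\<theta> r. frechet_derivative h (at (x + \<theta> *\<^sub>R b)) (r *\<^sub>R b)"])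
      show "continuous_on {0..?r} (\<lambda>r. h (x + r *\<^sub>R b))"
        by (rule continuous_on_compose2[OF schwartz_continuous[OF h, of UNIV]]) (auto intro!: continuous_intros)
      show "((\<lambda>r. h (x + r *\<^sub>R b)) has_derivative (\<lambda>r. frechet_derivative h (at (x + \<theta> *\<^sub>R b)) (r *\<^sub>R b))) (at \<theta>)" for \<theta>
        by (rule has_derivative_compose[where f="\<lambda>r. x + r *\<^sub>R b"])
           (auto intro!: derivative_eq_intros schwartz_has_derivative h)
    qed (use r in auto)
    then obtain \<theta> where \<theta>: "0 < \<theta>" "\<theta> < ?r"
        and le: "norm (h (x + ?r *\<^sub>R b) - h x) \<le> norm (frechet_derivative h (at (x + \<theta> *\<^sub>R b)) (?r *\<^sub>R b))"
      by auto
    let ?y = "x + \<theta> *\<^sub>R b"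
    have "norm (q n x) = real (Suc n) * norm (h (x + ?r *\<^sub>R b) - h x)"
      by (simp add: q_def norm_mult del: of_nat_Suc)
    also have "\<dots> \<le> real (Suc n) * norm (?r *\<^sub>R ?h' ?y)"
      using le linear_cmul[OF has_derivative_linear[OF schwartz_has_derivative[OF h]], of ?y ?r b]
      by (intro mult_left_mono) auto
    also have "\<dots> = norm (?h' ?y)" by (simp del: of_nat_Suc)
    finally have 1: "norm (q n x) \<le> norm (?h' ?y)" .
    have "norm x \<le> norm ?y + norm (\<theta> *\<^sub>R b)" using norm_triangle_ineq4[of ?y "\<theta> *\<^sub>R b"] by simp
    moreover have "norm (\<theta> *\<^sub>R b) \<le> 1" using \<theta>(1) less_le_trans[OF \<theta>(2) r(2)] nb by simp
    ultimately have "1 + norm x \<le> 2 * (1 + norm ?y)" by (smt (verit) norm_ge_zero)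
    then have "(1 + norm x) ^ ?N \<le> 2 ^ ?N * (1 + norm ?y) ^ ?N"
      unfolding power_mult_distrib[symmetric] by (intro power_mono) auto
    then have "(1 + norm x) ^ ?N * norm (q n x) \<le>
        (2 ^ ?N * (1 + norm ?y) ^ ?N) * norm (?h' ?y)"
      using 1 by (intro mult_mono) auto
    also have "\<dots> \<le> 2 ^ ?N * C" using C[of ?y] by (simp add: mult.assoc)
    finally have "(1 + norm x) ^ ?N * norm (q n x) \<le> 2 ^ ?N * C" .
    then show ?thesis by (rule le_weightI) simp
  qed
  have "(\<lambda>n. \<integral>x. q n x \<partial>bmu) \<longlonglongrightarrow> (\<integral>x. ?h' x \<partial>bmu)"
  proof (rule integral_dominated_convergence[where w="\<lambda>x. (2 ^ ?N * C) * weight x"])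
    show "?h' \<in> borel_measurable bmu" using schwartz_measurable[OF h'] by simp
    show "q n \<in> borel_measurable bmu" for n unfolding q_def by measurable
    show "integrable bmu (\<lambda>x::'a. (2 ^ ?N * C) * weight x)"
      by (intro integrable_mult_right integrable_weight)
  qed (use lim bound in auto)
  then show ?thesis unfolding q0 using LIMSEQ_unique tendsto_const by blast
qed

text \<open>Integration by parts: \<open>schwartz_integral_deriv\<close> for the product of
  \<open>f\<close> with the exponential, which is again a Schwartz function.\<close>

lemma ft_deriv:
  assumes f: "f \<in> schwartz" and b: "b \<in> Basis"
  shows "ft (\<lambda>s. frechet_derivative f (at s) b) \<xi> = - \<i> * of_real (\<xi> \<bullet> b) * ft f \<xi>"
proof -
  let ?f' = "\<lambda>s. frechet_derivative f (at s) b"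
  have D: "((\<lambda>s. f s * ker s \<xi>) has_derivative (\<lambda>v. f s * (\<i> * of_real (\<xi> \<bullet> v) * ker \<xi> s) + frechet_derivative f (at s) v * ker s \<xi>)) (at s)" for s
    unfolding ker_commute[of _ \<xi>]
    by (rule has_derivative_mult[OF schwartz_has_derivative[OF f] ker_has_derivative])
  have "frechet_derivative (\<lambda>s. f s * ker s \<xi>) (at s) b = \<i> * of_real (\<xi> \<bullet> b) * (f s * ker s \<xi>) + ?f' s * ker s \<xi>" for s
    using fun_cong[OF frechet_derivative_at[OF D[of s]], of b]
    unfolding ker_commute[of \<xi> s] by (simp add: mult_ac)
  moreover have "(\<lambda>s. f s * ker s \<xi>) \<in> schwartz"
    using schwartz_modulate[OF f, of \<xi>] by (simp add: ker_commute[of _ \<xi>] mult.commute)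
  ultimately have "(\<integral>s. \<i> * of_real (\<xi> \<bullet> b) * (f s * ker s \<xi>) + ?f' s * ker s \<xi> \<partial>bmu) = 0"
    using schwartz_integral_deriv[of "\<lambda>s. f s * ker s \<xi>" b] b by simp
  moreover have "(\<integral>s. \<i> * of_real (\<xi> \<bullet> b) * (f s * ker s \<xi>) + ?f' s * ker s \<xi> \<partial>bmu) =
     \<i> * of_real (\<xi> \<bullet> b) * ft f \<xi> + ft ?f' \<xi>"
  proof -
    have "integrable bmu (\<lambda>s. \<i> * of_real (\<xi> \<bullet> b) * (f s * ker s \<xi>))"
      by (intro integrable_mult_right integrable_mult_ker schwartz_integrable f) auto
    moreover have "integrable bmu (\<lambda>s. ?f' s * ker s \<xi>)"
      by (intro integrable_mult_ker schwartz_integrable schwartz_deriv f b) auto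
    ultimately show ?thesis
      unfolding ft_def by (subst Bochner_Integration.integral_add) simp_all
  qed
  ultimately show ?thesis by (simp add: add_eq_0_iff)
qed

text \<open>Derivatives of the transform come from multiplying \<open>f\<close> by coordinates,
  decay of the transform from differentiating \<open>f\<close>; both operations stay inside the
  Schwartz space.\<close>

lemma schwartz_ft:
  assumes "f \<in> schwartz" shows "ft f \<in> (schwartz :: ('a::euclidean_space \<Rightarrow> complex) set)"
proof -
  define X where "X = {ft f | f. f \<in> (schwartz :: ('a \<Rightarrow> complex) set)}"
  have "ft f \<in> X" using assms by (auto simp: X_def)
  then show ?thesis
  proof (cases rule: schwartz_coinduct)
    case (differentiable h x)
    then show ?case using schwartz_ft_has_derivative[THEN differentiableI] by (auto simp: X_def)
  next
    case (decay h N)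
    \<comment> \<open>Each further factor \<open>norm x\<close> is bounded by the sum of the
      coordinates, and \<open>ft_deriv\<close> trades a coordinate for a derivative of
      \<open>f\<close>. The induction therefore has to range over all Schwartz functions.\<close>
    have *: "\<exists>C. \<forall>x. (1 + norm x) ^ N * norm (ft f x) \<le> C" if "f \<in> schwartz" for f :: "'a \<Rightarrow> complex"
      using that
    proof (induction N arbitrary: f)
      case 0
      then show ?case using norm_ft_le by auto
    next
      case (Suc N)
      obtain C where C: "\<And>x. (1 + norm x) ^ N * norm (ft f x) \<le> C"
        using Suc.IH[OF Suc.prems] by blast
      have "\<forall>b\<in>Basis. \<exists>C. \<forall>x. (1 + norm x) ^ N * norm (ft (\<lambda>s. frechet_derivative f (at s) b) x) \<le> C"
        using Suc by (auto intro: schwartz_deriv)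
      then obtain D where D: "\<And>b x. b \<in> Basis \<Longrightarrow> (1 + norm x) ^ N * norm (ft (\<lambda>s. frechet_derivative f (at s) b) x) \<le> D b"
        by metis
      have "(1 + norm x) ^ Suc N * norm (ft f x) \<le> C + (\<Sum>b\<in>Basis. D b)" for x
      proof -
        have "(1 + norm x) ^ Suc N * norm (ft f x) = (1 + norm x) ^ N * norm (ft f x) + norm x * ((1 + norm x) ^ N * norm (ft f x))"
          by (simp add: algebra_simps)
        also have "norm x * ((1 + norm x) ^ N * norm (ft f x)) \<le> (\<Sum>b\<in>Basis. \<bar>x \<bullet> b\<bar>) * ((1 + norm x) ^ N * norm (ft f x))"
          by (intro mult_right_mono norm_le_l1) auto
        also have "\<dots> = (\<Sum>b\<in>Basis. (1 + norm x) ^ N * norm (ft (\<lambda>s. frechet_derivative f (at s) b) x))"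
          using Suc.prems by (simp add: sum_distrib_right sum_distrib_left ft_deriv norm_mult mult_ac)
        also have "\<dots> \<le> (\<Sum>b\<in>Basis. D b)" by (intro sum_mono D)
        finally show ?thesis using C[of x] by simp
      qed
      then show ?case by blast
    qed
    then show ?case using decay by (auto simp: X_def)
  next
    case (deriv h b)
    then obtain f where h: "h = ft f" "f \<in> schwartz" by (auto simp: X_def)
    have "frechet_derivative h (at \<xi>) = (\<lambda>v. ft (\<lambda>s. \<i> * of_real (s \<bullet> v) * f s) \<xi>)" for \<xi>
      unfolding h by (intro frechet_derivative_at[symmetric] schwartz_ft_has_derivative h)
    then have "(\<lambda>\<xi>. frechet_derivative h (at \<xi>) b) = ft (\<lambda>s. \<i> * (of_real (s \<bullet> b) * f s))"
      by (simp add: mult.assoc)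
    then show ?case
      unfolding X_def
      by (intro CollectI exI[of _ "\<lambda>s. \<i> * (of_real (s \<bullet> b) * f s)"] conjI schwartz_cmult schwartz_mult_inner h)
  qed
qed

subsection \<open>Inversion\<close>

lemma ft_reflect: "f \<in> borel_measurable borel \<Longrightarrow> ft (\<lambda>s. f (- s)) \<xi> = ft f (- \<xi>)"
  unfolding ft_def by (subst bmu_reflect[symmetric]) (auto simp: ker_minus)

lemma integrable_bmu_pair_bound:
  fixes K :: "'a::euclidean_space \<times> 'b::euclidean_space \<Rightarrow> 'c::{banach, second_countable_topology}"
    and f :: "'a \<Rightarrow> real" and g :: "'b \<Rightarrow> real"
  assumes f: "integrable bmu f" and g: "integrable bmu g"
    and [measurable]: "K \<in> borel_measurable borel"
    and le: "\<And>x y. norm (K (x, y)) \<le> \<bar>f x\<bar> * \<bar>g y\<bar>"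
  shows "integrable (bmu \<Otimes>\<^sub>M bmu) K"
proof (rule bmu_pair.Fubini_integrable)
  have [measurable]: "f \<in> borel_measurable borel" "g \<in> borel_measurable borel" using f g by auto
  have m: "K \<in> borel_measurable (bmu \<Otimes>\<^sub>M bmu)" by (simp add: bmu_prod)
  then show "K \<in> borel_measurable (bmu \<Otimes>\<^sub>M bmu)" .
  have m': "(\<lambda>y. K (x, y)) \<in> borel_measurable borel" for x
    using measurable_compose[OF measurable_Pair1'[of x bmu bmu] m] by simp
  have i: "integrable bmu (\<lambda>y. K (x, y))" for x
  proof (rule Bochner_Integration.integrable_bound)
    show "integrable bmu (\<lambda>y. \<bar>f x\<bar> * \<bar>g y\<bar>)"
      by (intro integrable_mult_right integrable_abs g)
  qed (use le m' in \<open>auto simp: abs_mult\<close>)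
  then show "AE x in bmu. integrable bmu (\<lambda>y. K (x, y))" by simp
  show "integrable bmu (\<lambda>x. \<integral>y. norm (K (x, y)) \<partial>bmu)"
  proof (rule Bochner_Integration.integrable_bound)
    show "integrable bmu (\<lambda>x. \<bar>f x\<bar> * (\<integral>y. \<bar>g y\<bar> \<partial>bmu))"
      by (intro integrable_mult_left integrable_abs f)
    have "(\<lambda>x. \<integral>y. norm (K (x, y)) \<partial>bmu) \<in> borel_measurable bmu"
      using m by (intro bmu.borel_measurable_lebesgue_integral) simp
    then show "(\<lambda>x. \<integral>y. norm (K (x, y)) \<partial>bmu) \<in> borel_measurable bmu" .
    show "AE x in bmu. norm (\<integral>y. norm (K (x, y)) \<partial>bmu) \<le> norm (\<bar>f x\<bar> * (\<integral>y. \<bar>g y\<bar> \<partial>bmu))"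
    proof (rule AE_I2)
      fix x
      have "(\<integral>y. norm (K (x, y)) \<partial>bmu) \<le> (\<integral>y. \<bar>f x\<bar> * \<bar>g y\<bar> \<partial>bmu)"
        using i[of x] g le by (intro integral_mono integrable_norm integrable_mult_right integrable_abs) auto
      then show "norm (\<integral>y. norm (K (x, y)) \<partial>bmu) \<le> norm (\<bar>f x\<bar> * (\<integral>y. \<bar>g y\<bar> \<partial>bmu))"
        by (simp add: abs_mult)
    qed
  qed
qed

section \<open>Gaussian regularization of the inversion integral\<close>

lemma integrable_gauss_scale:
  assumes "\<epsilon> \<noteq> 0" shows "integrable bmu (\<lambda>\<alpha>::'a::euclidean_space. gauss (\<epsilon> *\<^sub>R \<alpha>))"
  using integrable_bmu_affine[OF assms integrable_gauss, of 0] by simp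

lemma integral_gauss_scale_ker:
  fixes x :: "'a::euclidean_space"
  assumes "\<epsilon> > 0"
  shows "(\<integral>\<alpha>. of_real (gauss (\<epsilon> *\<^sub>R \<alpha>)) * ker \<alpha> x \<partial>bmu) = of_real (gauss ((1 / \<epsilon>) *\<^sub>R x) / \<epsilon> ^ DIM('a))"
proof -
  have "of_real (gauss ((1 / \<epsilon>) *\<^sub>R x)) = (\<integral>\<beta>. of_real (gauss \<beta>) * ker \<beta> ((1 / \<epsilon>) *\<^sub>R x) \<partial>bmu)"
    using integral_gauss_exp[of "(1 / \<epsilon>) *\<^sub>R x"] by (simp add: ker_def)
  also have "\<dots> = \<bar>\<epsilon>\<bar> ^ DIM('a) *\<^sub>R (\<integral>\<alpha>. of_real (gauss (0 + \<epsilon> *\<^sub>R \<alpha>)) * ker (0 + \<epsilon> *\<^sub>R \<alpha>) ((1 / \<epsilon>) *\<^sub>R x) \<partial>bmu)"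
    using assms by (intro integral_bmu_affine) auto
  also have "(\<integral>\<alpha>. of_real (gauss (0 + \<epsilon> *\<^sub>R \<alpha>)) * ker (0 + \<epsilon> *\<^sub>R \<alpha>) ((1 / \<epsilon>) *\<^sub>R x) \<partial>bmu) =
      (\<integral>\<alpha>. of_real (gauss (\<epsilon> *\<^sub>R \<alpha>)) * ker \<alpha> x \<partial>bmu)"
    using assms by (simp add: ker_def)
  finally show ?thesis using assms by (simp add: scaleR_conv_of_real field_simps)
qed

text \<open>The Gaussian makes the double integral absolutely convergent even if \<open>ft F\<close>
  is not integrable. After Fubini the inner integral is a Gaussian of width \<epsilon> around x, and
  substituting x + \<epsilon>y turns the result into an average of \<open>F\<close>.\<close>

lemma ft_gauss_regularized:
  fixes F :: "'a::euclidean_space \<Rightarrow> complex"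
  assumes F: "integrable bmu F" and \<epsilon>: "\<epsilon> > 0"
  shows "(\<integral>\<alpha>. ft F \<alpha> * ker \<alpha> (- x) * of_real (gauss (\<epsilon> *\<^sub>R \<alpha>)) \<partial>bmu) =
    (\<integral>y. F (x + \<epsilon> *\<^sub>R y) * of_real (gauss y) \<partial>bmu)"
proof -
  have [measurable]: "F \<in> borel_measurable borel" using F by auto
  define K where "K = (\<lambda>\<xi> \<alpha>. F \<xi> * (of_real (gauss (\<epsilon> *\<^sub>R \<alpha>)) * ker \<alpha> (\<xi> - x)))"
  have iK: "integrable (bmu \<Otimes>\<^sub>M bmu) (\<lambda>(\<xi>, \<alpha>). K \<xi> \<alpha>)"
  proof (rule integrable_bmu_pair_bound)
    show "integrable bmu (\<lambda>\<xi>. norm (F \<xi>))" using F by simp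
    show "integrable bmu (\<lambda>\<alpha>::'a. gauss (\<epsilon> *\<^sub>R \<alpha>))" using \<epsilon> by (intro integrable_gauss_scale) simp
    show "(\<lambda>(\<xi>, \<alpha>). K \<xi> \<alpha>) \<in> borel_measurable borel"
      unfolding K_def borel_prod[symmetric] by measurable
  qed (auto simp: K_def norm_mult)
  have "(\<integral>\<alpha>. ft F \<alpha> * ker \<alpha> (- x) * of_real (gauss (\<epsilon> *\<^sub>R \<alpha>)) \<partial>bmu) = (\<integral>\<alpha>. (\<integral>\<xi>. K \<xi> \<alpha> \<partial>bmu) \<partial>bmu)"
  proof (rule Bochner_Integration.integral_cong)
    fix \<alpha> :: 'a
    have "K \<xi> \<alpha> = (F \<xi> * ker \<xi> \<alpha>) * (ker \<alpha> (- x) * of_real (gauss (\<epsilon> *\<^sub>R \<alpha>)))" for \<xi>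
      unfolding K_def diff_conv_add_uminus ker_add_right ker_commute[of \<alpha> \<xi>] by (simp add: mult_ac)
    then show "ft F \<alpha> * ker \<alpha> (- x) * of_real (gauss (\<epsilon> *\<^sub>R \<alpha>)) = (\<integral>\<xi>. K \<xi> \<alpha> \<partial>bmu)"
      by (simp add: ft_def)
  qed simp
  also have "\<dots> = (\<integral>\<xi>. (\<integral>\<alpha>. K \<xi> \<alpha> \<partial>bmu) \<partial>bmu)"
    by (rule bmu_pair.Fubini_integral[OF iK])
  also have "\<dots> = (\<integral>\<xi>. F \<xi> * of_real (gauss ((1 / \<epsilon>) *\<^sub>R (\<xi> - x)) / \<epsilon> ^ DIM('a)) \<partial>bmu)"
    unfolding K_def integral_mult_right_zero integral_gauss_scale_ker[OF \<epsilon>] ..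
  also have "\<dots> = \<bar>\<epsilon>\<bar> ^ DIM('a) *\<^sub>R (\<integral>y. F (x + \<epsilon> *\<^sub>R y) * of_real (gauss ((1 / \<epsilon>) *\<^sub>R (x + \<epsilon> *\<^sub>R y - x)) / \<epsilon> ^ DIM('a)) \<partial>bmu)"
    using \<epsilon> by (intro integral_bmu_affine) auto
  also have "\<dots> = (\<integral>y. F (x + \<epsilon> *\<^sub>R y) * of_real (gauss y) \<partial>bmu)"
    using \<epsilon> by (subst integral_scaleR_right[symmetric]) (simp add: scaleR_conv_of_real)
  finally show ?thesis .
qed

lemma gauss_scale_tendsto: "(\<lambda>n. gauss (inverse (real (Suc n)) *\<^sub>R x)) \<longlonglongrightarrow> 1"
proof -
  have "(\<lambda>n. gauss (inverse (real (Suc n)) *\<^sub>R x)) \<longlonglongrightarrow> gauss (0 *\<^sub>R x)"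
    unfolding gauss_def by (intro tendsto_intros LIMSEQ_inverse_real_of_nat) simp
  then show ?thesis by (simp add: gauss_def)
qed

lemma gauss_regularization_tendsto:
  fixes f :: "'a::euclidean_space \<Rightarrow> complex"
  assumes f: "integrable bmu f"
  shows "(\<lambda>n. \<integral>\<alpha>. f \<alpha> * of_real (gauss (inverse (real (Suc n)) *\<^sub>R \<alpha>)) \<partial>bmu) \<longlonglongrightarrow> (\<integral>\<alpha>. f \<alpha> \<partial>bmu)"
proof (rule integral_dominated_convergence[where w="\<lambda>\<alpha>. norm (f \<alpha>)"])
  let ?g = "\<lambda>n \<alpha>::'a. complex_of_real (gauss (inverse (real (Suc n)) *\<^sub>R \<alpha>))"
  show fm: "f \<in> borel_measurable bmu" using f by (rule borel_measurable_integrable)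
  then show "(\<lambda>\<alpha>. f \<alpha> * ?g n \<alpha>) \<in> borel_measurable bmu" for n by measurable
  have "(\<lambda>n. f \<alpha> * ?g n \<alpha>) \<longlonglongrightarrow> f \<alpha> * of_real 1" for \<alpha>
    by (intro tendsto_intros gauss_scale_tendsto)
  then show "AE \<alpha> in bmu. (\<lambda>n. f \<alpha> * ?g n \<alpha>) \<longlonglongrightarrow> f \<alpha>" by simp
  show "integrable bmu (\<lambda>\<alpha>. norm (f \<alpha>))" using f by simp
  show "AE \<alpha> in bmu. norm (f \<alpha> * ?g n \<alpha>) \<le> norm (f \<alpha>)" for n
  proof (rule AE_I2)
    fix \<alpha> :: 'a
    show "norm (f \<alpha> * ?g n \<alpha>) \<le> norm (f \<alpha>)"
      using mult_left_mono[OF gauss_le_1[of "inverse (real (Suc n)) *\<^sub>R \<alpha>"] norm_ge_zero[of "f \<alpha>"]]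
        gauss_pos[of "inverse (real (Suc n)) *\<^sub>R \<alpha>"]
      by (simp add: norm_mult del: of_nat_Suc)
  qed
qed

lemma gauss_average_tendsto:
  fixes F :: "'a::euclidean_space \<Rightarrow> complex"
  assumes cont: "continuous_on UNIV F" and bdd: "\<And>x. norm (F x) \<le> B"
  shows "(\<lambda>n. \<integral>y. F (x + inverse (real (Suc n)) *\<^sub>R y) * of_real (gauss y) \<partial>bmu) \<longlonglongrightarrow> F x"
proof -
  have [measurable]: "F \<in> borel_measurable borel" using cont by (rule borel_measurable_continuous_onI)
  let ?e = "\<lambda>n. inverse (real (Suc n))"
  have "(\<lambda>n. \<integral>y. F (x + ?e n *\<^sub>R y) * of_real (gauss y) \<partial>bmu) \<longlonglongrightarrow> (\<integral>y. F x * of_real (gauss (y::'a)) \<partial>bmu)"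
  proof (rule integral_dominated_convergence[where w="\<lambda>y. B * gauss y"])
    have "(\<lambda>n. F (x + ?e n *\<^sub>R y) * of_real (gauss y)) \<longlonglongrightarrow> F x * of_real (gauss y)" for y
    proof -
      have "(\<lambda>n. x + ?e n *\<^sub>R y) \<longlonglongrightarrow> x + 0 *\<^sub>R y"
        by (intro tendsto_intros LIMSEQ_inverse_real_of_nat)
      then have "(\<lambda>n. F (x + ?e n *\<^sub>R y)) \<longlonglongrightarrow> F x"
        using cont by (intro isCont_tendsto_compose[of x F]) (auto simp: continuous_on_eq_continuous_at)
      then show ?thesis by (intro tendsto_intros)
    qed
    then show "AE y in bmu. (\<lambda>n. F (x + ?e n *\<^sub>R y) * of_real (gauss y)) \<longlonglongrightarrow> F x * of_real (gauss y)" by simp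
    show "integrable bmu (\<lambda>y::'a. B * gauss y)" by (intro integrable_mult_right integrable_gauss)
    show "AE y in bmu. norm (F (x + ?e n *\<^sub>R y) * of_real (gauss y)) \<le> B * gauss y" for n
      using bdd by (intro AE_I2) (simp add: norm_mult abs_of_pos gauss_pos mult_right_mono less_imp_le)
  qed measurable
  also have "(\<integral>y. F x * of_real (gauss (y::'a)) \<partial>bmu) = F x" by (simp add: integral_gauss)
  finally show ?thesis .
qed

text \<open>Two limits of the same quantity: integrability of \<open>ft F\<close> removes the
  Gaussian on the frequency side, while continuity and boundedness of \<open>F\<close> collapse the
  average on the other side to \<open>F x\<close>.\<close>

theorem ft_inversion:
  fixes F :: "'a::euclidean_space \<Rightarrow> complex"
  assumes F: "integrable bmu F" and iF: "integrable bmu (ft F)"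
    and cont: "continuous_on UNIV F" and bdd: "\<And>x. norm (F x) \<le> B"
  shows "ft (ft F) (- x) = F x"
proof -
  have [measurable]: "F \<in> borel_measurable borel" using F by auto
  let ?e = "\<lambda>n. inverse (real (Suc n))"
  have e: "?e n > 0" for n by simp
  have 1: "(\<lambda>n. \<integral>\<alpha>. ft F \<alpha> * ker \<alpha> (- x) * of_real (gauss (?e n *\<^sub>R \<alpha>)) \<partial>bmu) \<longlonglongrightarrow> (\<integral>\<alpha>. ft F \<alpha> * ker \<alpha> (- x) \<partial>bmu)"
    by (intro gauss_regularization_tendsto integrable_mult_ker iF) auto
  have 2: "(\<lambda>n. \<integral>y. F (x + ?e n *\<^sub>R y) * of_real (gauss y) \<partial>bmu) \<longlonglongrightarrow> F x"
    using cont bdd by (rule gauss_average_tendsto)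
  have "(\<integral>\<alpha>. ft F \<alpha> * ker \<alpha> (- x) \<partial>bmu) = F x"
    using LIMSEQ_unique[OF 1] 2 unfolding ft_gauss_regularized[OF F e] by blast
  then show ?thesis by (simp add: ft_def)
qed

lemma schwartz_ft_inversion:
  assumes "f \<in> schwartz" shows "ft (ft f) (- x) = f x"
proof -
  obtain B where "\<And>x. norm (f x) \<le> B" using schwartz_bounded[OF assms] by blast
  then show ?thesis
    by (intro ft_inversion schwartz_integrable schwartz_ft schwartz_continuous assms)
qed

lemma schwartz_ft_ft: "f \<in> schwartz \<Longrightarrow> ft (ft f) x = f (- x)"
  using schwartz_ft_inversion[of f "- x"] by simp

definition ift :: "('a::euclidean_space \<Rightarrow> complex) \<Rightarrow> 'a \<Rightarrow> complex" where
  "ift f \<xi> = ft f (- \<xi>)"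

lemma schwartz_ift: "f \<in> schwartz \<Longrightarrow> ift f \<in> schwartz"
  unfolding ift_def[abs_def] by (intro schwartz_reflect schwartz_ft)

lemma schwartz_ft_ift: "f \<in> schwartz \<Longrightarrow> ft (ift f) = f"
  unfolding ift_def[abs_def]
  by (rule ext, subst ft_reflect) (auto simp: schwartz_ft_inversion schwartz_measurable schwartz_ft)

subsection \<open>The Plancherel theorem\<close>

text \<open>Parseval's formula for merely integrable functions, with a Gaussian cut-off:
  \<open>ft_gauss_regularized\<close> integrated against \<open>H\<close>. The estimates for squares
  below arise by releasing the cut-off.\<close>

lemma integral_ft_mult_ft:
  fixes F H :: "'a::euclidean_space \<Rightarrow> complex"
  assumes F: "integrable bmu F" and H: "integrable bmu H" and \<epsilon>: "\<epsilon> > 0"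
  shows "(\<integral>\<alpha>. ft F \<alpha> * ft H (- \<alpha>) * of_real (gauss (\<epsilon> *\<^sub>R \<alpha>)) \<partial>bmu) =
    (\<integral>x. H x * (\<integral>y. F (x + \<epsilon> *\<^sub>R y) * of_real (gauss y) \<partial>bmu) \<partial>bmu)"
proof -
  have [measurable]: "F \<in> borel_measurable borel" "H \<in> borel_measurable borel" using F H by auto
  define K where "K = (\<lambda>x \<alpha>. H x * (ft F \<alpha> * ker \<alpha> (- x) * of_real (gauss (\<epsilon> *\<^sub>R \<alpha>))))"
  define C where "C = (\<integral>s. norm (F s) \<partial>bmu)"
  have iK: "integrable (bmu \<Otimes>\<^sub>M bmu) (\<lambda>(x, \<alpha>). K x \<alpha>)"
  proof (rule integrable_bmu_pair_bound)
    show "integrable bmu (\<lambda>x. norm (H x))" using H by simp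
    show "integrable bmu (\<lambda>\<alpha>::'a. C * gauss (\<epsilon> *\<^sub>R \<alpha>))"
      using \<epsilon> by (intro integrable_mult_right integrable_gauss_scale) simp
    show "(\<lambda>(x, \<alpha>). K x \<alpha>) \<in> borel_measurable borel"
      unfolding K_def borel_prod[symmetric] by measurable
    fix x \<alpha> :: 'a
    have "norm (K x \<alpha>) = norm (H x) * (norm (ft F \<alpha>) * gauss (\<epsilon> *\<^sub>R \<alpha>))"
      by (simp add: K_def norm_mult abs_of_pos gauss_pos)
    also have "\<dots> \<le> norm (H x) * (C * gauss (\<epsilon> *\<^sub>R \<alpha>))"
      unfolding C_def using gauss_pos[of "\<epsilon> *\<^sub>R \<alpha>"] by (intro mult_left_mono mult_right_mono norm_ft_le) auto
    also have "\<dots> \<le> \<bar>norm (H x)\<bar> * \<bar>C * gauss (\<epsilon> *\<^sub>R \<alpha>)\<bar>"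
      by (simp add: mult_left_mono)
    finally show "norm (case (x, \<alpha>) of (x, \<alpha>) \<Rightarrow> K x \<alpha>) \<le> \<bar>norm (H x)\<bar> * \<bar>C * gauss (\<epsilon> *\<^sub>R \<alpha>)\<bar>" by simp
  qed
  have "(\<integral>\<alpha>. ft F \<alpha> * ft H (- \<alpha>) * of_real (gauss (\<epsilon> *\<^sub>R \<alpha>)) \<partial>bmu) = (\<integral>\<alpha>. (\<integral>x. K x \<alpha> \<partial>bmu) \<partial>bmu)"
  proof (rule Bochner_Integration.integral_cong)
    fix \<alpha> :: 'a
    have "K x \<alpha> = (H x * ker x (- \<alpha>)) * (ft F \<alpha> * of_real (gauss (\<epsilon> *\<^sub>R \<alpha>)))" for x
      unfolding K_def ker_minus ker_commute[of \<alpha> x] by (simp add: mult_ac)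
    then show "ft F \<alpha> * ft H (- \<alpha>) * of_real (gauss (\<epsilon> *\<^sub>R \<alpha>)) = (\<integral>x. K x \<alpha> \<partial>bmu)"
      by (simp add: ft_def[of H])
  qed simp
  also have "\<dots> = (\<integral>x. (\<integral>\<alpha>. K x \<alpha> \<partial>bmu) \<partial>bmu)"
    by (rule bmu_pair.Fubini_integral[OF iK])
  also have "\<dots> = (\<integral>x. H x * (\<integral>y. F (x + \<epsilon> *\<^sub>R y) * of_real (gauss y) \<partial>bmu) \<partial>bmu)"
    unfolding K_def integral_mult_right_zero ft_gauss_regularized[OF F \<epsilon>] ..
  finally show ?thesis .
qed

text \<open>Integrability can be dispensed with because the integral of a non-integrable function is
  0 by default.\<close>

lemma norm_integral_le_nn_integral:
  fixes f :: "'a \<Rightarrow> 'b::{banach, second_countable_topology}"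
  shows "ennreal (norm (integral\<^sup>L M f)) \<le> (\<integral>\<^sup>+x. ennreal (norm (f x)) \<partial>M)"
  by (cases "integrable M f") (auto intro: integral_norm_bound_ennreal simp: not_integrable_integral_eq)

lemma nn_integral_gauss: "(\<integral>\<^sup>+x. ennreal (gauss (x::'a::euclidean_space)) \<partial>bmu) = 1"
  using integral_gauss integrable_gauss gauss_pos
  by (subst nn_integral_eq_integral) (auto intro: less_imp_le)

text \<open>Young's inequality for the Gaussian average of the translates of \<open>F\<close>: the autocorrelation
  of \<open>F\<close> is bounded by its square norm.\<close>

lemma nn_integral_ft_square_le:
  fixes F :: "'a::euclidean_space \<Rightarrow> complex"
  assumes F: "integrable bmu F"
  shows "(\<integral>\<^sup>+\<alpha>. ennreal ((norm (ft F \<alpha>))\<^sup>2) \<partial>bmu) \<le> (\<integral>\<^sup>+x. ennreal ((norm (F x))\<^sup>2) \<partial>bmu)"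
proof -
  have [measurable]: "F \<in> borel_measurable borel" using F by auto
  let ?S = "\<integral>\<^sup>+x. ennreal ((norm (F x))\<^sup>2) \<partial>bmu"
  have step: "(\<integral>\<^sup>+\<alpha>. ennreal ((norm (ft F \<alpha>))\<^sup>2 * gauss (\<epsilon> *\<^sub>R \<alpha>)) \<partial>bmu) \<le> ?S" if \<epsilon>: "\<epsilon> > 0" for \<epsilon> :: real
  proof -
    let ?Y = "\<lambda>x y. ((norm (F x))\<^sup>2 + (norm (F (x + \<epsilon> *\<^sub>R y)))\<^sup>2) / 2"
    let ?m = "\<lambda>x. \<integral>y. F (x + \<epsilon> *\<^sub>R y) * of_real (gauss y) \<partial>bmu"
    let ?w = "\<lambda>\<alpha>. (norm (ft F \<alpha>))\<^sup>2 * gauss (\<epsilon> *\<^sub>R \<alpha>)"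
    \<comment> \<open>With the conjugate of \<open>F\<close> as second function, the product of the
      two transforms becomes the squared modulus of \<open>ft F \<alpha>\<close>.\<close>
    have H: "integrable bmu (\<lambda>x. cnj (F x))" using F by simp
    have gi: "integrable bmu (\<lambda>\<alpha>. ?w \<alpha>)"
    proof (rule Bochner_Integration.integrable_bound)
      show "integrable bmu (\<lambda>\<alpha>::'a. (\<integral>s. norm (F s) \<partial>bmu)\<^sup>2 * gauss (\<epsilon> *\<^sub>R \<alpha>))"
        using \<epsilon> by (intro integrable_mult_right integrable_gauss_scale) simp
      show "AE \<alpha> in bmu. norm (?w \<alpha>) \<le> norm ((\<integral>s. norm (F s) \<partial>bmu)\<^sup>2 * gauss (\<epsilon> *\<^sub>R \<alpha>))"
        by (intro AE_I2) (simp add: abs_mult mult_right_mono power_mono norm_ft_le)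
    qed measurable
    have "(\<integral>\<alpha>. ft F \<alpha> * ft (\<lambda>x. cnj (F x)) (- \<alpha>) * of_real (gauss (\<epsilon> *\<^sub>R \<alpha>)) \<partial>bmu) =
      (\<integral>\<alpha>. complex_of_real (?w \<alpha>) \<partial>bmu)"
      by (intro Bochner_Integration.integral_cong) (simp_all add: ft_cnj complex_norm_square[symmetric])
    then have eq: "(\<integral>x. cnj (F x) * (?m x) \<partial>bmu) =
      of_real (\<integral>\<alpha>. ?w \<alpha> \<partial>bmu)"
      unfolding integral_ft_mult_ft[OF F H \<epsilon>] by (simp only: integral_complex_of_real)
    have "(\<integral>\<^sup>+\<alpha>. ennreal (?w \<alpha>) \<partial>bmu) =
      ennreal (\<integral>\<alpha>. ?w \<alpha> \<partial>bmu)"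
      using gi by (intro nn_integral_eq_integral) (auto simp: gauss_pos less_imp_le)
    also have "\<dots> \<le> ennreal (norm (\<integral>x. cnj (F x) * (?m x) \<partial>bmu))"
      unfolding eq by (intro ennreal_leI) simp
    also have "\<dots> \<le> (\<integral>\<^sup>+x. ennreal (norm (cnj (F x) * (?m x))) \<partial>bmu)"
      by (rule norm_integral_le_nn_integral) 
    also have "\<dots> \<le> (\<integral>\<^sup>+x. (\<integral>\<^sup>+y. ennreal (?Y x y * gauss y) \<partial>bmu) \<partial>bmu)"
    proof (rule nn_integral_mono)
      fix x :: 'a
      have mult: "cnj (F x) * (?m x) =
        (\<integral>y. cnj (F x) * (F (x + \<epsilon> *\<^sub>R y) * of_real (gauss y)) \<partial>bmu)"
        by (rule integral_mult_right_zero[symmetric])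
      have "ennreal (norm (cnj (F x) * (?m x))) \<le> (\<integral>\<^sup>+y. ennreal (norm (cnj (F x) * (F (x + \<epsilon> *\<^sub>R y) * of_real (gauss y)))) \<partial>bmu)"
        unfolding mult by (rule norm_integral_le_nn_integral)
      also have "\<dots> \<le> (\<integral>\<^sup>+y. ennreal (?Y x y * gauss y) \<partial>bmu)"
      proof (intro nn_integral_mono ennreal_leI)
        fix y :: 'a
        have "norm (F x) * norm (F (x + \<epsilon> *\<^sub>R y)) \<le> ?Y x y"
          using sum_squares_bound[of "norm (F x)" "norm (F (x + \<epsilon> *\<^sub>R y))"] by simp
        then show "norm (cnj (F x) * (F (x + \<epsilon> *\<^sub>R y) * of_real (gauss y))) \<le> ?Y x y * gauss y"
          by (simp add: norm_mult abs_of_pos gauss_pos mult_right_mono less_imp_le flip: mult.assoc)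
      qed
      finally show "ennreal (norm (cnj (F x) * (?m x))) \<le>
         (\<integral>\<^sup>+y. ennreal (?Y x y * gauss y) \<partial>bmu)" .
    qed
    also have "\<dots> = (\<integral>\<^sup>+y. (\<integral>\<^sup>+x. ennreal (?Y x y * gauss y) \<partial>bmu) \<partial>bmu)"
      by (rule bmu_pair.Fubini') measurable
    also have "\<dots> = (\<integral>\<^sup>+(y::'a). ennreal (gauss y) * ?S \<partial>bmu)"
    proof (rule nn_integral_cong)
      fix y :: 'a
      have shift: "(\<integral>\<^sup>+x. ennreal ((norm (F (x + \<epsilon> *\<^sub>R y)))\<^sup>2) \<partial>bmu) = ?S"
        using nn_integral_bmu_affine[of 1 "\<lambda>x. ennreal ((norm (F x))\<^sup>2)" "\<epsilon> *\<^sub>R y"]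
        by (simp add: add.commute)
      have "(\<integral>\<^sup>+x. ennreal (?Y x y * gauss y) \<partial>bmu) =
        (\<integral>\<^sup>+x. ennreal (gauss y / 2) * (ennreal ((norm (F x))\<^sup>2) + ennreal ((norm (F (x + \<epsilon> *\<^sub>R y)))\<^sup>2)) \<partial>bmu)"
        using gauss_pos[of y]
        by (intro nn_integral_cong) (simp flip: ennreal_plus ennreal_mult add: field_simps)
      also have "\<dots> = ennreal (gauss y / 2) * (?S + ?S)"
        by (subst nn_integral_cmult, measurable) (subst nn_integral_add, auto simp: shift)
      also have "\<dots> = (ennreal (gauss y / 2) + ennreal (gauss y / 2)) * ?S"
        by (simp add: distrib_left distrib_right)
      also have "ennreal (gauss y / 2) + ennreal (gauss y / 2) = ennreal (gauss y)"
        using gauss_pos[of y] by (simp flip: ennreal_plus)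
      finally show "(\<integral>\<^sup>+x. ennreal (?Y x y * gauss y) \<partial>bmu) = ennreal (gauss y) * ?S" .
    qed
    also have "\<dots> = ?S"
      by (subst nn_integral_multc) (simp_all add: nn_integral_gauss)
    finally show ?thesis .
  qed
  \<comment> \<open>The cut-off is released along \<epsilon> = 1/(n+1). Fatou's lemma is enough,
    since only an upper bound is claimed.\<close>
  let ?e = "\<lambda>n. inverse (real (Suc n))"
  have "(\<integral>\<^sup>+\<alpha>. ennreal ((norm (ft F \<alpha>))\<^sup>2) \<partial>bmu) =
     (\<integral>\<^sup>+\<alpha>. liminf (\<lambda>n. ennreal ((norm (ft F \<alpha>))\<^sup>2 * gauss (?e n *\<^sub>R \<alpha>))) \<partial>bmu)"
  proof (rule nn_integral_cong)
    fix \<alpha> :: 'a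
    have "(\<lambda>n. ennreal ((norm (ft F \<alpha>))\<^sup>2 * gauss (?e n *\<^sub>R \<alpha>))) \<longlonglongrightarrow> ennreal ((norm (ft F \<alpha>))\<^sup>2 * 1)"
      by (intro tendsto_ennrealI tendsto_mult_left gauss_scale_tendsto)
    then show "ennreal ((norm (ft F \<alpha>))\<^sup>2) = liminf (\<lambda>n. ennreal ((norm (ft F \<alpha>))\<^sup>2 * gauss (?e n *\<^sub>R \<alpha>)))"
      using lim_imp_Liminf[OF sequentially_bot] by fastforce
  qed
  also have "\<dots> \<le> liminf (\<lambda>n. \<integral>\<^sup>+\<alpha>. ennreal ((norm (ft F \<alpha>))\<^sup>2 * gauss (?e n *\<^sub>R \<alpha>)) \<partial>bmu)"
    by (rule nn_integral_liminf) measurable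
  also have "\<dots> \<le> liminf (\<lambda>n. ?S)"
    by (intro Liminf_mono always_eventually allI step) simp
  also have "\<dots> = ?S" by (simp add: Liminf_const)
  finally show ?thesis .
qed

lemma
  fixes F :: "'a::euclidean_space \<Rightarrow> complex"
  assumes F: "integrable bmu F" and F2: "integrable bmu (\<lambda>x. (norm (F x))\<^sup>2)"
  shows integrable_ft_square: "integrable bmu (\<lambda>\<alpha>. (norm (ft F \<alpha>))\<^sup>2)"
    and integral_ft_square_le: "(\<integral>\<alpha>. (norm (ft F \<alpha>))\<^sup>2 \<partial>bmu) \<le> (\<integral>x. (norm (F x))\<^sup>2 \<partial>bmu)"
proof -
  have [measurable]: "F \<in> borel_measurable borel" using F by auto
  have eq: "(\<integral>\<^sup>+x. ennreal ((norm (F x))\<^sup>2) \<partial>bmu) = ennreal (\<integral>x. (norm (F x))\<^sup>2 \<partial>bmu)"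
    using F2 by (intro nn_integral_eq_integral) auto
  then have le: "(\<integral>\<^sup>+\<alpha>. ennreal ((norm (ft F \<alpha>))\<^sup>2) \<partial>bmu) \<le> ennreal (\<integral>x. (norm (F x))\<^sup>2 \<partial>bmu)"
    using nn_integral_ft_square_le[OF F] by simp
  also have "\<dots> < \<infinity>" by simp
  finally show i: "integrable bmu (\<lambda>\<alpha>. (norm (ft F \<alpha>))\<^sup>2)"
    by (intro integrableI_bounded) auto
  show "(\<integral>\<alpha>. (norm (ft F \<alpha>))\<^sup>2 \<partial>bmu) \<le> (\<integral>x. (norm (F x))\<^sup>2 \<partial>bmu)"
    using le nn_integral_eq_integral[OF i] by (simp add: integral_nonneg_AE)
qed

section \<open>Parseval's formula against continuous test functions\<close>

lemma integrable_mult_square: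
  fixes f g :: "'a \<Rightarrow> complex"
  assumes "f \<in> borel_measurable M" "g \<in> borel_measurable M"
    and "integrable M (\<lambda>x. (norm (f x))\<^sup>2)" "integrable M (\<lambda>x. (norm (g x))\<^sup>2)"
  shows "integrable M (\<lambda>x. f x * g x)"
proof (rule Bochner_Integration.integrable_bound)
  show "integrable M (\<lambda>x. (norm (f x))\<^sup>2 + (norm (g x))\<^sup>2)" using assms by auto
  show "(\<lambda>x. f x * g x) \<in> borel_measurable M" using assms by measurable
  have "norm (f x) * norm (g x) \<le> (norm (f x))\<^sup>2 + (norm (g x))\<^sup>2" for x
  proof -
    have "0 \<le> norm (f x) * norm (g x)" by simp
    then show ?thesis using sum_squares_bound[of "norm (f x)" "norm (g x)"] by linarith
  qed
  then show "AE x in M. norm (f x * g x) \<le> norm ((norm (f x))\<^sup>2 + (norm (g x))\<^sup>2)"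
    by (intro AE_I2) (simp add: norm_mult)
qed

text \<open>The regularization is put on \<open>h\<close>: by continuity its Gaussian averages
  converge at every point, and they stay below \<open>B\<close>, so \<open>norm (F x) * B\<close> is
  a majorant. Thus \<open>F\<close> may be any function that is integrable and square
  integrable.\<close>

lemma parseval_continuous:
  fixes F h :: "'a::euclidean_space \<Rightarrow> complex"
  assumes F: "integrable bmu F" and F2: "integrable bmu (\<lambda>x. (norm (F x))\<^sup>2)"
    and h: "integrable bmu h" and cont: "continuous_on UNIV h" and bdd: "\<And>x. norm (h x) \<le> B"
  shows "(\<integral>x. F x * h x \<partial>bmu) = (\<integral>\<alpha>. ft F \<alpha> * ft h (- \<alpha>) \<partial>bmu)"
    and "integrable bmu (\<lambda>\<alpha>. ft F \<alpha> * ft h (- \<alpha>))"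
    and "integrable bmu (\<lambda>x. (norm (h x))\<^sup>2)"
proof -
  have [measurable]: "F \<in> borel_measurable borel" "h \<in> borel_measurable borel" using F h by auto
  have B: "0 \<le> B" using bdd[of 0] norm_ge_zero[of "h 0"] by linarith
  show h2: "integrable bmu (\<lambda>x. (norm (h x))\<^sup>2)"
  proof (rule Bochner_Integration.integrable_bound)
    show "integrable bmu (\<lambda>x. B * norm (h x))" using h by simp
    show "AE x in bmu. norm ((norm (h x))\<^sup>2) \<le> norm (B * norm (h x))"
      using bdd B by (intro AE_I2) (auto simp: power2_eq_square abs_mult intro!: mult_right_mono)
  qed measurable
  have i2: "integrable bmu (\<lambda>\<alpha>. (norm (ft h (- \<alpha>)))\<^sup>2)"
    using integrable_bmu_reflect[OF integrable_ft_square[OF h h2]] .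
  show ip: "integrable bmu (\<lambda>\<alpha>. ft F \<alpha> * ft h (- \<alpha>))"
    by (intro integrable_mult_square integrable_ft_square F F2 i2) measurable
  let ?e = "\<lambda>n. inverse (real (Suc n))"
  let ?p = "\<lambda>\<alpha>. ft F \<alpha> * ft h (- \<alpha>)"
  let ?g = "\<lambda>n \<alpha>. complex_of_real (gauss (?e n *\<^sub>R \<alpha>))"
  let ?m = "\<lambda>n x. \<integral>y. h (x + ?e n *\<^sub>R y) * of_real (gauss y) \<partial>bmu"
  have e: "?e n > 0" for n by simp
  have 1: "(\<lambda>n. \<integral>\<alpha>. ?p \<alpha> * ?g n \<alpha> \<partial>bmu) \<longlonglongrightarrow> (\<integral>\<alpha>. ?p \<alpha> \<partial>bmu)"
    by (rule gauss_regularization_tendsto[OF ip])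
  \<comment> \<open>\<open>h\<close> takes the first place in \<open>integral_ft_mult_ft\<close>, so
    that it is the averaged function; reflecting \<alpha>, under which the Gaussian is even,
    restores the order of the transforms.\<close>
  have swap: "(\<integral>\<alpha>. ?p \<alpha> * ?g n \<alpha> \<partial>bmu) =
     (\<integral>x. F x * (?m n x) \<partial>bmu)" for n
    unfolding integral_ft_mult_ft[OF h F e, symmetric]
    by (subst bmu_reflect[symmetric]) (auto simp: mult_ac simp del: of_nat_Suc)
  have 2: "(\<lambda>n. \<integral>x. F x * (?m n x) \<partial>bmu) \<longlonglongrightarrow> (\<integral>x. F x * h x \<partial>bmu)"
  proof (rule integral_dominated_convergence[where w="\<lambda>x. norm (F x) * B"])
    show "integrable bmu (\<lambda>x. norm (F x) * B)" using F by simp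
    show "AE x in bmu. (\<lambda>n. F x * (?m n x)) \<longlonglongrightarrow> F x * h x"
      by (intro AE_I2 tendsto_mult_left gauss_average_tendsto[OF cont bdd])
    show "AE x in bmu. norm (F x * (?m n x)) \<le> norm (F x) * B" for n
    proof (rule AE_I2)
      fix x :: 'a
      have "norm (?m n x) \<le> (\<integral>y. norm (h (x + ?e n *\<^sub>R y) * of_real (gauss y)) \<partial>bmu)"
        by (rule integral_norm_bound)
      also have "\<dots> \<le> (\<integral>y. B * gauss (y::'a) \<partial>bmu)"
      proof (rule integral_mono')
        show "integrable bmu (\<lambda>y::'a. B * gauss y)" by (intro integrable_mult_right integrable_gauss)
        show "norm (h (x + ?e n *\<^sub>R y) * of_real (gauss y)) \<le> B * gauss y" for y
          using bdd by (simp add: norm_mult abs_of_pos gauss_pos mult_right_mono less_imp_le)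
        show "0 \<le> B * gauss y" for y :: 'a using B gauss_pos[of y] by simp
      qed
      also have "\<dots> = B" by (simp add: integral_gauss)
      finally show "norm (F x * (?m n x)) \<le> norm (F x) * B"
        by (simp only: norm_mult mult_left_mono norm_ge_zero)
    qed
  qed measurable
  show "(\<integral>x. F x * h x \<partial>bmu) = (\<integral>\<alpha>. ?p \<alpha> \<partial>bmu)"
    by (rule LIMSEQ_unique[OF 2 1[unfolded swap]])
qed

text \<open>Radial truncation: the modulus is cut down to \<open>min r (norm z)\<close> and the
  phase is kept. Written with \<open>max\<close>, the formula is visibly continuous in
  \<open>z\<close> and \<open>r\<close> for positive \<open>r\<close>, also at
  \<open>z = 0\<close>.\<close>

definition clip :: "complex \<Rightarrow> real \<Rightarrow> complex" where
  "clip z r = (r / max r (norm z)) *\<^sub>R z"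

lemma clip_measurable [measurable (raw)]:
  "f \<in> borel_measurable M \<Longrightarrow> g \<in> borel_measurable M \<Longrightarrow> (\<lambda>x. clip (f x) (g x)) \<in> borel_measurable M"
  unfolding clip_def
  by (intro borel_measurable_scaleR borel_measurable_divide borel_measurable_max measurable_compose[OF _ borel_measurable_norm])

lemma cnj_measurable [measurable (raw)]:
  "f \<in> borel_measurable M \<Longrightarrow> (\<lambda>x. cnj (f x)) \<in> borel_measurable M"
  by (rule borel_measurable_continuous_on[OF continuous_on_cnj[OF continuous_on_id]])

lemma clip_id: "0 < r \<Longrightarrow> norm z \<le> r \<Longrightarrow> clip z r = z"
  by (simp add: clip_def max_def)

lemma norm_clip: "0 < r \<Longrightarrow> norm (clip z r) = min r (norm z)"
  by (auto simp: clip_def max_def min_def field_simps)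

lemma mult_cnj_clip: "0 < r \<Longrightarrow> z * cnj (clip z r) = of_real (norm z * min r (norm z))"
proof -
  have "z * cnj (clip z r) = of_real (r / max r (norm z)) * (z * cnj z)"
    by (simp add: clip_def scaleR_conv_of_real)
  also have "\<dots> = of_real (r / max r (norm z) * (norm z)\<^sup>2)"
    by (simp only: complex_norm_square of_real_mult)
  also assume "0 < r"
  then have "r / max r (norm z) * (norm z)\<^sup>2 = norm z * min r (norm z)"
    by (auto simp: max_def min_def power2_eq_square field_simps)
  finally show ?thesis .
qed

lemma tendsto_clip [tendsto_intros]:
  assumes "(f \<longlongrightarrow> a) net" "(g \<longlongrightarrow> r) net" "0 < r"
  shows "((\<lambda>x. clip (f x) (g x)) \<longlongrightarrow> clip a r) net"
  unfolding clip_def using assms by (intro tendsto_intros) (auto simp: max_def)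

text \<open>The bound from below is by duality: \<open>F\<close> is tested against continuous approximations of its
  truncations at multiples of a Gaussian, for which Parseval's formula is available.\<close>

theorem integral_ft_square:
  fixes F :: "'a::euclidean_space \<Rightarrow> complex"
  assumes F: "integrable bmu F" and F2: "integrable bmu (\<lambda>x. (norm (F x))\<^sup>2)"
  shows "(\<integral>\<alpha>. (norm (ft F \<alpha>))\<^sup>2 \<partial>bmu) = (\<integral>x. (norm (F x))\<^sup>2 \<partial>bmu)"
proof (rule antisym)
  have [measurable]: "F \<in> borel_measurable borel" using F by auto
  let ?P = "\<integral>\<alpha>. (norm (ft F \<alpha>))\<^sup>2 \<partial>bmu"
  show "?P \<le> (\<integral>x. (norm (F x))\<^sup>2 \<partial>bmu)" by (rule integral_ft_square_le[OF F F2])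
  let ?r = "\<lambda>n x. real (Suc n) * gauss x"
  \<comment> \<open>The notion \<open>measurable_on\<close> supplies continuous functions
    \<open>g n\<close> that converge to \<open>F\<close> off a negligible set.\<close>
  have "F measurable_on UNIV"
    by (rule lebesgue_measurable_imp_measurable_on) (auto intro: measurable_completion)
  then obtain N g where "negligible N" and gc: "\<And>n. continuous_on UNIV (g n)"
    and gl: "\<And>x. x \<notin> N \<Longrightarrow> (\<lambda>n. g n x) \<longlonglongrightarrow> F x"
    unfolding measurable_on_def by auto
  have "AE x in lebesgue. x \<notin> N"
    using \<open>negligible N\<close> by (simp add: AE_not_in negligible_iff_null_sets)
  then have aeN: "AE x in bmu. x \<notin> N" by (simp add: AE_bmu_iff AE_completion_iff)
  \<comment> \<open>The level \<open>R * gauss x\<close> is positive, continuous, bounded and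
    integrable. Truncating the continuous \<open>g n\<close> at it yields functions admissible in
    Parseval's formula and with a common majorant.\<close>
  have bound: "(\<integral>x. (norm (clip (F x) (R * gauss x)))\<^sup>2 \<partial>bmu) \<le> ?P" if R: "R > 0" for R
  proof -
    have Rg: "0 < R * gauss x" for x :: 'a using R gauss_pos by (rule mult_pos_pos)
    have Rg': "R * gauss x \<le> R" for x :: 'a using mult_left_mono[OF gauss_le_1, of R x] R by simp
    define c where "c x = clip (F x) (R * gauss x)" for x
    define h where "h n x = cnj (clip (g n x) (R * gauss x))" for n x
    have [measurable]: "g n \<in> borel_measurable borel" for n by (rule borel_measurable_continuous_onI[OF gc])
    have [measurable]: "h n \<in> borel_measurable borel" "c \<in> borel_measurable borel" for n
      unfolding h_def[abs_def] c_def[abs_def] by measurable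
    have hb: "norm (h n x) \<le> R * gauss x" for n x by (simp add: h_def norm_clip Rg)
    have cb: "norm (c x) \<le> R * gauss x" "norm (c x) \<le> norm (F x)" for x by (simp_all add: c_def norm_clip Rg)
    have hi: "integrable bmu (h n)" for n
    proof (rule Bochner_Integration.integrable_bound)
      show "integrable bmu (\<lambda>x::'a. R * gauss x)" by (intro integrable_mult_right integrable_gauss)
      show "AE x in bmu. norm (h n x) \<le> norm (R * gauss x)" using hb Rg by (intro AE_I2) (simp add: abs_of_pos)
    qed simp
    have hc: "continuous_on UNIV (h n)" for n
      unfolding continuous_on_def h_def
    proof (intro ballI tendsto_intros)
      fix x :: 'a
      show "(g n \<longlongrightarrow> g n x) (at x)" using gc by (simp add: continuous_on_def)
      show "(gauss \<longlongrightarrow> gauss x) (at x)" using continuous_gauss[where 'a='a] by (simp add: continuous_on_def)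
      show "0 < R * gauss x" by (rule Rg)
    qed
    have hbR: "norm (h n x) \<le> R" for n x using hb Rg' by (rule order_trans)
    have hl: "AE x in bmu. (\<lambda>n. h n x) \<longlonglongrightarrow> cnj (c x)"
      using aeN unfolding h_def c_def
      by eventually_elim (intro tendsto_intros gl Rg)
    \<comment> \<open>Parseval, followed by 2ab \<le> a^2 + b^2. The transform of \<open>h n\<close>
      is controlled by the inequality \<open>integral_ft_square_le\<close>, already available for
      it.\<close>
    have step: "norm (\<integral>x. F x * h n x \<partial>bmu) \<le> (?P + (\<integral>x. (norm (h n x))\<^sup>2 \<partial>bmu)) / 2" for n
    proof -
      note par = parseval_continuous[OF F F2 hi[of n] hc[of n] hbR[of n]]
      have iP: "integrable bmu (\<lambda>\<alpha>. (norm (ft F \<alpha>))\<^sup>2)" by (rule integrable_ft_square[OF F F2])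
      have iQ: "integrable bmu (\<lambda>\<alpha>. (norm (ft (h n) (- \<alpha>)))\<^sup>2)"
        by (rule integrable_bmu_reflect[OF integrable_ft_square[OF hi par(3)]])
      have "norm (\<integral>x. F x * h n x \<partial>bmu) \<le> (\<integral>\<alpha>. norm (ft F \<alpha> * ft (h n) (- \<alpha>)) \<partial>bmu)"
        unfolding par(1) by (rule integral_norm_bound)
      also have "\<dots> \<le> (\<integral>\<alpha>. ((norm (ft F \<alpha>))\<^sup>2 + (norm (ft (h n) (- \<alpha>)))\<^sup>2) / 2 \<partial>bmu)"
      proof (rule integral_mono)
        show "integrable bmu (\<lambda>\<alpha>. norm (ft F \<alpha> * ft (h n) (- \<alpha>)))" using par(2) by (rule integrable_norm)
        show "integrable bmu (\<lambda>\<alpha>. ((norm (ft F \<alpha>))\<^sup>2 + (norm (ft (h n) (- \<alpha>)))\<^sup>2) / 2)"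
          using iP iQ by (intro integrable_divide Bochner_Integration.integrable_add)
        show "norm (ft F \<alpha> * ft (h n) (- \<alpha>)) \<le> ((norm (ft F \<alpha>))\<^sup>2 + (norm (ft (h n) (- \<alpha>)))\<^sup>2) / 2" for \<alpha>
          using sum_squares_bound[of "norm (ft F \<alpha>)" "norm (ft (h n) (- \<alpha>))"] by (simp add: norm_mult)
      qed
      also have "\<dots> = (?P + (\<integral>\<alpha>. (norm (ft (h n) (- \<alpha>)))\<^sup>2 \<partial>bmu)) / 2"
        using iP iQ by simp
      also have "(\<integral>\<alpha>. (norm (ft (h n) (- \<alpha>)))\<^sup>2 \<partial>bmu) = (\<integral>\<alpha>. (norm (ft (h n) \<alpha>))\<^sup>2 \<partial>bmu)"
        by (rule bmu_reflect[of "\<lambda>\<alpha>. (norm (ft (h n) \<alpha>))\<^sup>2"]) measurable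
      also have "\<dots> \<le> (\<integral>x. (norm (h n x))\<^sup>2 \<partial>bmu)" by (rule integral_ft_square_le[OF hi par(3)])
      finally show ?thesis by simp
    qed
    have l1: "(\<lambda>n. \<integral>x. F x * h n x \<partial>bmu) \<longlonglongrightarrow> (\<integral>x. F x * cnj (c x) \<partial>bmu)"
    proof (rule integral_dominated_convergence[where w="\<lambda>x. norm (F x) * R"])
      show "AE x in bmu. (\<lambda>n. F x * h n x) \<longlonglongrightarrow> F x * cnj (c x)"
        using hl by eventually_elim (rule tendsto_mult_left)
      show "AE x in bmu. norm (F x * h n x) \<le> norm (F x) * R" for n
        using hbR by (intro AE_I2) (simp add: norm_mult mult_left_mono)
      show "integrable bmu (\<lambda>x. norm (F x) * R)" using F by simp
    qed measurable
    have l2: "(\<lambda>n. \<integral>x. (norm (h n x))\<^sup>2 \<partial>bmu) \<longlonglongrightarrow> (\<integral>x. (norm (c x))\<^sup>2 \<partial>bmu)"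
    proof (rule integral_dominated_convergence[where w="\<lambda>x. R * (R * gauss x)"])
      show "AE x in bmu. (\<lambda>n. (norm (h n x))\<^sup>2) \<longlonglongrightarrow> (norm (c x))\<^sup>2"
        using hl
      proof eventually_elim
        case (elim x)
        then have "(\<lambda>n. (norm (h n x))\<^sup>2) \<longlonglongrightarrow> (norm (cnj (c x)))\<^sup>2" by (intro tendsto_intros)
        then show ?case by simp
      qed
      show "AE x in bmu. norm ((norm (h n x))\<^sup>2) \<le> R * (R * gauss x)" for n
        unfolding power2_eq_square
        by (intro AE_I2) (use hbR hb R in \<open>simp add: mult_mono\<close>)
      show "integrable bmu (\<lambda>x::'a. R * (R * gauss x))" by (intro integrable_mult_right integrable_gauss)
    qed measurable
    have le: "norm (\<integral>x. F x * cnj (c x) \<partial>bmu) \<le> (?P + (\<integral>x. (norm (c x))\<^sup>2 \<partial>bmu)) / 2"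
      using step by (intro LIMSEQ_le[OF tendsto_norm[OF l1], of "\<lambda>n. (?P + (\<integral>x. (norm (h n x))\<^sup>2 \<partial>bmu)) / 2"] tendsto_intros l2) auto
    have eqF: "F x * cnj (c x) = of_real (norm (F x) * norm (c x))" for x
      unfolding c_def by (simp add: mult_cnj_clip norm_clip Rg)
    have iFc: "integrable bmu (\<lambda>x. norm (F x) * norm (c x))"
      by (rule Bochner_Integration.integrable_bound[OF F2])
         (use cb(2) in \<open>auto simp: power2_eq_square abs_mult intro!: AE_I2 mult_left_mono\<close>)
    \<comment> \<open>\<open>F\<close> paired with the conjugate of its truncation \<open>c\<close>
      dominates the square norm of \<open>c\<close>. So \<open>le\<close> bounds this norm by half
      of itself plus half of \<open>?P\<close>, and the former half is absorbed.\<close>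
    have "(\<integral>x. (norm (c x))\<^sup>2 \<partial>bmu) \<le> (\<integral>x. norm (F x) * norm (c x) \<partial>bmu)"
    proof (rule integral_mono'[OF iFc])
      show "(norm (c x))\<^sup>2 \<le> norm (F x) * norm (c x)" for x
        unfolding power2_eq_square using cb(2) by (intro mult_right_mono) auto
    qed simp
    also have "\<dots> \<le> norm (\<integral>x. F x * cnj (c x) \<partial>bmu)"
      unfolding eqF integral_complex_of_real by simp
    finally show ?thesis using le unfolding c_def by simp
  qed
  \<comment> \<open>Along R = n+1 the truncation is inactive at each point from some index on,
    because the Gaussian is positive there.\<close>
  have lim: "(\<lambda>n. \<integral>x. (norm (clip (F x) (?r n x)))\<^sup>2 \<partial>bmu) \<longlonglongrightarrow> (\<integral>x. (norm (F x))\<^sup>2 \<partial>bmu)"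
  proof (rule integral_dominated_convergence[where w="\<lambda>x. (norm (F x))\<^sup>2"])
    show "AE x in bmu. (\<lambda>n. (norm (clip (F x) (?r n x)))\<^sup>2) \<longlonglongrightarrow> (norm (F x))\<^sup>2"
    proof (rule AE_I2)
      fix x :: 'a
      obtain m :: nat where m: "norm (F x) / gauss x \<le> real m" using real_arch_simple by blast
      have "clip (F x) (?r n x) = F x" if "n \<ge> m" for n
      proof (rule clip_id)
        have "norm (F x) \<le> real m * gauss x" using m gauss_pos[of x] by (simp add: field_simps)
        also have "\<dots> \<le> ?r n x" using that gauss_pos[of x] by (intro mult_right_mono) auto
        finally show "norm (F x) \<le> ?r n x" .
      qed (simp add: gauss_pos)
      then have "\<forall>\<^sub>F n in sequentially. (norm (clip (F x) (?r n x)))\<^sup>2 = (norm (F x))\<^sup>2"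
        unfolding eventually_sequentially by metis
      then show "(\<lambda>n. (norm (clip (F x) (?r n x)))\<^sup>2) \<longlonglongrightarrow> (norm (F x))\<^sup>2"
        by (rule tendsto_eventually)
    qed
    show "AE x in bmu. norm ((norm (clip (F x) (?r n x)))\<^sup>2) \<le> (norm (F x))\<^sup>2" for n
    proof (rule AE_I2)
      fix x :: 'a
      have "norm (clip (F x) (?r n x)) \<le> norm (F x)"
        by (simp add: norm_clip gauss_pos del: of_nat_Suc)
      then have "(norm (clip (F x) (?r n x)))\<^sup>2 \<le> (norm (F x))\<^sup>2"
        by (rule power_mono) simp
      then show "norm ((norm (clip (F x) (?r n x)))\<^sup>2) \<le> (norm (F x))\<^sup>2"
        by simp
    qed
    show "(\<lambda>x. (norm (clip (F x) (?r n x)))\<^sup>2) \<in> borel_measurable bmu" for n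
      by measurable
  qed (use F2 in measurable)
  show "(\<integral>x. (norm (F x))\<^sup>2 \<partial>bmu) \<le> ?P"
    by (rule LIMSEQ_le_const2[OF lim]) (auto intro!: bound simp del: of_nat_Suc)
qed

section \<open>The area formula with multiplicity\<close>

subsection \<open>Injective pieces of a local diffeomorphism\<close>

text \<open>A continuous derivative that is injective at a point makes the map injective near it.
  Halving the radius of the ball puts a compact closure inside the domain of injectivity and inside
  \<Omega>, and Lindelof's theorem leaves countably many balls.\<close>

lemma compact_injective_cover:
  fixes p :: "'a::euclidean_space \<Rightarrow> 'a"
  assumes der: "\<And>x. (p has_derivative p' x) (at x)"
    and cont: "\<And>v. continuous_on UNIV (\<lambda>x. p' x v)"
    and \<Omega>: "open \<Omega>" "\<And>x. x \<in> \<Omega> \<Longrightarrow> inj (p' x)"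
  shows "\<exists>C :: nat \<Rightarrow> 'a set. (\<forall>i. compact (C i)) \<and> (\<forall>i. inj_on p (C i)) \<and> (\<Union>i. C i) = \<Omega>"
proof -
  define F where "F = {U. open U \<and> compact (closure U) \<and> inj_on p (closure U) \<and> closure U \<subseteq> \<Omega>}"
  have pt: "\<exists>U\<in>F. a \<in> U" if a: "a \<in> \<Omega>" for a
  proof -
    have lin: "linear (p' a)" using der by (rule has_derivative_linear)
    obtain g' where g': "linear g'" "g' \<circ> p' a = id"
      using linear_injective_left_inverse[OF lin \<Omega>(2)[OF a]] by blast
    \<comment> \<open>\<open>has_derivative_locally_injective\<close> requires continuity of the
      derivative in operator norm. That norm is at most the sum of the deviations on the basis
      vectors, which is continuous by \<open>cont\<close>.\<close>
    have "\<exists>d>0. \<forall>x. dist a x < d \<longrightarrow> onorm (\<lambda>v. p' x v - p' a v) < e" if e: "e > 0" for e :: real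
    proof -
      define s where "s x = (\<Sum>b\<in>Basis. norm (p' x b - p' a b))" for x
      have "continuous_on UNIV s"
        unfolding s_def by (intro continuous_intros cont)
      then have "(s \<longlongrightarrow> s a) (at a)" by (simp add: continuous_on_def)
      then have "(s \<longlongrightarrow> 0) (at a)" by (simp add: s_def)
      then obtain d where d: "d > 0" "\<And>x. x \<noteq> a \<Longrightarrow> dist x a < d \<Longrightarrow> \<bar>s x\<bar> < e"
        using e unfolding LIM_def by (metis dist_real_def diff_zero)
      have "onorm (\<lambda>v. p' x v - p' a v) < e" if "dist a x < d" for x
      proof -
        have linx: "linear (\<lambda>v. p' x v - p' a v)"
          by (intro linear_compose_sub has_derivative_linear[OF der])
        have "onorm (\<lambda>v. p' x v - p' a v) \<le> s x"
        proof (rule onorm_le)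
          fix v
          have "p' x v - p' a v = (\<Sum>b\<in>Basis. (v \<bullet> b) *\<^sub>R (p' x b - p' a b))"
            using linear_sum[OF linx, of "\<lambda>b. (v \<bullet> b) *\<^sub>R b" Basis] linear_cmul[OF linx]
            by (simp add: euclidean_representation)
          also have "norm \<dots> \<le> (\<Sum>b\<in>Basis. norm ((v \<bullet> b) *\<^sub>R (p' x b - p' a b)))"
            by (rule norm_sum)
          also have "\<dots> \<le> (\<Sum>b\<in>Basis. norm v * norm (p' x b - p' a b))"
            by (intro sum_mono) (simp add: Basis_le_norm mult_right_mono)
          also have "\<dots> = s x * norm v" by (simp add: s_def sum_distrib_left mult.commute)
          finally show "norm (p' x v - p' a v) \<le> s x * norm v" .
        qed
        also have "s x < e"
          using d(2)[of x] that e by (cases "x = a") (auto simp: s_def dist_commute)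
        finally show ?thesis .
      qed
      then show ?thesis using d(1) by blast
    qed
    then obtain r where r: "r > 0" "ball a r \<subseteq> \<Omega>" "inj_on p (ball a r)"
      using has_derivative_locally_injective[of a \<Omega> g' p' p, OF a \<Omega>(1) _ g'(2) der] g'(1)
      by (metis linear_conv_bounded_linear)
    have "closure (ball a (r / 2)) \<subseteq> ball a r"
      using r by (auto simp: closure_ball)
    moreover have "compact (closure (ball a (r / 2)))" by (simp add: compact_closure)
    ultimately have "ball a (r / 2) \<in> F"
      using r unfolding F_def by (auto intro: inj_on_subset)
    then show ?thesis using r by (intro bexI[of _ "ball a (r / 2)"]) auto
  qed
  obtain F' where F': "F' \<subseteq> F" "countable F'" "\<Union>F' = \<Union>F"
    using Lindelof[of F] by (auto simp: F_def)
  \<comment> \<open>The empty set is itself a member of \<open>F\<close>; inserting it keeps the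
    enumeration meaningful when \<open>F'\<close> is empty.\<close>
  define C where "C i = closure (from_nat_into (insert {} F') i)" for i
  have mem: "from_nat_into (insert {} F') i \<in> F" for i
    using from_nat_into[of "insert {} F'" i] F'(1) by (auto simp: F_def)
  have "(\<Union>i. C i) = \<Omega>"
  proof
    show "(\<Union>i. C i) \<subseteq> \<Omega>" using mem by (auto simp: C_def F_def)
    show "\<Omega> \<subseteq> (\<Union>i. C i)"
    proof
      fix a assume "a \<in> \<Omega>"
      then obtain U where "U \<in> F'" "a \<in> U" using pt F'(3) by (metis UnionE UnionI)
      moreover obtain i where "from_nat_into (insert {} F') i = U"
        using from_nat_into_surj[of "insert {} F'" U] F'(2) \<open>U \<in> F'\<close> by auto
      ultimately show "a \<in> (\<Union>i. C i)" unfolding C_def using closure_subset by blast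
    qed
  qed
  then show ?thesis using mem by (intro exI[of _ C]) (auto simp: C_def F_def)
qed

text \<open>For images of finite measure this is \<open>has_measure_differentiable_image\<close>.
  For infinite measure the right side must be infinite as well: a finite value would make the
  Jacobian integrable on \<open>S\<close>, and the same equivalence would give the image finite
  measure.\<close>

lemma emeasure_differentiable_image:
  fixes p :: "real^'n::{finite,wellorder} \<Rightarrow> real^'n::_"
  assumes S: "S \<in> sets borel" and der: "\<And>x. (p has_derivative p' x) (at x)" and inj: "inj_on p S"
    and det: "(\<lambda>x. det (matrix (p' x))) \<in> borel_measurable borel"
  shows "emeasure lebesgue (p ` S) = (\<integral>\<^sup>+x. ennreal \<bar>det (matrix (p' x))\<bar> * indicator S x \<partial>lborel)"
proof -
  let ?D = "\<lambda>x. \<bar>det (matrix (p' x))\<bar>"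
  have SL: "S \<in> sets lebesgue" using S by simp
  note iff = has_measure_differentiable_image[OF SL has_derivative_at_withinI[OF der] inj]
  have img: "p ` S \<in> sets lebesgue"
    by (rule differentiable_image_in_sets_lebesgue[OF SL])
       (auto intro!: differentiable_at_withinI[OF differentiableI[OF der]] simp: differentiable_on_def)
  have m: "(\<lambda>x. indicator S x *\<^sub>R ?D x) \<in> borel_measurable borel"
    using S det by measurable
  have nn: "(\<integral>\<^sup>+x. ennreal (?D x) * indicator S x \<partial>lborel) = (\<integral>\<^sup>+x. ennreal (indicator S x *\<^sub>R ?D x) \<partial>lborel)"
    by (intro nn_integral_cong) (auto simp: indicator_def)
  show ?thesis
  proof (cases "p ` S \<in> lmeasurable")
    case True
    then have hi: "(?D has_integral measure lebesgue (p ` S)) S" using iff by blast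
    moreover have "(\<lambda>x. indicator S x *\<^sub>R ?D x) = (\<lambda>x. if x \<in> S then ?D x else 0)"
      by (auto simp: indicator_def)
    ultimately have "((\<lambda>x. indicator S x *\<^sub>R ?D x) has_integral measure lebesgue (p ` S)) UNIV"
      by (simp only: has_integral_restrict_UNIV)
    then have "(\<integral>\<^sup>+x. ennreal (indicator S x *\<^sub>R ?D x) \<partial>lborel) = ennreal (measure lebesgue (p ` S))"
      using m by (intro nn_integral_has_integral_lborel[OF _ _ ]) auto
    then show ?thesis unfolding nn emeasure_eq_measure2[OF True] by (rule sym)
  next
    case False
    then have "\<not> emeasure lebesgue (p ` S) < \<infinity>"
      using img unfolding fmeasurable_def by blast
    then have top: "emeasure lebesgue (p ` S) = \<infinity>" by (simp add: less_top[symmetric])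
    have "(\<integral>\<^sup>+x. ennreal (indicator S x *\<^sub>R ?D x) \<partial>lborel) = \<infinity>"
    proof (rule ccontr)
      assume "\<not> ?thesis"
      then have "(\<integral>\<^sup>+x. ennreal (norm (indicator S x *\<^sub>R ?D x)) \<partial>lborel) < \<infinity>"
        by (simp add: less_top abs_mult)
      then have "integrable lborel (\<lambda>x. indicator S x *\<^sub>R ?D x)"
        using m by (intro integrableI_bounded) auto
      then have "set_integrable lebesgue S ?D"
        unfolding set_integrable_def using m by (subst integrable_completion) auto
      then have "?D integrable_on S"
        by (rule set_lebesgue_integral_eq_integral(1))
      then show False using iff[of "integral S ?D"] False by (auto simp: has_integral_integral)
    qed
    then show ?thesis unfolding nn top by simp
  qed
qed

lemma ennreal_pos_finiteE:
  assumes "x \<noteq> \<infinity>" "x \<noteq> (0::ennreal)"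
  obtains r where "x = ennreal r" "0 < r"
proof -
  have "x = ennreal (enn2real x)" using assms by (simp add: less_top)
  moreover have "0 < enn2real x" using assms by (simp add: enn2real_positive_iff less_top zero_less_iff_neq_zero)
  ultimately show thesis by (rule that)
qed

text \<open>The number of preimages is summed over disjoint pieces of the regular set on which \<open>p\<close> is
  injective; by Sard's theorem, almost no value has a preimage outside the regular set.\<close>

theorem area_formula_wellorder:
  fixes p :: "real^'n::{finite,wellorder} \<Rightarrow> real^'n::_" and f :: "real^'n::_ \<Rightarrow> ennreal"
  assumes der: "\<And>x. (p has_derivative p' x) (at x)"
    and cont: "\<And>v. continuous_on UNIV (\<lambda>x. p' x v)"
    and fin: "AE \<eta> in lborel. emeasure (count_space UNIV) {t. p t = \<eta>} \<noteq> \<infinity> \<and> emeasure (count_space UNIV) {t. p t = \<eta>} \<noteq> 0"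
    and w: "AE t in lborel. w t = \<bar>det (matrix (p' t))\<bar> / enn2real (emeasure (count_space UNIV) {s. p s = p t})"
    and [measurable]: "f \<in> borel_measurable borel"
  shows "(\<integral>\<^sup>+t. f (p t) * ennreal (w t) \<partial>lborel) = (\<integral>\<^sup>+\<eta>. f \<eta> \<partial>lborel)"
proof -
  define n where "n \<eta> = emeasure (count_space UNIV) {t. p t = \<eta>}" for \<eta>
  define D where "D t = \<bar>det (matrix (p' t))\<bar>" for t
  define \<Omega> where "\<Omega> = {t. det (matrix (p' t)) \<noteq> 0}"
  have pc: "continuous_on A p" for A
    by (meson der has_derivative_continuous continuous_at_imp_continuous_on)
  have [measurable]: "p \<in> borel_measurable borel" by (rule borel_measurable_continuous_onI[OF pc])
  have dc: "continuous_on UNIV (\<lambda>t. det (matrix (p' t)))"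
    unfolding det_def matrix_def by (auto intro!: continuous_intros cont)
  have dm: "(\<lambda>t. det (matrix (p' t))) \<in> borel_measurable borel"
    by (rule borel_measurable_continuous_onI[OF dc])
  then have [measurable]: "D \<in> borel_measurable borel" unfolding D_def[abs_def] by measurable
  have lin: "linear (p' x)" for x using der by (rule has_derivative_linear)
  have "open \<Omega>"
    unfolding \<Omega>_def using open_Collect_neq[OF dc continuous_on_const] by simp
  moreover have "inj (p' x)" if "x \<in> \<Omega>" for x
    using that lin det_nz_iff_inj[of "p' x"] by (auto simp: \<Omega>_def)
  ultimately have "\<exists>C :: nat \<Rightarrow> (real^'n::_) set. (\<forall>i. compact (C i)) \<and> (\<forall>i. inj_on p (C i)) \<and> (\<Union>i. C i) = \<Omega>"
    by (rule compact_injective_cover[OF der cont])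
  then obtain C :: "nat \<Rightarrow> (real^'n::_) set"
    where C: "\<And>i. compact (C i)" "\<And>i. inj_on p (C i)" "(\<Union>i. C i) = \<Omega>"
    by blast
  define S where "S = disjointed C"
  have S_sub: "S i \<subseteq> C i" for i unfolding S_def by (rule disjointed_subset)
  have S_UN: "(\<Union>i. S i) = \<Omega>" using C(3) by (simp add: S_def UN_disjointed_eq)
  have S_disj: "disjoint_family S" unfolding S_def by (rule disjoint_family_disjointed)
  have [measurable]: "C i \<in> sets borel" for i using C(1) by (simp add: compact_imp_closed)
  have Sm [measurable]: "S i \<in> sets borel" for i
    unfolding S_def disjointed_def by (auto intro!: sets.Diff sets.finite_UN)
  have inj: "inj_on p (S i)" for i using C(2) S_sub by (rule inj_on_subset)
  let ?d = "\<lambda>i. distr (density lborel (\<lambda>t. ennreal (D t) * indicator (S i) t)) borel p"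
  \<comment> \<open>Injectivity on \<open>C i\<close> lets the image commute with set difference, so
    the image of a disjoint piece is a difference of two compact sets, hence Borel.\<close>
  have pS [measurable]: "p ` S i \<in> sets borel" for i
  proof -
    have "S i = C i - (\<Union>j\<in>{0..<i}. C i \<inter> C j)" unfolding S_def disjointed_def by auto
    then have "p ` S i = p ` C i - p ` (\<Union>j\<in>{0..<i}. C i \<inter> C j)"
      using inj_on_image_set_diff[OF C(2)[of i], of "C i" "\<Union>j\<in>{0..<i}. C i \<inter> C j"] by auto
    moreover have "compact (\<Union>j\<in>{0..<i}. C i \<inter> C j)" by (intro compact_UN) (auto intro: compact_Int C)
    ultimately show ?thesis
      using compact_continuous_image[OF pc] C(1) by (simp add: compact_imp_closed)
  qed
  \<comment> \<open>On one injective piece, the Jacobian times Lebesgue measure is pushed forward to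
    Lebesgue measure on the image; it suffices to compare the two measures on each Borel set
    \<open>B\<close>.\<close>
  have distr: "?d i = density lborel (indicator (p ` S i))" for i
  proof (rule measure_eqI)
    fix B :: "(real^'n::_) set" assume "B \<in> sets (?d i)"
    then have B [measurable]: "B \<in> sets borel" by simp
    have E: "S i \<inter> p -` B \<in> sets borel" using measurable_sets[of p borel borel B] by simp
    have "emeasure (?d i) B =
      (\<integral>\<^sup>+t. ennreal (D t) * indicator (S i) t * indicator (p -` B) t \<partial>lborel)"
      by (subst emeasure_distr, simp_all, subst emeasure_density) (use measurable_sets[of p borel borel B] in auto)
    also have "\<dots> = (\<integral>\<^sup>+t. ennreal (D t) * indicator (S i \<inter> p -` B) t \<partial>lborel)"
      by (intro nn_integral_cong) (auto simp: indicator_def)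
    also have "\<dots> = emeasure lebesgue (p ` (S i \<inter> p -` B))"
      unfolding D_def by (rule emeasure_differentiable_image[OF E der _ dm, symmetric]) (rule inj_on_subset[OF inj], auto)
    also have "p ` (S i \<inter> p -` B) = p ` S i \<inter> B" by auto
    also have "emeasure lebesgue (p ` S i \<inter> B) = emeasure (density lborel (indicator (p ` S i))) B"
      by (subst emeasure_density) (auto simp: indicator_inter_arith[symmetric])
    finally show "emeasure (?d i) B = emeasure (density lborel (indicator (p ` S i))) B" .
  qed simp
  have piece: "(\<integral>\<^sup>+t. g (p t) * (ennreal (D t) * indicator (S i) t) \<partial>lborel) = (\<integral>\<^sup>+\<eta>. g \<eta> * indicator (p ` S i) \<eta> \<partial>lborel)"
    if [measurable]: "g \<in> borel_measurable borel" for g :: "real^'n::_ \<Rightarrow> ennreal" and i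
  proof -
    have "(\<integral>\<^sup>+\<eta>. g \<eta> \<partial>?d i) =
       (\<integral>\<^sup>+t. (ennreal (D t) * indicator (S i) t) * g (p t) \<partial>lborel)"
      by (subst nn_integral_distr, simp_all, subst nn_integral_density) auto
    then show ?thesis
      unfolding distr by (subst (asm) nn_integral_density) (auto simp: mult.commute)
  qed
  \<comment> \<open>The pieces cover only \<Omega>, but nothing is lost: the Jacobian is 0
    elsewhere.\<close>
  have sumD: "(\<Sum>i. ennreal (D t) * indicator (S i) t) = ennreal (D t)" for t
  proof (cases "t \<in> \<Omega>")
    case True
    then obtain i where i: "t \<in> S i" using S_UN by auto
    have "(\<Sum>i. ennreal (D t) * indicator (S i) t) = ennreal (D t) * (\<Sum>i. indicator (S i) t)" by simp
    also have "(\<Sum>i. indicator (S i) t) = (indicator (\<Union>i. S i) t :: ennreal)"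
      by (rule suminf_indicator[OF S_disj])
    finally show ?thesis using True S_UN by simp
  next
    case False
    then show ?thesis by (simp add: \<Omega>_def D_def)
  qed
  \<comment> \<open>A Borel function that counts the pieces whose image contains \<eta>. Off the
    critical values it equals the number \<open>n \<eta>\<close> of preimages, as each piece
    contributes at most one.\<close>
  define m where "m \<eta> = (\<Sum>i. indicator (p ` S i) \<eta> :: ennreal)" for \<eta>
  have [measurable]: "m \<in> borel_measurable borel" unfolding m_def[abs_def] by measurable
  have total: "(\<integral>\<^sup>+t. g (p t) * ennreal (D t) \<partial>lborel) = (\<integral>\<^sup>+\<eta>. g \<eta> * m \<eta> \<partial>lborel)"
    if [measurable]: "g \<in> borel_measurable borel" for g :: "real^'n::_ \<Rightarrow> ennreal"
  proof -
    have "(\<integral>\<^sup>+t. g (p t) * ennreal (D t) \<partial>lborel) = (\<integral>\<^sup>+t. (\<Sum>i. g (p t) * (ennreal (D t) * indicator (S i) t)) \<partial>lborel)"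
      by (intro nn_integral_cong) (subst ennreal_suminf_cmult, subst sumD, rule refl)
    also have "\<dots> = (\<Sum>i. \<integral>\<^sup>+t. g (p t) * (ennreal (D t) * indicator (S i) t) \<partial>lborel)"
      by (rule nn_integral_suminf) measurable
    also have "\<dots> = (\<Sum>i. \<integral>\<^sup>+\<eta>. g \<eta> * indicator (p ` S i) \<eta> \<partial>lborel)"
      by (simp only: piece[OF that])
    also have "\<dots> = (\<integral>\<^sup>+\<eta>. g \<eta> * m \<eta> \<partial>lborel)"
      unfolding m_def by (subst nn_integral_suminf[symmetric]) auto
    finally show ?thesis .
  qed
  have "negligible (p ` (- \<Omega>))"
    by (rule baby_Sard) (auto intro: has_derivative_at_withinI[OF der] simp: \<Omega>_def det_eq_0_rank)
  then have "AE \<eta> in lebesgue. \<eta> \<notin> p ` (- \<Omega>)"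
    by (simp add: AE_not_in negligible_iff_null_sets)
  then have sard: "AE \<eta> in lborel. \<eta> \<notin> p ` (- \<Omega>)" by (simp add: AE_completion_iff)
  have nm: "n \<eta> = m \<eta>" if \<eta>: "\<eta> \<notin> p ` (- \<Omega>)" for \<eta>
  proof -
    have "{t. p t = \<eta>} = (\<Union>i. {t \<in> S i. p t = \<eta>})" using \<eta> S_UN by blast
    then have "n \<eta> = emeasure (count_space UNIV) (\<Union>i. {t \<in> S i. p t = \<eta>})" by (simp add: n_def)
    also have "\<dots> = (\<Sum>i. emeasure (count_space UNIV) {t \<in> S i. p t = \<eta>})"
      by (rule suminf_emeasure[symmetric]) (use S_disj in \<open>auto simp: disjoint_family_on_def\<close>)
    also have "\<dots> = m \<eta>"
      unfolding m_def
    proof (rule suminf_cong)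
      fix i
      show "emeasure (count_space UNIV) {t \<in> S i. p t = \<eta>} = indicator (p ` S i) \<eta>"
      proof (cases "\<eta> \<in> p ` S i")
        case True
        then obtain t where t: "t \<in> S i" "p t = \<eta>" by auto
        then have single: "{t \<in> S i. p t = \<eta>} = {t}" using inj[of i] by (auto dest: inj_onD)
        show ?thesis unfolding single using True by simp
      next
        case False
        then have empty: "{t \<in> S i. p t = \<eta>} = {}" by auto
        show ?thesis unfolding empty using False by simp
      qed
    qed
    finally show ?thesis .
  qed
  have ae: "AE \<eta> in lborel. n \<eta> = m \<eta> \<and> n \<eta> \<noteq> \<infinity> \<and> n \<eta> \<noteq> 0"
    using sard fin unfolding n_def[symmetric]
  proof eventually_elim
    case (elim \<eta>)
    then show ?case using nm[OF elim(1)] by blast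
  qed
  then obtain Z where Z: "\<And>\<eta>. \<eta> \<in> space lborel - Z \<Longrightarrow> n \<eta> = m \<eta> \<and> n \<eta> \<noteq> \<infinity> \<and> n \<eta> \<noteq> 0"
      "Z \<in> null_sets lborel"
    by (rule AE_E3) blast
  \<comment> \<open>The preimage of the null set \<open>Z\<close> of bad values need not be null,
    but \<open>total\<close>, applied to the indicator of \<open>Z\<close>, shows that the Jacobian
    vanishes almost everywhere on it.\<close>
  have Zb [measurable]: "Z \<in> sets borel" using Z(2) by auto
  have "(\<integral>\<^sup>+t. indicator Z (p t) * ennreal (D t) \<partial>lborel) = (\<integral>\<^sup>+\<eta>. indicator Z \<eta> * m \<eta> \<partial>lborel)"
    by (rule total) measurable
  also have "\<dots> = 0"
    using AE_not_in[OF Z(2)] by (subst nn_integral_0_iff_AE) (auto elim!: eventually_mono)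
  finally have aeZ: "AE t in lborel. indicator Z (p t) * ennreal (D t) = 0"
    by (subst (asm) nn_integral_0_iff_AE) auto
  \<comment> \<open>Where the Jacobian is 0, both sides are 0 whatever the multiplicity. Elsewhere
    \<open>p t\<close> avoids \<open>Z\<close>, so the multiplicity is a positive real number and
    can be divided by.\<close>
  have "AE t in lborel. ennreal (w t) = inverse (m (p t)) * ennreal (D t)"
    using w aeZ
  proof eventually_elim
    case (elim t)
    show ?case
    proof (cases "D t = 0")
      case True
      then show ?thesis using elim by (simp add: D_def)
    next
      case False
      then have "D t > 0" by (simp add: D_def)
      then have "p t \<notin> Z" using elim(2) by (auto simp: indicator_def split: if_splits)
      then have *: "n (p t) = m (p t)" "n (p t) \<noteq> \<infinity>" "n (p t) \<noteq> 0" using Z(1)[of "p t"] by auto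
      obtain r where r: "n (p t) = ennreal r" "0 < r"
        using *(2,3) by (rule ennreal_pos_finiteE)
      then show ?thesis
        using elim(1) \<open>D t > 0\<close> unfolding n_def[symmetric] D_def[symmetric] *(1)[symmetric]
        by (simp add: inverse_ennreal divide_inverse mult.commute flip: ennreal_mult)
    qed
  qed
  then have "(\<integral>\<^sup>+t. f (p t) * ennreal (w t) \<partial>lborel) = (\<integral>\<^sup>+t. (f (p t) * inverse (m (p t))) * ennreal (D t) \<partial>lborel)"
    by (intro nn_integral_cong_AE) (auto elim!: eventually_mono simp: mult.assoc)
  also have "\<dots> = (\<integral>\<^sup>+\<eta>. (f \<eta> * inverse (m \<eta>)) * m \<eta> \<partial>lborel)"
    by (rule total) measurable
  also have "\<dots> = (\<integral>\<^sup>+\<eta>. f \<eta> \<partial>lborel)"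
  proof (rule nn_integral_cong_AE)
    show "AE \<eta> in lborel. f \<eta> * inverse (m \<eta>) * m \<eta> = f \<eta>"
      using ae
    proof eventually_elim
      case (elim \<eta>)
      then have "m \<eta> \<noteq> \<infinity>" "m \<eta> \<noteq> 0" by auto
      then obtain r where r: "m \<eta> = ennreal r" "0 < r"
        by (rule ennreal_pos_finiteE)
      then have "inverse (m \<eta>) * m \<eta> = 1"
        by (simp add: inverse_ennreal flip: ennreal_mult)
      then show ?case by (simp add: mult.assoc)
    qed
  qed
  finally show ?thesis .
qed

subsection \<open>Index types without an order\<close>

text \<open>The change of variables theorems of the library are restricted to well-ordered index types.
  Any finite type has a copy with a well-order, and the formula is invariant under relabelling.\<close>

datatype 'a ordered_copy = Ordered_Copy (label: 'a)

lemma bij_label: "bij (label :: 'a ordered_copy \<Rightarrow> 'a)"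
  by (rule bijI') (auto intro: ordered_copy.expand exI[of _ "Ordered_Copy _"])

instance ordered_copy :: (finite) finite
proof
  have "(UNIV :: 'a ordered_copy set) = range Ordered_Copy"
    by (metis UNIV_eq_I ordered_copy.exhaust rangeI)
  then show "finite (UNIV :: 'a ordered_copy set)" by (metis finite finite_imageI)
qed

instantiation ordered_copy :: (finite) wellorder
begin

definition ordinal :: "'a ordered_copy \<Rightarrow> nat" where
  "ordinal = (SOME f. inj f)"

lemma inj_ordinal: "inj ordinal"
proof -
  have "\<exists>f :: 'a ordered_copy \<Rightarrow> nat. inj f"
    using finite_imp_inj_to_nat_seg[OF finite_class.finite_UNIV] by blast
  then show ?thesis unfolding ordinal_def by (rule someI_ex)
qed

definition less_eq_ordered_copy :: "'a ordered_copy \<Rightarrow> 'a ordered_copy \<Rightarrow> bool" where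
  "x \<le> y \<longleftrightarrow> ordinal x \<le> ordinal y"

definition less_ordered_copy :: "'a ordered_copy \<Rightarrow> 'a ordered_copy \<Rightarrow> bool" where
  "x < y \<longleftrightarrow> ordinal x < ordinal y"

instance
proof
  fix P :: "'a ordered_copy \<Rightarrow> bool" and a
  assume step: "\<And>x. (\<And>y. y < x \<Longrightarrow> P y) \<Longrightarrow> P x"
  show "P a"
  proof (induction a rule: measure_induct_rule[where f=ordinal])
    case (less x)
    show ?case by (rule step) (rule less, simp add: less_ordered_copy_def)
  qed
qed (auto simp: less_eq_ordered_copy_def less_ordered_copy_def dest: injD[OF inj_ordinal])

end

text \<open>Transporting permutations along \<open>f\<close> preserves signs and only reorders the
  factors of each Leibniz product, so the two Leibniz sums agree term by term.\<close>

lemma det_relabel: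
  fixes M :: "real^'n^'n" and f :: "'m::finite \<Rightarrow> 'n"
  assumes f: "bij f"
  shows "det (\<chi> i j. M $ f i $ f j) = det M"
proof -
  let ?g = "map_permutation UNIV f"
  have bij: "bij_betw ?g {q. q permutes UNIV} {q. q permutes UNIV}"
  proof (rule bij_betw_byWitness[where f'="map_permutation UNIV (inv f)"])
    show "\<forall>a\<in>{q. q permutes UNIV}. map_permutation UNIV (inv f) (?g a) = a"
      using map_permutation_compose_inv[of f UNIV UNIV] f by (auto simp: bij_is_inj)
    show "\<forall>a\<in>{q. q permutes UNIV}. ?g (map_permutation UNIV (inv f) a) = a"
      using map_permutation_compose_inv[of "inv f" UNIV UNIV] bij_imp_bij_inv[OF f] f
      by (auto simp: bij_is_surj surj_f_inv_f)
  qed (use map_permutation_permutes[of f UNIV UNIV] map_permutation_permutes[of "inv f" UNIV UNIV] f bij_imp_bij_inv[OF f] in auto)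
  have g_app: "?g q (f i) = f (q i)" for q :: "'m \<Rightarrow> 'm" and i
    using f by (simp add: map_permutation_def restrict_id_def bij_is_inj bij_is_surj)
  have "det M = (\<Sum>q | q permutes UNIV. of_int (sign (?g q)) * (\<Prod>i\<in>UNIV. M $ i $ ?g q i))"
    unfolding det_def by (rule sum.reindex_bij_betw[OF bij, symmetric])
  also have "\<dots> = (\<Sum>q | q permutes (UNIV :: 'm set). of_int (sign q) * (\<Prod>i\<in>UNIV. M $ f i $ f (q i)))"
  proof (rule sum.cong)
    fix q :: "'m \<Rightarrow> 'm" assume q: "q \<in> {q. q permutes UNIV}"
    have "sign (?g q) = sign q"
      unfolding sign_def using evenperm_map_permutation[of f UNIV q] f q by (simp add: bij_is_inj)
    moreover have "(\<Prod>i\<in>UNIV. M $ i $ ?g q i) = (\<Prod>i\<in>UNIV. M $ f i $ f (q i))"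
      using prod.reindex_bij_betw[OF f, of "\<lambda>i. M $ i $ ?g q i"] by (simp add: g_app)
    ultimately show "of_int (sign (?g q)) * (\<Prod>i\<in>UNIV. M $ i $ ?g q i) = of_int (sign q) * (\<Prod>i\<in>UNIV. M $ f i $ f (q i))"
      by simp
  qed simp
  finally show ?thesis by (simp add: det_def)
qed

definition relabel :: "('m::finite \<Rightarrow> 'n::finite) \<Rightarrow> real^'n \<Rightarrow> real^'m" where
  "relabel f x = (\<chi> i. x $ f i)"

lemma linear_relabel: "linear (relabel f)"
  by (rule linearI) (simp_all add: relabel_def vec_eq_iff)

lemma relabel_has_derivative: "(relabel f has_derivative relabel f) (at x)"
  using linear_relabel linear_conv_bounded_linear bounded_linear_imp_has_derivative by blast

lemma continuous_relabel: "continuous_on A (relabel f)"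
  unfolding relabel_def by (intro continuous_intros)

lemma relabel_measurable [measurable]: "relabel f \<in> borel_measurable borel"
  by (rule borel_measurable_continuous_onI[OF continuous_relabel])

lemma relabel_inverse: "bij f \<Longrightarrow> relabel (inv f) (relabel f x) = x" "bij f \<Longrightarrow> relabel f (relabel (inv f) y) = y"
  by (simp_all add: relabel_def vec_eq_iff bij_is_surj bij_is_inj surj_f_inv_f)

text \<open>Lebesgue measure is determined by the volumes of boxes, and relabelling coordinates
  merely permutes the side lengths.\<close>

lemma distr_relabel:
  fixes f :: "'m::finite \<Rightarrow> 'n::finite"
  assumes f: "bij f"
  shows "distr lborel borel (relabel f) = lborel"
proof (rule lborel_eqI[symmetric])
  fix l u :: "real^'m"
  assume lu: "\<And>b. b \<in> Basis \<Longrightarrow> l \<bullet> b \<le> u \<bullet> b"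
  then have le: "l $ i \<le> u $ i" for i
    using lu[of "axis i 1"] by (simp add: inner_axis axis_in_Basis_iff)
  have prodB: "(\<Prod>b\<in>Basis. (y - x) \<bullet> b) = (\<Prod>i\<in>UNIV. y $ i - x $ i)" for x y :: "real^'k::finite"
  proof -
    have B: "(Basis :: (real^'k) set) = range (\<lambda>i. axis i 1)" by (auto simp: Basis_vec_def)
    have "inj (\<lambda>i. axis i (1::real) :: real^'k)" by (auto simp: inj_def axis_eq_axis)
    then show ?thesis unfolding B by (subst prod.reindex) (auto simp: inner_axis)
  qed
  have "relabel f -` box l u = box (relabel (inv f) l) (relabel (inv f) u)"
  proof (intro set_eqI iffI)
    fix x assume "x \<in> relabel f -` box l u"
    then have "l $ i < x $ f i" "x $ f i < u $ i" for i by (auto simp: mem_box_cart relabel_def)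
    then have "l $ inv f j < x $ j" "x $ j < u $ inv f j" for j
      using f by (metis bij_inv_eq_iff)+
    then show "x \<in> box (relabel (inv f) l) (relabel (inv f) u)" by (auto simp: mem_box_cart relabel_def)
  next
    fix x assume "x \<in> box (relabel (inv f) l) (relabel (inv f) u)"
    then have "l $ inv f j < x $ j" "x $ j < u $ inv f j" for j by (auto simp: mem_box_cart relabel_def)
    then have "l $ i < x $ f i" "x $ f i < u $ i" for i
      using f by (metis bij_inv_eq_iff)+
    then show "x \<in> relabel f -` box l u" by (auto simp: mem_box_cart relabel_def)
  qed
  then have "emeasure (distr lborel borel (relabel f)) (box l u) = emeasure lborel (box (relabel (inv f) l) (relabel (inv f) u))"
    by (subst emeasure_distr) auto
  also have "\<dots> = ennreal (\<Prod>b\<in>Basis. (relabel (inv f) u - relabel (inv f) l) \<bullet> b)"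
    using le by (intro emeasure_lborel_box) (auto simp: Basis_vec_def inner_axis relabel_def)
  also have "(\<Prod>b\<in>Basis. (relabel (inv f) u - relabel (inv f) l) \<bullet> b) = (\<Prod>j\<in>UNIV. u $ inv f j - l $ inv f j)"
    by (simp only: prodB) (simp add: relabel_def)
  also have "\<dots> = (\<Prod>i\<in>UNIV. u $ i - l $ i)"
    by (rule prod.reindex_bij_betw[OF bij_imp_bij_inv[OF f]])
  also have "\<dots> = (\<Prod>b\<in>Basis. (u - l) \<bullet> b)" by (simp only: prodB)
  finally show "emeasure (distr lborel borel (relabel f)) (box l u) = ennreal (\<Prod>b\<in>Basis. (u - l) \<bullet> b)" .
qed simp

lemma nn_integral_relabel:
  assumes "bij f" and "g \<in> borel_measurable borel"
  shows "(\<integral>\<^sup>+y. g (relabel f y) \<partial>lborel) = (\<integral>\<^sup>+x. g x \<partial>lborel)"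
  using nn_integral_distr[of "relabel f" lborel borel g] assms by (simp add: distr_relabel)

lemma AE_relabel:
  assumes "bij f" and "AE x in lborel. P x"
  shows "AE y in lborel. P (relabel f y)"
proof -
  obtain N where N: "\<And>x. x \<in> space lborel - N \<Longrightarrow> P x" "N \<in> null_sets lborel"
    using assms(2) by (rule AE_E3) blast
  have "AE x in distr lborel borel (relabel f). x \<notin> N"
    unfolding distr_relabel[OF assms(1)] using N(2) by (rule AE_not_in)
  then have "AE y in lborel. relabel f y \<notin> N"
    using N(2) by (subst (asm) AE_distr_iff) auto
  then show ?thesis by (rule eventually_mono) (use N(1) in auto)
qed

text \<open>Conjugating \<open>p\<close> with the relabelling leaves multiplicities, Jacobian
  determinants and Lebesgue measure unchanged. Measurability of \<open>w\<close> serves to relabel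
  the integral on the left.\<close>

theorem area_formula:
  fixes p :: "real^'n \<Rightarrow> real^'n" and f :: "real^'n \<Rightarrow> ennreal"
  assumes der: "\<And>x. (p has_derivative p' x) (at x)"
    and cont: "\<And>v. continuous_on UNIV (\<lambda>x. p' x v)"
    and fin: "AE \<eta> in lborel. emeasure (count_space UNIV) {t. p t = \<eta>} \<noteq> \<infinity> \<and> emeasure (count_space UNIV) {t. p t = \<eta>} \<noteq> 0"
    and w: "AE t in lborel. w t = \<bar>det (matrix (p' t))\<bar> / enn2real (emeasure (count_space UNIV) {s. p s = p t})"
    and wm: "w \<in> borel_measurable borel"
    and [measurable]: "f \<in> borel_measurable borel"
  shows "(\<integral>\<^sup>+t. f (p t) * ennreal (w t) \<partial>lborel) = (\<integral>\<^sup>+\<eta>. f \<eta> \<partial>lborel)"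
proof -
  let ?R = "relabel (label :: 'n ordered_copy \<Rightarrow> 'n)"
  let ?R' = "relabel (inv (label :: 'n ordered_copy \<Rightarrow> 'n))"
  note bij = bij_label[where 'a='n]
  note bij' = bij_imp_bij_inv[OF bij]
  note RR = relabel_inverse[OF bij]
  define q where "q = ?R \<circ> p \<circ> ?R'"
  define q' where "q' y = ?R \<circ> p' (?R' y) \<circ> ?R'" for y
  have pm [measurable]: "p \<in> borel_measurable borel"
    by (rule borel_measurable_continuous_onI)
       (meson der has_derivative_continuous continuous_at_imp_continuous_on)
  have nq: "emeasure (count_space UNIV) {t. q t = \<eta>} = emeasure (count_space UNIV) {t. p t = ?R' \<eta>}" for \<eta>
  proof -
    have "bij_betw ?R {t. p t = ?R' \<eta>} {t. q t = \<eta>}"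
      by (rule bij_betw_byWitness[where f'="?R'"]) (auto simp: RR q_def)
    then show ?thesis
      using bij_betw_finite bij_betw_same_card by (fastforce simp: emeasure_count_space)
  qed
  have det: "det (matrix (q' y)) = det (matrix (p' (?R' y)))" for y
  proof -
    have ax: "?R' (axis j 1) = axis (label j) 1" for j :: "'n ordered_copy"
    proof -
      have "inv label i = j \<longleftrightarrow> i = label j" for i
        using bij_inv_eq_iff[OF bij, of j i] by auto
      then show ?thesis by (simp add: relabel_def vec_eq_iff axis_def)
    qed
    have "matrix (q' y) = (\<chi> i j. matrix (p' (?R' y)) $ label i $ label j)"
      by (simp add: matrix_def q'_def vec_eq_iff ax) (simp add: relabel_def)
    then show ?thesis using det_relabel[OF bij] by simp
  qed
  have "(\<integral>\<^sup>+s. f (?R' (q s)) * ennreal (w (?R' s)) \<partial>lborel) = (\<integral>\<^sup>+\<eta>. f (?R' \<eta>) \<partial>lborel)"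
  proof (rule area_formula_wellorder[where p'=q'])
    show "(q has_derivative q' y) (at y)" for y
      unfolding q_def q'_def by (intro diff_chain_at der relabel_has_derivative)
    show "continuous_on UNIV (\<lambda>y. q' y v)" for v
      unfolding q'_def o_def
      by (intro continuous_on_compose2[OF continuous_relabel] continuous_on_compose2[OF cont] continuous_relabel) auto
    show "AE \<eta> in lborel. emeasure (count_space UNIV) {t. q t = \<eta>} \<noteq> \<infinity> \<and> emeasure (count_space UNIV) {t. q t = \<eta>} \<noteq> 0"
      unfolding nq by (rule AE_relabel[OF bij' fin])
    have "emeasure (count_space UNIV) {s. q s = q y} = emeasure (count_space UNIV) {s. p s = p (?R' y)}" for y
      unfolding nq by (simp add: q_def RR)
    then show "AE y in lborel. w (?R' y) = \<bar>det (matrix (q' y))\<bar> / enn2real (emeasure (count_space UNIV) {s. q s = q y})"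
      unfolding det by (simp only:) (rule AE_relabel[OF bij' w])
  qed measurable
  moreover have "(\<integral>\<^sup>+s. f (?R' (q s)) * ennreal (w (?R' s)) \<partial>lborel) = (\<integral>\<^sup>+t. f (p t) * ennreal (w t) \<partial>lborel)"
    using wm nn_integral_relabel[OF bij', of "\<lambda>t. f (p t) * ennreal (w t)"] by (simp add: q_def RR)
  moreover have "(\<integral>\<^sup>+\<eta>. f (?R' \<eta>) \<partial>lborel) = (\<integral>\<^sup>+\<eta>. f \<eta> \<partial>lborel)"
    by (rule nn_integral_relabel[OF bij']) simp
  ultimately show ?thesis by simp
qed

section \<open>The Crofton function as a Jacobian factor\<close>

text \<open>Induction over polynomials produces a derivative together with its continuity in the
  base point, the form in which \<open>area_formula\<close> takes its input.\<close>

lemma real_polynomial_function_C1: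
  fixes f :: "'a::euclidean_space \<Rightarrow> real"
  assumes "real_polynomial_function f"
  shows "\<exists>f'. (\<forall>x. (f has_derivative f' x) (at x)) \<and> (\<forall>v. continuous_on UNIV (\<lambda>x. f' x v))"
  using assms
proof induction
  case (linear f)
  then show ?case by (intro exI[of _ "\<lambda>_. f"]) (simp add: bounded_linear_imp_has_derivative)
next
  case (const c)
  then show ?case by (intro exI[of _ "\<lambda>_ _. 0"]) simp
next
  case (add f g)
  then obtain f' g' where "\<forall>x. (f has_derivative f' x) (at x)" "\<forall>v. continuous_on UNIV (\<lambda>x. f' x v)"
    "\<forall>x. (g has_derivative g' x) (at x)" "\<forall>v. continuous_on UNIV (\<lambda>x. g' x v)" by blast
  then show ?case
    by (intro exI[of _ "\<lambda>x v. f' x v + g' x v"]) (auto intro!: has_derivative_add continuous_on_add)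
next
  case (mult f g)
  then obtain f' g' where fg: "\<forall>x. (f has_derivative f' x) (at x)" "\<forall>v. continuous_on UNIV (\<lambda>x. f' x v)"
    "\<forall>x. (g has_derivative g' x) (at x)" "\<forall>v. continuous_on UNIV (\<lambda>x. g' x v)" by blast
  then have "continuous_on UNIV f" "continuous_on UNIV g"
    by (meson has_derivative_continuous continuous_at_imp_continuous_on)+
  then show ?case using fg
    by (intro exI[of _ "\<lambda>x v. f x * g' x v + f' x v * g x"]) (auto intro!: has_derivative_mult continuous_on_add continuous_on_mult)
qed

lemma real_polynomial_function_vmult:
  "polynomial_matrix u \<Longrightarrow> real_polynomial_function (\<lambda>t. (\<xi> v* u t) $ j)"
  unfolding vector_matrix_mult_def polynomial_matrix_def
  by (auto intro!: real_polynomial_function_sum real_polynomial_function.intros(2,4))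

lemma polynomial_matrix_continuous: "polynomial_matrix u \<Longrightarrow> continuous_on A (\<lambda>t. u t $ i $ j)"
  unfolding polynomial_matrix_def
  by (meson continuous_at_imp_continuous_on differentiable_imp_continuous_within differentiable_at_real_polynomial_function)

lemma vmult_C1:
  fixes u :: "real^'k \<Rightarrow> real^'k^'l"
  assumes "polynomial_matrix u"
  obtains p' where "\<And>t. ((\<lambda>t. \<xi> v* u t) has_derivative p' t) (at t)" "\<And>v. continuous_on UNIV (\<lambda>t. p' t v)"
proof -
  have "\<forall>j. \<exists>f'. (\<forall>x. ((\<lambda>t. (\<xi> v* u t) $ j) has_derivative f' x) (at x)) \<and> (\<forall>v. continuous_on UNIV (\<lambda>x. f' x v))"
    using real_polynomial_function_C1[OF real_polynomial_function_vmult[OF assms]] by blast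
  then obtain f' where f': "\<And>j x. ((\<lambda>t. (\<xi> v* u t) $ j) has_derivative f' j x) (at x)"
    "\<And>j v. continuous_on UNIV (\<lambda>x. f' j x v)" by metis
  have "((\<lambda>t. \<xi> v* u t) has_derivative (\<lambda>v. \<chi> j. f' j t v)) (at t)" for t
    using f'(1) by (subst has_derivative_componentwise_within) (auto simp: Basis_vec_def inner_axis)
  then show thesis
    using f'(2) by (intro that[of "\<lambda>t v. \<chi> j. f' j t v"]) (auto intro: continuous_on_vec_lambda)
qed

lemma det_uminus: "det (- A) = (-1) ^ CARD('n) * det (A :: real^'n^'n)"
  unfolding det_def sum_distrib_left
  by (rule sum.cong) (simp_all add: prod_uminus mult_ac)

text \<open>For \<open>c = 0\<close> both sides are 0, by the default values of \<open>powr\<close>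
  at base 0 and of division by 0. This matters because \<open>enn2real\<close> sends an infinite
  Crofton number to 0.\<close>

lemma square_powr_half: "(c powr (- 1 / 2) * \<bar>w\<bar> powr (1 / 2))\<^sup>2 = \<bar>w\<bar> / c" if "0 \<le> c" for c w :: real
proof (cases "c = 0")
  case False
  with that have "c > 0" by simp
  have "(c powr (- 1 / 2))\<^sup>2 = inverse c"
    using \<open>c > 0\<close> unfolding power2_eq_square powr_add[symmetric] by (simp add: powr_minus)
  moreover have "(\<bar>w\<bar> powr (1 / 2))\<^sup>2 = \<bar>w\<bar>"
    unfolding power2_eq_square powr_add[symmetric] by simp
  ultimately have "(c powr (- 1 / 2) * \<bar>w\<bar> powr (1 / 2))\<^sup>2 = inverse c * \<bar>w\<bar>"
    by (simp only: power_mult_distrib)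
  then show ?thesis by (simp only: divide_inverse mult.commute)
qed simp

text \<open>For fixed \<xi> this is the area formula for t \<mapsto> -\<xi>u(t), whose multiplicity
  is the Crofton function. The minus sign changes the Jacobian determinant by a power of -1, which
  its modulus does not see.\<close>

lemma nn_integral_crofton:
  fixes u :: "real^'k \<Rightarrow> real^'k^'l"
  assumes u: "polynomial_matrix u"
    and fin: "AE \<eta> in lborel. crofton u \<eta> \<xi> \<noteq> \<infinity> \<and> crofton u \<eta> \<xi> \<noteq> 0"
    and w: "AE t in lborel. w t = \<bar>omega u \<xi> t\<bar> / enn2real (crofton u (- (\<xi> v* u t)) \<xi>)"
    and wm: "w \<in> borel_measurable borel" and h: "h \<in> borel_measurable borel"
  shows "(\<integral>\<^sup>+t. h (- (\<xi> v* u t)) * ennreal (w t) \<partial>lborel) = (\<integral>\<^sup>+\<eta>. h \<eta> \<partial>lborel)"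
proof -
  obtain p' where p': "\<And>t. ((\<lambda>t. \<xi> v* u t) has_derivative p' t) (at t)" "\<And>v. continuous_on UNIV (\<lambda>t. p' t v)"
    using vmult_C1[OF u, where \<xi>=\<xi>] by metis
  have cr: "crofton u \<eta> \<xi> = emeasure (count_space UNIV) {t. - (\<xi> v* u t) = \<eta>}" for \<eta>
    by (simp add: crofton_def eq_commute)
  have "matrix (\<lambda>v. - p' t v) = - matrix (p' t)" for t
    by (simp add: matrix_def vec_eq_iff)
  then have det: "\<bar>det (matrix (\<lambda>v. - p' t v))\<bar> = \<bar>omega u \<xi> t\<bar>" for t
    by (simp add: omega_def frechet_derivative_at[OF p'(1), symmetric] det_uminus abs_mult power_abs)
  show ?thesis
  proof (rule area_formula[where p'="\<lambda>t v. - p' t v"])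
    show "((\<lambda>t. - (\<xi> v* u t)) has_derivative (\<lambda>v. - p' t v)) (at t)" for t
      by (intro has_derivative_minus p')
    show "continuous_on UNIV (\<lambda>t. - p' t v)" for v
      by (intro continuous_on_minus p')
    show "AE \<eta> in lborel. emeasure (count_space UNIV) {t. - (\<xi> v* u t) = \<eta>} \<noteq> \<infinity> \<and>
        emeasure (count_space UNIV) {t. - (\<xi> v* u t) = \<eta>} \<noteq> 0"
      using fin unfolding cr .
    show "AE t in lborel. w t = \<bar>det (matrix (\<lambda>v. - p' t v))\<bar> /
        enn2real (emeasure (count_space UNIV) {s. - (\<xi> v* u s) = - (\<xi> v* u t)})"
      using w unfolding det cr .
  qed (use wm h in auto)
qed

section \<open>Almost everywhere statements on products\<close>

lemma AE_lborel_prod_swap: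
  assumes "AE z in (lborel :: ('a::euclidean_space \<times> 'b::euclidean_space) measure). P z"
  shows "AE y in lborel. AE x in lborel. P (x, y)"
proof -
  \<comment> \<open>\<open>P\<close> need not be measurable; replacing its exceptional set by a
    Borel null set makes the two quantifiers exchangeable.\<close>
  obtain N where N: "\<And>z. z \<in> space lborel - N \<Longrightarrow> P z" "N \<in> null_sets (lborel :: ('a \<times> 'b) measure)"
    using assms by (rule AE_E3) blast
  have Nm: "N \<in> sets (lborel \<Otimes>\<^sub>M lborel)" using N(2) unfolding lborel_prod by (rule null_setsD2)
  have "AE z in (lborel \<Otimes>\<^sub>M lborel). z \<notin> N" unfolding lborel_prod by (rule AE_not_in[OF N(2)])
  then have "AE x in lborel. AE y in lborel. (x, y) \<notin> N" by (rule lborel_pair.AE_pair)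
  then have "AE y in lborel. AE x in lborel. (x, y) \<notin> N"
  proof (subst (asm) lborel_pair.AE_commute)
    show "{x \<in> space (lborel \<Otimes>\<^sub>M lborel). (fst x, snd x) \<notin> N} \<in> sets (lborel \<Otimes>\<^sub>M lborel)"
      using sets.Diff[OF sets.top Nm] by (simp only: set_diff_eq prod.collapse)
  qed
  then show ?thesis
  proof eventually_elim
    case (elim y)
    then show ?case by eventually_elim (use N(1) in auto)
  qed
qed

lemma AE_lborel_prod:
  assumes "AE z in (lborel :: ('a::euclidean_space \<times> 'b::euclidean_space) measure). P z"
  shows "AE x in lborel. AE y in lborel. P (x, y)"
  using assms unfolding lborel_prod[symmetric] by (rule lborel_pair.AE_pair)

lemma AE_lborel_snd:
  assumes "AE y in (lborel :: 'b::euclidean_space measure). P y"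
  shows "AE z in (lborel :: ('a::euclidean_space \<times> 'b) measure). P (snd z)"
proof -
  obtain N where N: "\<And>z. z \<in> space lborel - N \<Longrightarrow> P z" "N \<in> null_sets (lborel :: 'b measure)"
    using assms by (rule AE_E3) blast
  have [measurable]: "N \<in> sets lborel" using N(2) by (rule null_setsD2)
  have "AE z in (lborel \<Otimes>\<^sub>M lborel :: ('a \<times> 'b) measure). snd z \<notin> N"
  proof (rule lborel_pair.AE_pair_measure)
    show "{z \<in> space (lborel \<Otimes>\<^sub>M lborel :: ('a \<times> 'b) measure). snd z \<notin> N} \<in> sets (lborel \<Otimes>\<^sub>M lborel)"
      by measurable
    show "AE x in lborel. AE y in lborel. snd (x, y) \<notin> N" using AE_not_in[OF N(2)] by simp
  qed
  then show ?thesis unfolding lborel_prod by (rule eventually_mono) (use N(1) in auto)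
qed

lemma continuous_vmult_pair:
  assumes "polynomial_matrix (u :: real^'k \<Rightarrow> real^'k^'l)"
  shows "continuous_on UNIV (\<lambda>z. fst z v* u (snd z))"
proof -
  have c: "continuous_on UNIV (\<lambda>z::(real^'l) \<times> (real^'k). u (snd z) $ i $ j)" for i j
    by (rule continuous_on_compose2[OF polynomial_matrix_continuous[OF assms, of UNIV i j] continuous_on_snd[OF continuous_on_id]]) simp
  show ?thesis
    unfolding vector_matrix_mult_def
    by (rule continuous_on_vec_lambda, rule continuous_on_sum, rule continuous_on_mult,
        rule continuous_on_component, rule continuous_on_fst, rule continuous_on_id, rule c)
qed

text \<open>The kernel is absent: the transport of measures depends on the modulus of its spectrum
  alone. \<open>A\<close> is Borel so that this squared modulus can serve as a density.\<close>

locale crofton_density =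
  fixes u :: "real^'k \<Rightarrow> real^'k^'l" and A :: "(real^'l) \<times> (real^'k) \<Rightarrow> complex"
  assumes poly: "polynomial_matrix u"
    and crofton_ae: "AE (\<eta>, \<xi>) in lborel. crofton u \<eta> \<xi> \<noteq> \<infinity> \<and> crofton u \<eta> \<xi> \<noteq> 0"
    and A_measurable [measurable]: "A \<in> borel_measurable borel"
    and norm_A: "AE (\<xi>, t) in lborel. norm (A (\<xi>, t)) =
      enn2real (crofton u (- (\<xi> v* u t)) \<xi>) powr (- 1 / 2) * \<bar>omega u \<xi> t\<bar> powr (1 / 2)"
begin

text \<open>The conormal covector of the planes y = u(t)x + \<alpha>: it vanishes on their
  directions.\<close>

definition frequency :: "(real^'l) \<times> (real^'k) \<Rightarrow> (real^'k) \<times> (real^'l)" where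
  "frequency z = (- (fst z v* u (snd z)), fst z)"

lemma continuous_frequency: "continuous_on UNIV frequency"
  unfolding frequency_def[abs_def] by (intro continuous_intros continuous_vmult_pair poly)

lemma frequency_measurable [measurable]: "frequency \<in> borel_measurable borel"
  by (rule borel_measurable_continuous_onI[OF continuous_frequency])

text \<open>The map \<open>frequency\<close> keeps \<xi> as a coordinate, so Tonelli reduces the
  claim to the area formula in t, for almost every fixed \<xi>. The squared modulus of
  \<open>A\<close> is precisely Jacobian over multiplicity.\<close>

theorem nn_integral_frequency:
  assumes h: "h \<in> borel_measurable borel"
  shows "(\<integral>\<^sup>+z. h (frequency z) * ennreal ((norm (A z))\<^sup>2) \<partial>lborel) = (\<integral>\<^sup>+z. h z \<partial>lborel)"
proof -
  have [measurable]: "h \<in> borel_measurable (borel \<Otimes>\<^sub>M borel)" using h by (simp add: borel_prod)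
  have [measurable]: "frequency \<in> borel_measurable (borel \<Otimes>\<^sub>M borel)" "A \<in> borel_measurable (borel \<Otimes>\<^sub>M borel)"
    unfolding borel_prod by measurable
  have hm: "h \<in> borel_measurable (lborel \<Otimes>\<^sub>M lborel)" by (simp add: borel_prod h lborel_prod)
  have "(\<lambda>z. h (frequency z) * ennreal ((norm (A z))\<^sup>2)) \<in> borel_measurable borel"
    using h by measurable
  then have gm: "(\<lambda>z. h (frequency z) * ennreal ((norm (A z))\<^sup>2)) \<in> borel_measurable (lborel \<Otimes>\<^sub>M lborel)"
    by (simp add: lborel_prod)
  have "(\<integral>\<^sup>+z. h (frequency z) * ennreal ((norm (A z))\<^sup>2) \<partial>lborel) =
     (\<integral>\<^sup>+\<xi>. (\<integral>\<^sup>+t. h (frequency (\<xi>, t)) * ennreal ((norm (A (\<xi>, t)))\<^sup>2) \<partial>lborel) \<partial>lborel)"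
    unfolding lborel_prod[symmetric] by (rule lborel.nn_integral_fst[OF gm, symmetric])
  also have "\<dots> = (\<integral>\<^sup>+\<xi>. (\<integral>\<^sup>+\<eta>. h (\<eta>, \<xi>) \<partial>lborel) \<partial>lborel)"
  proof (rule nn_integral_cong_AE)
    show "AE \<xi> in lborel. (\<integral>\<^sup>+t. h (frequency (\<xi>, t)) * ennreal ((norm (A (\<xi>, t)))\<^sup>2) \<partial>lborel) = (\<integral>\<^sup>+\<eta>. h (\<eta>, \<xi>) \<partial>lborel)"
      using AE_lborel_prod_swap[OF crofton_ae] AE_lborel_prod[OF norm_A]
    proof eventually_elim
      case (elim \<xi>)
      have "(\<integral>\<^sup>+t. h (- (\<xi> v* u t), \<xi>) * ennreal ((norm (A (\<xi>, t)))\<^sup>2) \<partial>lborel) = (\<integral>\<^sup>+\<eta>. h (\<eta>, \<xi>) \<partial>lborel)"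
      proof (rule nn_integral_crofton[OF poly])
        show "AE \<eta> in lborel. crofton u \<eta> \<xi> \<noteq> \<infinity> \<and> crofton u \<eta> \<xi> \<noteq> 0" using elim(1) by simp
        show "AE t in lborel. (norm (A (\<xi>, t)))\<^sup>2 = \<bar>omega u \<xi> t\<bar> / enn2real (crofton u (- (\<xi> v* u t)) \<xi>)"
          using elim(2) by eventually_elim (simp only: prod.case square_powr_half enn2real_nonneg)
      qed measurable
      then show ?case by (simp add: frequency_def)
    qed
  qed
  also have "\<dots> = (\<integral>\<^sup>+z. h z \<partial>lborel)"
    unfolding lborel_prod[symmetric] by (rule lborel_pair.nn_integral_snd[OF hm])
  finally show ?thesis .
qed

lemma distr_frequency:
  "distr (density bmu (\<lambda>z. ennreal ((norm (A z))\<^sup>2))) borel frequency = bmu"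
proof (rule measure_eqI)
  let ?D = "distr (density bmu (\<lambda>z. ennreal ((norm (A z))\<^sup>2))) borel frequency"
  fix B assume "B \<in> sets (?D)"
  then have [measurable]: "B \<in> sets borel" by simp
  \<comment> \<open>Domain and target have dimensions l+k and k+l, hence the same normalizing
    constant, and the identity for \<open>lborel\<close> carries over to \<open>bmu\<close>.\<close>
  define c where "c = ennreal ((2 * pi) powr (- (real (CARD('k) + CARD('l))) / 2))"
  have nn: "(\<integral>\<^sup>+z. g z \<partial>bmu) = c * (\<integral>\<^sup>+z. g z \<partial>lborel)" if "g \<in> borel_measurable borel"
    for g :: "(real^'l) \<times> (real^'k) \<Rightarrow> ennreal"
    using that unfolding bmu_def c_def by (subst nn_integral_density) (auto simp: nn_integral_cmult add.commute)
  have nn': "(\<integral>\<^sup>+z. g z \<partial>bmu) = c * (\<integral>\<^sup>+z. g z \<partial>lborel)" if "g \<in> borel_measurable borel"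
    for g :: "(real^'k) \<times> (real^'l) \<Rightarrow> ennreal"
    using that unfolding bmu_def c_def by (subst nn_integral_density) (auto simp: nn_integral_cmult)
  have pre: "frequency -` B \<in> sets borel" using measurable_sets[OF frequency_measurable, of B] by simp
  have "emeasure (?D) B =
     (\<integral>\<^sup>+z. indicator B (frequency z) * ennreal ((norm (A z))\<^sup>2) \<partial>bmu)"
    using pre by (subst emeasure_distr, simp_all, subst emeasure_density)
      (auto intro!: nn_integral_cong simp: indicator_def)
  also have "\<dots> = c * (\<integral>\<^sup>+z. indicator B (frequency z) * ennreal ((norm (A z))\<^sup>2) \<partial>lborel)"
    by (rule nn) measurable
  also have "\<dots> = c * (\<integral>\<^sup>+z. indicator B z \<partial>lborel)" by (subst nn_integral_frequency) auto
  also have "\<dots> = (\<integral>\<^sup>+z. indicator B z \<partial>bmu)" by (rule nn'[symmetric]) simp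
  also have "\<dots> = emeasure bmu B" by simp
  finally show "emeasure (?D) B = emeasure bmu B" .
qed simp

lemma has_bochner_integral_frequency:
  fixes h :: "(real^'k) \<times> (real^'l) \<Rightarrow> complex"
  assumes h: "has_bochner_integral bmu h c"
  shows "has_bochner_integral bmu (\<lambda>z. (norm (A z))\<^sup>2 *\<^sub>R h (frequency z)) c"
proof -
  let ?D = "density bmu (\<lambda>z. ennreal ((norm (A z))\<^sup>2))"
  have "h \<in> borel_measurable bmu" using h by (rule borel_measurable_has_bochner_integral)
  then have hm: "h \<in> borel_measurable borel" by (simp only: measurable_bmu)
  have gm: "(\<lambda>z. h (frequency z)) \<in> borel_measurable bmu"
    unfolding measurable_bmu by (rule measurable_compose[OF frequency_measurable hm])
  have Am: "(\<lambda>z. (norm (A z))\<^sup>2) \<in> borel_measurable bmu" by measurable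
  have fm: "frequency \<in> measurable ?D borel" by (simp add: frequency_measurable)
  have "integrable (distr ?D borel frequency) h" "integral\<^sup>L (distr ?D borel frequency) h = c"
    using h unfolding distr_frequency has_bochner_integral_iff by blast+
  then have "integrable ?D (\<lambda>z. h (frequency z))" "integral\<^sup>L ?D (\<lambda>z. h (frequency z)) = c"
    unfolding integrable_distr_eq[OF fm hm] integral_distr[OF fm hm] by blast+
  then show ?thesis
    unfolding has_bochner_integral_iff
    by (subst (asm) integrable_density[OF gm Am], simp, subst (asm) integral_density[OF gm Am], simp, blast)
qed

end

section \<open>The Fourier transform of the integrals over parallel planes\<close>

lemma ift_eq: "ift f \<xi> = (\<integral>s. f s * ker s (- \<xi>) \<partial>bmu)"
  by (simp add: ift_def ft_def)

lemma borel_measurable_Pair_fst: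
  fixes f :: "'a::euclidean_space \<times> 'b::euclidean_space \<Rightarrow> 'c::topological_space"
  assumes "f \<in> borel_measurable borel" shows "(\<lambda>x. f (x, c)) \<in> borel_measurable borel"
  by (rule measurable_compose[OF _ assms])
     (intro borel_measurable_continuous_onI continuous_on_Pair continuous_on_id continuous_on_const)

lemma borel_measurable_Pair_snd:
  fixes f :: "'a::euclidean_space \<times> 'b::euclidean_space \<Rightarrow> 'c::topological_space"
  assumes "f \<in> borel_measurable borel" shows "(\<lambda>y. f (c, y)) \<in> borel_measurable borel"
  by (rule measurable_compose[OF _ assms])
     (intro borel_measurable_continuous_onI continuous_on_Pair continuous_on_id continuous_on_const)

lemma integral_ft_mult:
  assumes F: "integrable bmu F" and H: "integrable bmu H"
  shows "(\<integral>\<alpha>. ft F \<alpha> * H \<alpha> \<partial>bmu) = (\<integral>\<xi>. F \<xi> * ft H \<xi> \<partial>bmu)"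
proof -
  have [measurable]: "F \<in> borel_measurable borel" "H \<in> borel_measurable borel" using F H by auto
  define K where "K = (\<lambda>\<xi> \<alpha>. F \<xi> * H \<alpha> * ker \<xi> \<alpha>)"
  have "integrable (bmu \<Otimes>\<^sub>M bmu) (\<lambda>(\<xi>, \<alpha>). K \<xi> \<alpha>)"
  proof (rule integrable_bmu_pair_bound)
    show "integrable bmu (\<lambda>\<xi>. norm (F \<xi>))" "integrable bmu (\<lambda>\<alpha>. norm (H \<alpha>))" using F H by simp_all
    show "(\<lambda>(\<xi>, \<alpha>). K \<xi> \<alpha>) \<in> borel_measurable borel"
      unfolding K_def borel_prod[symmetric] by measurable
  qed (simp add: K_def norm_mult)
  then have "(\<integral>\<alpha>. (\<integral>\<xi>. K \<xi> \<alpha> \<partial>bmu) \<partial>bmu) = (\<integral>\<xi>. (\<integral>\<alpha>. K \<xi> \<alpha> \<partial>bmu) \<partial>bmu)"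
    by (rule bmu_pair.Fubini_integral)
  moreover have "(\<integral>\<xi>. K \<xi> \<alpha> \<partial>bmu) = ft F \<alpha> * H \<alpha>" for \<alpha>
  proof -
    have "K \<xi> \<alpha> = (F \<xi> * ker \<xi> \<alpha>) * H \<alpha>" for \<xi> by (simp add: K_def)
    then show ?thesis by (simp add: ft_def)
  qed
  moreover have "(\<integral>\<alpha>. K \<xi> \<alpha> \<partial>bmu) = F \<xi> * ft H \<xi>" for \<xi>
  proof -
    have "K \<xi> \<alpha> = F \<xi> * (H \<alpha> * ker \<alpha> \<xi>)" for \<alpha> by (simp add: K_def ker_commute[of \<xi>])
    then show ?thesis by (simp add: ft_def)
  qed
  ultimately show ?thesis by simp
qed

text \<open>Decay in \<open>x\<close> that is uniform in \<open>p\<close> gives a single integrable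
  majorant for all fibres. Continuity, boundedness and integrability are what Fourier inversion asks
  for, so the marginal need not be shown to be a Schwartz function.\<close>

lemma
  fixes h :: "'a::euclidean_space \<times> 'b::euclidean_space \<Rightarrow> complex"
  assumes h: "h \<in> schwartz"
  shows continuous_marginal: "continuous_on UNIV (\<lambda>p. \<integral>x. h (x, p) \<partial>bmu)"
    and bounded_marginal: "\<exists>B. \<forall>p. norm (\<integral>x. h (x, p) \<partial>bmu) \<le> B"
    and integrable_marginal: "integrable bmu (\<lambda>p. \<integral>x. h (x, p) \<partial>bmu)"
proof -
  let ?N = "2 * DIM('a)"
  obtain C where C: "\<And>z. (1 + norm z) ^ ?N * norm (h z) \<le> C"
    using schwartz_decay[OF h] by blast
  have hc: "continuous_on UNIV h" by (rule schwartz_continuous[OF h])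
  have bound: "norm (h (x, p)) \<le> C * weight x" for x p
  proof -
    have "norm x \<le> norm (x, p)" by (rule norm_fst_le)
    then have "(1 + norm x) ^ ?N * norm (h (x, p)) \<le> (1 + norm (x, p)) ^ ?N * norm (h (x, p))"
      by (intro mult_right_mono power_mono) auto
    also have "\<dots> \<le> C" by (rule C)
    finally have "(1 + norm x) ^ ?N * norm (h (x, p)) \<le> C" .
    then show ?thesis by (rule le_weightI) simp
  qed
  have int_w: "integrable bmu (\<lambda>x::'a. C * weight x)"
    by (intro integrable_mult_right integrable_weight)
  have hm: "(\<lambda>x. h (x, p)) \<in> borel_measurable bmu" for p
    unfolding measurable_bmu
    by (rule borel_measurable_Pair_fst[OF schwartz_measurable[OF h]])
  show "continuous_on UNIV (\<lambda>p. \<integral>x. h (x, p) \<partial>bmu)"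
    unfolding continuous_on_sequentially comp_def
  proof (intro allI ballI impI)
    fix p :: "nat \<Rightarrow> 'b" and q assume "(\<forall>n. p n \<in> UNIV) \<and> p \<longlonglongrightarrow> q"
    then have lim: "p \<longlonglongrightarrow> q" by simp
    show "(\<lambda>n. \<integral>x. h (x, p n) \<partial>bmu) \<longlonglongrightarrow> (\<integral>x. h (x, q) \<partial>bmu)"
    proof (rule integral_dominated_convergence[where w="\<lambda>x. C * weight x"])
      show "AE x in bmu. (\<lambda>n. h (x, p n)) \<longlonglongrightarrow> h (x, q)"
      proof (rule AE_I2)
        fix x
        have "isCont h (x, q)" using hc by (simp add: continuous_on_eq_continuous_at)
        then show "(\<lambda>n. h (x, p n)) \<longlonglongrightarrow> h (x, q)"
          by (rule isCont_tendsto_compose) (intro tendsto_Pair tendsto_const lim)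
      qed
      show "AE x in bmu. norm (h (x, p n)) \<le> C * weight x" for n by (rule AE_I2) (rule bound)
    qed (rule hm int_w)+
  qed
  have "norm (\<integral>x. h (x, p) \<partial>bmu) \<le> (\<integral>x. C * weight (x::'a) \<partial>bmu)" for p
  proof -
    have "norm (\<integral>x. h (x, p) \<partial>bmu) \<le> (\<integral>x. norm (h (x, p)) \<partial>bmu)" by (rule integral_norm_bound)
    also have "\<dots> \<le> (\<integral>x. C * weight (x::'a) \<partial>bmu)"
      using bound order_trans[OF norm_ge_zero bound] by (intro integral_mono'[OF int_w]) auto
    finally show ?thesis .
  qed
  then show "\<exists>B. \<forall>p. norm (\<integral>x. h (x, p) \<partial>bmu) \<le> B" by blast
  have "integrable (bmu \<Otimes>\<^sub>M bmu) (\<lambda>(x, p). h (x, p))"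
    using schwartz_integrable[OF h] by (simp add: bmu_prod)
  then show "integrable bmu (\<lambda>p. \<integral>x. h (x, p) \<partial>bmu)"
    by (rule bmu_pair.integrable_snd)
qed

definition plane_integral :: "real^'k^'l \<Rightarrow> ((real^'k) \<times> (real^'l) \<Rightarrow> complex) \<Rightarrow> real^'l \<Rightarrow> complex" where
  "plane_integral U f p = (\<integral>x. f (x, U *v x + p) \<partial>bmu)"

text \<open>Restriction of the inverse transform to the frequencies conormal to the planes. With the
  inverse transform here, \<open>ft\<close> leads back to the plane integral.\<close>

definition slice :: "real^'k^'l \<Rightarrow> ((real^'k) \<times> (real^'l) \<Rightarrow> complex) \<Rightarrow> real^'l \<Rightarrow> complex" where
  "slice U f \<xi> = ift f (- (\<xi> v* U), \<xi>)"

lemma schwartz_slice: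
  fixes U :: "real^'k^'l"
  assumes "f \<in> schwartz" shows "slice U f \<in> schwartz"
proof -
  have "linear (\<lambda>\<xi>::real^'l. (- (\<xi> v* U), \<xi>))"
    by (rule linearI) (simp_all add: vector_matrix_mult_def vec_eq_iff algebra_simps sum.distrib sum_distrib_left)
  moreover have "inj (\<lambda>\<xi>::real^'l. (- (\<xi> v* U), \<xi>))" by (auto simp: inj_def)
  ultimately show ?thesis
    unfolding slice_def[abs_def] by (intro schwartz_comp_linear[OF schwartz_ift[OF assms]])
qed

lemma schwartz_shear:
  fixes U :: "real^'k^'l"
  assumes "f \<in> schwartz" shows "(\<lambda>(x, p). f (x, U *v x + p)) \<in> schwartz"
proof -
  have "linear (\<lambda>z::(real^'k) \<times> (real^'l). (fst z, U *v fst z + snd z))"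
    by (rule linearI) (simp_all add: matrix_vector_mult_add_rdistrib matrix_vector_right_distrib matrix_vector_mult_scaleR scaleR_add_right)
  moreover have "inj (\<lambda>z::(real^'k) \<times> (real^'l). (fst z, U *v fst z + snd z))"
    by (auto simp: inj_def prod_eq_iff)
  ultimately have "(\<lambda>z. f (fst z, U *v fst z + snd z)) \<in> schwartz"
    by (rule schwartz_comp_linear[OF assms])
  then show ?thesis by (simp add: case_prod_beta')
qed

lemma inner_mult_vector: "(U *v x) \<bullet> \<xi> = x \<bullet> (\<xi> v* (U :: real^'k^'l))"
  unfolding inner_vec_def matrix_vector_mult_def vector_matrix_mult_def
  by (simp add: sum_distrib_right sum_distrib_left mult_ac, subst sum.swap, simp add: mult_ac)

text \<open>The frequency (\<xi>U, -\<xi>) has the same pairing with every point of one plane, since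
  the contributions of x cancel. So the phase in p is a phase in (x, Ux + p), and a shift in the
  second variable followed by Fubini gives a full Fourier integral of f.\<close>

lemma projection_slice:
  fixes U :: "real^'k^'l"
  assumes f: "f \<in> schwartz"
  shows "ift (plane_integral U f) \<xi> = slice U f \<xi>"
proof -
  let ?h = "\<lambda>(x, p). f (x, U *v x + p)"
  let ?k = "\<lambda>x y. f (x, y) * ker (x, y) (\<xi> v* U, - \<xi>)"
  have hS: "?h \<in> schwartz" by (rule schwartz_shear[OF f])
  have fm [measurable]: "f \<in> borel_measurable borel" by (rule schwartz_measurable[OF f])
  have ih: "integrable (bmu \<Otimes>\<^sub>M bmu) (\<lambda>(x, p). ?h (x, p) * ker p (- \<xi>))"
  proof -
    have "integrable bmu (\<lambda>z. ?h z * ker (snd z) (- \<xi>))"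
      by (intro integrable_mult_ker schwartz_integrable[OF hS] borel_measurable_const
          borel_measurable_continuous_onI[OF continuous_on_snd[OF continuous_on_id]])
    then show ?thesis by (simp add: bmu_prod case_prod_beta')
  qed
  have if': "integrable (bmu \<Otimes>\<^sub>M bmu) (\<lambda>(x, y). ?k x y)"
  proof -
    have "integrable bmu (\<lambda>z. f z * ker z (\<xi> v* U, - \<xi>))"
      by (intro integrable_mult_ker schwartz_integrable f) auto
    then show ?thesis by (simp add: bmu_prod case_prod_beta')
  qed
  have "ift (plane_integral U f) \<xi> = (\<integral>p. (\<integral>x. ?h (x, p) * ker p (- \<xi>) \<partial>bmu) \<partial>bmu)"
    by (simp add: ift_eq plane_integral_def)
  also have "\<dots> = (\<integral>x. (\<integral>p. ?h (x, p) * ker p (- \<xi>) \<partial>bmu) \<partial>bmu)"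
    by (rule bmu_pair.Fubini_integral[OF ih])
  also have "\<dots> = (\<integral>x. (\<integral>y. ?k x y \<partial>bmu) \<partial>bmu)"
  proof (rule Bochner_Integration.integral_cong)
    fix x :: "real^'k"
    have fx: "(\<lambda>y. f (x, y)) \<in> borel_measurable borel"
      by (rule borel_measurable_Pair_snd[OF fm])
    have k: "ker p (- \<xi>) = ker (x, U *v x + p) (\<xi> v* U, - \<xi>)" for p
      by (simp add: ker_def inner_Pair inner_add_left inner_mult_vector)
    have "(\<integral>p. f (x, U *v x + p) * ker (x, U *v x + p) (\<xi> v* U, - \<xi>) \<partial>bmu) =
      (\<integral>y. ?k x y \<partial>bmu)"
      using fx by (intro bmu_translate[of "\<lambda>y. ?k x y"])
        (auto intro!: borel_measurable_times ker_measurable borel_measurable_continuous_onI continuous_intros)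
    then show "(\<integral>p. ?h (x, p) * ker p (- \<xi>) \<partial>bmu) = (\<integral>y. ?k x y \<partial>bmu)"
      by (simp add: k[symmetric])
  qed simp
  also have "\<dots> = (\<integral>z. f z * ker z (\<xi> v* U, - \<xi>) \<partial>(bmu \<Otimes>\<^sub>M bmu))"
    using bmu_pair.integral_fst[OF if'] by (simp add: case_prod_beta')
  also have "\<dots> = slice U f \<xi>"
    by (simp add: slice_def ift_eq bmu_prod)
  finally show ?thesis .
qed

text \<open>\<open>projection_slice\<close> identifies the transform of the plane integral as a
  reflected slice, which is Schwartz and therefore integrable; inversion then applies to the plane
  integral, known to be integrable, bounded and continuous.\<close>

lemma ft_slice:
  fixes U :: "real^'k^'l"
  assumes f: "f \<in> schwartz"
  shows "ft (slice U f) = plane_integral U f"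
proof
  fix p
  let ?h = "\<lambda>(x, p). f (x, U *v x + p)"
  have hS: "?h \<in> schwartz" by (rule schwartz_shear[OF f])
  have eq: "plane_integral U f = (\<lambda>p. \<integral>x. ?h (x, p) \<partial>bmu)" by (simp add: plane_integral_def fun_eq_iff)
  obtain B where B: "\<And>p. norm (plane_integral U f p) \<le> B"
    using bounded_marginal[OF hS] unfolding eq by blast
  have i: "integrable bmu (plane_integral U f)" unfolding eq by (rule integrable_marginal[OF hS])
  have c: "continuous_on UNIV (plane_integral U f)" unfolding eq by (rule continuous_marginal[OF hS])
  have sl: "slice U f \<in> schwartz" by (rule schwartz_slice[OF f])
  have ftp: "ft (plane_integral U f) = (\<lambda>\<xi>. slice U f (- \<xi>))"
    using projection_slice[OF f, of U] by (auto simp: fun_eq_iff ift_def) (metis minus_minus)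
  have "plane_integral U f p = ft (ft (plane_integral U f)) (- p)"
    by (rule ft_inversion[symmetric, OF i _ c B]) (simp add: ftp schwartz_integrable schwartz_reflect sl)
  also have "\<dots> = ft (slice U f) p"
    unfolding ftp by (subst ft_reflect) (simp_all add: schwartz_measurable sl)
  finally show "ft (slice U f) p = plane_integral U f p" by simp
qed

text \<open>The function paired with \<open>a t\<close> is \<open>ft\<close> of the slice, and
  shifting it by \<alpha> amounts to modulating the slice. Pairing \<open>a t\<close> with a
  transform means integrating against \<open>A\<close>, so the value is a Fourier integral in
  \<alpha>. Its absolute convergence is part of \<open>distr_is_function\<close>.\<close>

lemma J_transform_eq:
  fixes u :: "real^'k \<Rightarrow> real^'k^'l"
  assumes f: "f \<in> schwartz"
    and a: "distr_is_function (distr_fourier (a t)) (\<lambda>\<xi>. A \<xi> t)"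
    and B: "B \<in> borel_measurable borel" "AE \<xi> in lborel. A \<xi> t = B \<xi>"
  shows "integrable bmu (\<lambda>\<xi>. B \<xi> * slice (u t) f \<xi>)"
    and "J_transform u a f \<alpha> t = ft (\<lambda>\<xi>. B \<xi> * slice (u t) f \<xi>) \<alpha>"
proof -
  let ?G = "slice (u t) f"
  have G: "?G \<in> schwartz" by (rule schwartz_slice[OF f])
  have fc: "(\<lambda>x. f (x, u t *v x + p)) \<in> borel_measurable borel" for p
    by (intro borel_measurable_continuous_onI continuous_on_compose2[OF schwartz_continuous[OF f, of UNIV]]
        continuous_on_Pair continuous_on_id continuous_on_add continuous_on_const
        linear_continuous_on matrix_vector_mul_bounded_linear) simp
  have gen: "has_bochner_integral bmu (\<lambda>\<xi>. B \<xi> * m \<xi>) (a t (ft m))" if m: "m \<in> schwartz" for m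
  proof -
    have mm [measurable]: "m \<in> borel_measurable borel" by (rule schwartz_measurable[OF m])
    note [measurable] = B(1)
    have "has_bochner_integral mu (\<lambda>\<xi>. A \<xi> t * m \<xi>) (a t (ft m))"
      using a m unfolding distr_is_function_def distr_fourier_def fourier_eq_ft[OF mm, symmetric] by blast
    moreover have "AE \<xi> in mu. A \<xi> t * m \<xi> = B \<xi> * m \<xi>"
      using B(2) unfolding AE_mu_iff by eventually_elim simp
    moreover have Bm: "(\<lambda>\<xi>. B \<xi> * m \<xi>) \<in> borel_measurable bmu" by measurable
    moreover from Bm have "(\<lambda>\<xi>. B \<xi> * m \<xi>) \<in> borel_measurable mu"
      unfolding mu_eq_completion by (rule measurable_completion)
    ultimately have "has_bochner_integral mu (\<lambda>\<xi>. B \<xi> * m \<xi>) (a t (ft m))"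
      using has_bochner_integral_cong_AE borel_measurable_has_bochner_integral by blast
    then show ?thesis
      unfolding has_bochner_integral_iff mu_eq_completion
      by (simp only: integrable_completion[OF Bm] integral_completion[OF Bm])
  qed
  show "integrable bmu (\<lambda>\<xi>. B \<xi> * ?G \<xi>)"
    using gen[OF G] by (rule integrable.intros)
  have "(\<lambda>s. \<integral>x. f (x, u t *v x + (s + \<alpha>)) \<partial>mu) = (\<lambda>s. plane_integral (u t) f (s + \<alpha>))"
    by (simp add: plane_integral_def integral_mu_eq fc)
  also have "\<dots> = (\<lambda>s. ft ?G (s + \<alpha>))" by (simp add: ft_slice[OF f])
  also have "\<dots> = ft (\<lambda>\<xi>. ker \<alpha> \<xi> * ?G \<xi>)"
    by (simp add: ft_def fun_eq_iff ker_add_right ker_commute[of _ \<alpha>] mult_ac)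
  finally have "J_transform u a f \<alpha> t = a t (ft (\<lambda>\<xi>. ker \<alpha> \<xi> * ?G \<xi>))"
    unfolding J_transform_def distr_translate_def by simp
  also have "\<dots> = (\<integral>\<xi>. B \<xi> * (ker \<alpha> \<xi> * ?G \<xi>) \<partial>bmu)"
    using gen[OF schwartz_modulate[OF G]] by (simp add: has_bochner_integral_iff)
  also have "\<dots> = ft (\<lambda>\<xi>. B \<xi> * ?G \<xi>) \<alpha>"
    by (simp add: ft_def ker_commute[of _ \<alpha>] mult_ac)
  finally show "J_transform u a f \<alpha> t = ft (\<lambda>\<xi>. B \<xi> * ?G \<xi>) \<alpha>" .
qed

section \<open>The transform\<close>

lemma schwartz_integrable_square:
  assumes f: "f \<in> schwartz" shows "integrable bmu (\<lambda>x. (norm (f x))\<^sup>2)"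
proof -
  obtain B where B: "\<And>x. norm (f x) \<le> B" using schwartz_bounded[OF f] by blast
  \<comment> \<open>The third conclusion of \<open>parseval_continuous\<close> concerns
    \<open>h\<close> alone, here \<open>f\<close>; the zero function stands in for
    \<open>F\<close>.\<close>
  then show ?thesis
    by (rule parseval_continuous(3)[OF schwartz_integrable[OF schwartz_zero] _ schwartz_integrable[OF f] schwartz_continuous[OF f], rotated]) simp
qed

lemma schwartz_integral_ift_square:
  assumes f: "f \<in> schwartz"
  shows "(\<integral>\<xi>. (norm (ift f \<xi>))\<^sup>2 \<partial>bmu) = (\<integral>x. (norm (f x))\<^sup>2 \<partial>bmu)"
proof -
  note [measurable] = schwartz_measurable[OF f]
  have "(\<integral>\<xi>. (norm (ift f \<xi>))\<^sup>2 \<partial>bmu) = (\<integral>\<xi>. (norm (ft f \<xi>))\<^sup>2 \<partial>bmu)"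
    unfolding ift_def by (rule bmu_reflect[of "\<lambda>\<xi>. (norm (ft f \<xi>))\<^sup>2"]) measurable
  also have "\<dots> = (\<integral>x. (norm (f x))\<^sup>2 \<partial>bmu)"
    by (rule integral_ft_square[OF schwartz_integrable[OF f] schwartz_integrable_square[OF f]])
  finally show ?thesis .
qed

lemma distr_is_function_cong_AE:
  assumes T: "distr_is_function T g" and g': "g' \<in> borel_measurable borel" "AE x in lborel. g x = g' x"
  shows "distr_is_function T g'"
  unfolding distr_is_function_def
proof
  fix h :: "'a \<Rightarrow> complex" assume h: "h \<in> schwartz"
  note [measurable] = schwartz_measurable[OF h] g'(1)
  have gh: "has_bochner_integral mu (\<lambda>x. g x * h x) (T h)" using T h by (simp add: distr_is_function_def)
  have "(\<lambda>x. g' x * h x) \<in> borel_measurable bmu" by measurable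
  then have m: "(\<lambda>x. g' x * h x) \<in> borel_measurable mu"
    unfolding mu_eq_completion by (rule measurable_completion)
  have "AE x in mu. g x * h x = g' x * h x"
    unfolding AE_mu_iff using g'(2) by eventually_elim simp
  then have "has_bochner_integral mu (\<lambda>x. g x * h x) (T h) \<longleftrightarrow> has_bochner_integral mu (\<lambda>x. g' x * h x) (T h)"
    by (rule has_bochner_integral_cong_AE[OF borel_measurable_has_bochner_integral[OF gh] m])
  then show "has_bochner_integral mu (\<lambda>x. g' x * h x) (T h)" using gh by simp
qed

section \<open>Bounded functions as tempered distributions\<close>

lemma schwartz_norm_upper:
  assumes f: "f \<in> schwartz"
  shows "(1 + norm x) ^ m * norm (f x) \<le> schwartz_norm m f"
proof -
  let ?S = "{bs. set bs \<subseteq> (Basis :: 'a set) \<and> length bs \<le> m}"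
  let ?s = "\<lambda>bs. SUP x. (1 + norm x) ^ m * norm (pderivs bs f x)"
  have bdd: "bdd_above (range (\<lambda>x. (1 + norm x) ^ m * norm (pderivs bs f x)))" if "bs \<in> ?S" for bs
    using f that unfolding schwartz_def by (intro bounded_imp_bdd_above) auto
  have upper: "(1 + norm x) ^ m * norm (pderivs bs f x) \<le> ?s bs" if "bs \<in> ?S" for bs x
    by (rule cSUP_upper[OF UNIV_I bdd[OF that]])
  have "(1 + norm x) ^ m * norm (f x) \<le> ?s []" using upper[of "[]" x] by simp
  also have "\<dots> \<le> (\<Sum>bs\<in>?S. ?s bs)"
  proof (rule member_le_sum)
    show "0 \<le> ?s bs" if "bs \<in> ?S - {[]}" for bs
      using upper[of bs 0] that by (intro order_trans[OF _ upper[of bs 0]]) auto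
    show "finite ?S" by (rule finite_lists_length_le) simp
  qed simp
  finally show ?thesis by (simp add: schwartz_norm_def)
qed

text \<open>The seminorm of order \<open>2 * DIM('a)\<close> controls the integral of the modulus of
  a test function through \<open>weight\<close>, which gives the required continuity.\<close>

lemma
  fixes \<phi> :: "'a::euclidean_space \<Rightarrow> complex"
  assumes m: "\<phi> \<in> borel_measurable borel" and K: "\<And>x. norm (\<phi> x) \<le> K"
  shows bounded_function_tempered: "tempered_distribution (\<lambda>h. \<integral>x. \<phi> x * h x \<partial>mu)"
    and bounded_function_distr: "distr_is_function (\<lambda>h. \<integral>x. \<phi> x * h x \<partial>mu) \<phi>"
proof -
  have K0: "0 \<le> K" using order_trans[OF norm_ge_zero K] .
  have pm: "(\<lambda>x. \<phi> x * h x) \<in> borel_measurable borel" if "h \<in> schwartz" for h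
    using m schwartz_measurable[OF that] by measurable
  have i: "integrable bmu (\<lambda>x. \<phi> x * h x)" if h: "h \<in> schwartz" for h
  proof (rule Bochner_Integration.integrable_bound)
    show "integrable bmu (\<lambda>x. K * norm (h x))"
      by (intro integrable_mult_right integrable_norm schwartz_integrable h)
    show "AE x in bmu. norm (\<phi> x * h x) \<le> norm (K * norm (h x))"
      using K K0 by (intro AE_I2) (simp add: norm_mult abs_mult mult_right_mono)
  qed (use pm[OF h] in simp)
  have eq: "(\<integral>x. \<phi> x * h x \<partial>mu) = (\<integral>x. \<phi> x * h x \<partial>bmu)" if "h \<in> schwartz" for h
    by (rule integral_mu_eq[OF pm[OF that]])
  show "distr_is_function (\<lambda>h. \<integral>x. \<phi> x * h x \<partial>mu) \<phi>"
    unfolding distr_is_function_def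
    using has_bochner_integral_mu[OF has_bochner_integral_integrable[OF i]] by (simp add: eq)
  have add: "(\<integral>x. \<phi> x * (f x + g x) \<partial>mu) = (\<integral>x. \<phi> x * f x \<partial>mu) + (\<integral>x. \<phi> x * g x \<partial>mu)"
    if "f \<in> schwartz" "g \<in> schwartz" for f g
  proof -
    have "(\<integral>x. \<phi> x * (f x + g x) \<partial>mu) = (\<integral>x. \<phi> x * f x + \<phi> x * g x \<partial>bmu)"
      using eq[OF schwartz_add[OF that]] by (simp only: distrib_left)
    also have "\<dots> = (\<integral>x. \<phi> x * f x \<partial>bmu) + (\<integral>x. \<phi> x * g x \<partial>bmu)"
      by (rule Bochner_Integration.integral_add) (rule i that)+
    finally show ?thesis unfolding eq[OF that(1)] eq[OF that(2)] .
  qed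
  have cmult: "(\<integral>x. \<phi> x * (c * f x) \<partial>mu) = c * (\<integral>x. \<phi> x * f x \<partial>mu)" for f c
    by (simp add: mult.left_commute[of _ c])
  have bound: "norm (\<integral>x. \<phi> x * f x \<partial>mu) \<le> (K * (\<integral>x. weight (x::'a) \<partial>bmu)) * schwartz_norm (2 * DIM('a)) f"
    if f: "f \<in> schwartz" for f
  proof -
    have "norm (\<integral>x. \<phi> x * f x \<partial>mu) \<le> (\<integral>x. norm (\<phi> x * f x) \<partial>bmu)"
      unfolding eq[OF f] by (rule integral_norm_bound)
    also have "\<dots> \<le> (\<integral>x. K * norm (f x) \<partial>bmu)"
    proof (rule integral_mono)
      show "integrable bmu (\<lambda>x. norm (\<phi> x * f x))" by (rule integrable_norm[OF i[OF f]])
      show "integrable bmu (\<lambda>x. K * norm (f x))"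
        by (intro integrable_mult_right integrable_norm schwartz_integrable f)
      show "norm (\<phi> x * f x) \<le> K * norm (f x)" for x
        unfolding norm_mult by (intro mult_right_mono K) simp
    qed
    also have "\<dots> = K * (\<integral>x. norm (f x) \<partial>bmu)" by simp
    also have "\<dots> \<le> K * (schwartz_norm (2 * DIM('a)) f * (\<integral>x. weight (x::'a) \<partial>bmu))"
      by (intro mult_left_mono K0 integrable_rapid schwartz_measurable f schwartz_norm_upper)
    finally show ?thesis by (simp add: mult_ac)
  qed
  show "tempered_distribution (\<lambda>h. \<integral>x. \<phi> x * h x \<partial>mu)"
    unfolding tempered_distribution_def using add cmult bound by blast
qed

text \<open>All four squares are written in the form \<open>norm (x + c * y)\<close>, so that one
  statement valid for every \<open>c\<close> provides each of them.\<close>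

lemma polarization:
  fixes x y :: complex
  shows "x * cnj y = (of_real ((norm (x + 1 * y))\<^sup>2) - of_real ((norm (x + (-1) * y))\<^sup>2)
     + \<i> * of_real ((norm (x + \<i> * y))\<^sup>2) - \<i> * of_real ((norm (x + (-\<i>) * y))\<^sup>2)) / 4"
  by (simp add: complex_eq_iff cmod_power2) (simp add: power2_eq_square algebra_simps)

text \<open>The value depends on \<open>I\<close> alone. Hence two pairs of functions whose
  combinations have equal square norms for every \<open>c\<close> also have equal inner products,
  which extends Plancherel from norms to pairs.\<close>

lemma has_bochner_integral_polarization:
  fixes X Y :: "'a \<Rightarrow> complex"
  assumes "\<And>c. has_bochner_integral M (\<lambda>z. (norm (X z + c * Y z))\<^sup>2) (I c)"
  shows "has_bochner_integral M (\<lambda>z. X z * cnj (Y z))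
    ((of_real (I 1) - of_real (I (-1)) + \<i> * of_real (I \<i>) - \<i> * of_real (I (-\<i>))) / 4)"
proof -
  have h: "has_bochner_integral M (\<lambda>z. complex_of_real ((norm (X z + c * Y z))\<^sup>2)) (of_real (I c))" for c
    using assms by (rule has_bochner_integral_of_real)
  show ?thesis
    unfolding polarization[of "X _" "Y _"]
    by (intro has_bochner_integral_divide has_bochner_integral_diff has_bochner_integral_add
        has_bochner_integral_mult_right h)
qed

section \<open>The transform as multiplication on the Fourier side\<close>

context crofton_density
begin

text \<open>The spectral side of the transform: for almost every t, its Fourier transform in \<xi>
  is \<open>J_transform\<close> as a function of \<alpha>.\<close>

definition amplitude :: "((real^'k) \<times> (real^'l) \<Rightarrow> complex) \<Rightarrow> (real^'l) \<times> (real^'k) \<Rightarrow> complex" where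
  "amplitude f z = A z * ift f (frequency z)"

text \<open>A Borel function of all (\<alpha>, t) that coincides with \<open>J_transform\<close> for
  almost every t. Its joint measurability is evident, which is not so for an expression in the
  distributions \<open>a t\<close>.\<close>

definition wave :: "((real^'k) \<times> (real^'l) \<Rightarrow> complex) \<Rightarrow> (real^'l) \<times> (real^'k) \<Rightarrow> complex" where
  "wave f z = ft (\<lambda>\<xi>. amplitude f (\<xi>, snd z)) (fst z)"

lemma amplitude_slice: "amplitude f (\<xi>, t) = A (\<xi>, t) * slice (u t) f \<xi>"
  by (simp add: amplitude_def slice_def frequency_def)

lemma amplitude_measurable:
  assumes "f \<in> schwartz" shows "amplitude f \<in> borel_measurable borel"
proof -
  note [measurable] = schwartz_measurable[OF schwartz_ift[OF assms]]
  show ?thesis unfolding amplitude_def[abs_def] by measurable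
qed

lemma amplitude_slice_measurable:
  assumes "f \<in> schwartz" shows "(\<lambda>\<xi>. amplitude f (\<xi>, t)) \<in> borel_measurable borel"
  by (rule borel_measurable_Pair_fst[OF amplitude_measurable[OF assms]])

lemma wave_measurable:
  assumes f: "f \<in> schwartz" shows "wave f \<in> borel_measurable borel"
proof -
  have [measurable]: "amplitude f \<in> borel_measurable (borel \<Otimes>\<^sub>M borel)"
    using amplitude_measurable[OF f] by (simp add: borel_prod)
  have "(\<lambda>z. \<integral>\<xi>. amplitude f (\<xi>, snd z) * ker \<xi> (fst z) \<partial>bmu) \<in> borel_measurable ((borel :: (real^'l) measure) \<Otimes>\<^sub>M (borel :: (real^'k) measure))"
    by measurable
  then show ?thesis unfolding wave_def[abs_def] ft_def by (simp add: borel_prod)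
qed

lemma amplitude_add_cmult:
  assumes f: "f \<in> schwartz" and g: "g \<in> schwartz"
  shows "amplitude (\<lambda>z. f z + c * g z) w = amplitude f w + c * amplitude g w"
  unfolding amplitude_def ift_def
  by (subst ft_add) (simp_all add: ft_cmult schwartz_integrable f schwartz_cmult g distrib_left mult_ac)

lemma wave_add_cmult:
  assumes f: "f \<in> schwartz" and g: "g \<in> schwartz"
    and i: "integrable bmu (\<lambda>\<xi>. amplitude f (\<xi>, snd z))" "integrable bmu (\<lambda>\<xi>. amplitude g (\<xi>, snd z))"
  shows "wave (\<lambda>z. f z + c * g z) z = wave f z + c * wave g z"
  unfolding wave_def amplitude_add_cmult[OF f g]
  using i by (subst ft_add) (simp_all add: ft_cmult)

lemma nn_integral_amplitude_square:
  assumes f: "f \<in> schwartz"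
  shows "(\<integral>\<^sup>+z. ennreal ((norm (amplitude f z))\<^sup>2) \<partial>bmu) = ennreal (\<integral>z. (norm (f z))\<^sup>2 \<partial>bmu)"
proof -
  note [measurable] = schwartz_measurable[OF schwartz_ift[OF f]]
  let ?g = "\<lambda>z. ennreal ((norm (ift f z))\<^sup>2)"
  have gm: "?g \<in> borel_measurable borel" by measurable
  have "(\<integral>\<^sup>+z. ennreal ((norm (amplitude f z))\<^sup>2) \<partial>bmu) = (\<integral>\<^sup>+z. ennreal ((norm (A z))\<^sup>2) * ?g (frequency z) \<partial>bmu)"
    by (intro nn_integral_cong) (simp add: amplitude_def norm_mult power_mult_distrib ennreal_mult)
  also have "\<dots> = (\<integral>\<^sup>+z. ?g (frequency z) \<partial>density bmu (\<lambda>z. ennreal ((norm (A z))\<^sup>2)))"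
    by (rule nn_integral_density[symmetric]) measurable
  also have "\<dots> = (\<integral>\<^sup>+z. ?g z \<partial>distr (density bmu (\<lambda>z. ennreal ((norm (A z))\<^sup>2))) borel frequency)"
    by (rule nn_integral_distr[symmetric]) (simp_all add: frequency_measurable)
  also have "\<dots> = (\<integral>\<^sup>+z. ?g z \<partial>bmu)" by (simp only: distr_frequency)
  also have "\<dots> = ennreal (\<integral>z. (norm (ift f z))\<^sup>2 \<partial>bmu)"
    by (rule nn_integral_eq_integral) (simp_all add: schwartz_integrable_square schwartz_ift f)
  finally show ?thesis by (simp only: schwartz_integral_ift_square[OF f])
qed

text \<open>The amplitude has finite total square mass, so by Tonelli almost every t-slice is square
  integrable; by assumption it is integrable too. \<open>integral_ft_square\<close> then applies
  slice by slice.\<close>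

lemma has_bochner_integral_wave_square:
  assumes f: "f \<in> schwartz" and i: "AE t in lborel. integrable bmu (\<lambda>\<xi>. amplitude f (\<xi>, t))"
  shows "has_bochner_integral bmu (\<lambda>z. (norm (wave f z))\<^sup>2) (\<integral>z. (norm (f z))\<^sup>2 \<partial>bmu)"
proof (rule has_bochner_integral_nn_integral)
  note [measurable] = wave_measurable[OF f] amplitude_measurable[OF f]
  show "(\<lambda>z. (norm (wave f z))\<^sup>2) \<in> borel_measurable bmu" by measurable
  have wm: "(\<lambda>z. ennreal ((norm (wave f z))\<^sup>2)) \<in> borel_measurable (bmu \<Otimes>\<^sub>M bmu)"
    unfolding bmu_prod measurable_bmu by measurable
  have am: "(\<lambda>z. ennreal ((norm (amplitude f z))\<^sup>2)) \<in> borel_measurable (bmu \<Otimes>\<^sub>M bmu)"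
    unfolding bmu_prod measurable_bmu by measurable
  have a_eq: "(\<integral>\<^sup>+t. (\<integral>\<^sup>+\<xi>. ennreal ((norm (amplitude f (\<xi>, t)))\<^sup>2) \<partial>bmu) \<partial>bmu) = ennreal (\<integral>z. (norm (f z))\<^sup>2 \<partial>bmu)"
    using bmu_pair.nn_integral_snd[OF am] by (simp add: bmu_prod nn_integral_amplitude_square[OF f])
  have "(\<lambda>t. \<integral>\<^sup>+\<xi>. ennreal ((norm (amplitude f (\<xi>, t)))\<^sup>2) \<partial>bmu) \<in> borel_measurable bmu"
    by (rule bmu.borel_measurable_nn_integral[OF measurable_pair_swap[OF am]])
  then have "AE t in bmu. (\<integral>\<^sup>+\<xi>. ennreal ((norm (amplitude f (\<xi>, t)))\<^sup>2) \<partial>bmu) \<noteq> \<infinity>"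
    by (rule nn_integral_PInf_AE) (simp add: a_eq)
  then have ae: "AE t in bmu. (\<integral>\<^sup>+\<alpha>. ennreal ((norm (wave f (\<alpha>, t)))\<^sup>2) \<partial>bmu) = (\<integral>\<^sup>+\<xi>. ennreal ((norm (amplitude f (\<xi>, t)))\<^sup>2) \<partial>bmu)"
    using i unfolding AE_bmu_iff
  proof eventually_elim
    case (elim t)
    let ?F = "\<lambda>\<xi>. amplitude f (\<xi>, t)"
    have [measurable]: "?F \<in> borel_measurable borel" by (rule amplitude_slice_measurable[OF f])
    have F2: "integrable bmu (\<lambda>\<xi>. (norm (?F \<xi>))\<^sup>2)"
      using elim(1) by (intro integrableI_bounded) (simp_all add: less_top)
    have "(\<integral>\<^sup>+\<alpha>. ennreal ((norm (ft ?F \<alpha>))\<^sup>2) \<partial>bmu) = ennreal (\<integral>\<alpha>. (norm (ft ?F \<alpha>))\<^sup>2 \<partial>bmu)"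
      by (rule nn_integral_eq_integral) (simp_all add: integrable_ft_square elim(2) F2)
    also have "\<dots> = (\<integral>\<^sup>+\<xi>. ennreal ((norm (?F \<xi>))\<^sup>2) \<partial>bmu)"
      unfolding integral_ft_square[OF elim(2) F2] by (rule nn_integral_eq_integral[symmetric]) (simp_all add: F2)
    finally show ?case by (simp add: wave_def)
  qed
  have "(\<integral>\<^sup>+z. ennreal ((norm (wave f z))\<^sup>2) \<partial>bmu) = (\<integral>\<^sup>+t. (\<integral>\<^sup>+\<alpha>. ennreal ((norm (wave f (\<alpha>, t)))\<^sup>2) \<partial>bmu) \<partial>bmu)"
    using bmu_pair.nn_integral_snd[OF wm] by (simp add: bmu_prod)
  also have "\<dots> = ennreal (\<integral>z. (norm (f z))\<^sup>2 \<partial>bmu)"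
    using nn_integral_cong_AE[OF ae] a_eq by simp
  finally show "(\<integral>\<^sup>+z. ennreal ((norm (wave f z))\<^sup>2) \<partial>bmu) = ennreal (\<integral>z. (norm (f z))\<^sup>2 \<partial>bmu)" .
qed simp_all

text \<open>\<open>wave\<close> is additive wherever both amplitude slices are integrable, that is,
  for almost every t. The square norms of all combinations are therefore those of the original
  functions, and polarization gives the inner product.\<close>

lemma has_bochner_integral_wave_cnj:
  assumes f: "f \<in> schwartz" and g: "g \<in> schwartz"
    and i: "\<And>h. h \<in> schwartz \<Longrightarrow> AE t in lborel. integrable bmu (\<lambda>\<xi>. amplitude h (\<xi>, t))"
  shows "has_bochner_integral bmu (\<lambda>z. wave f z * cnj (wave g z)) (\<integral>z. f z * cnj (g z) \<partial>bmu)"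
proof -
  define I where "I c = (\<integral>z. (norm (f z + c * g z))\<^sup>2 \<partial>bmu)" for c
  have S: "(\<lambda>z. f z + c * g z) \<in> schwartz" for c by (intro schwartz_add schwartz_cmult f g)
  have "has_bochner_integral bmu (\<lambda>z. (norm (wave f z + c * wave g z))\<^sup>2) (I c)" for c
  proof -
    have ae: "AE z in bmu. (norm (wave (\<lambda>z. f z + c * g z) z))\<^sup>2 = (norm (wave f z + c * wave g z))\<^sup>2"
      unfolding AE_bmu_iff using AE_lborel_snd[OF i[OF f]] AE_lborel_snd[OF i[OF g]]
      by eventually_elim (simp add: wave_add_cmult[OF f g])
    note [measurable] = wave_measurable[OF f] wave_measurable[OF g] wave_measurable[OF S]
    have "has_bochner_integral bmu (\<lambda>z. (norm (wave f z + c * wave g z))\<^sup>2) (I c) \<longleftrightarrow>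
      has_bochner_integral bmu (\<lambda>z. (norm (wave (\<lambda>z. f z + c * g z) z))\<^sup>2) (I c)"
      using ae by (intro has_bochner_integral_cong_AE) (measurable, auto elim: eventually_mono)
    then show ?thesis
      using has_bochner_integral_wave_square[OF S i[OF S]] by (simp add: I_def)
  qed
  note W = has_bochner_integral_polarization[OF this]
  have "has_bochner_integral bmu (\<lambda>z. (norm (f z + c * g z))\<^sup>2) (I c)" for c
    unfolding I_def using schwartz_integrable_square[OF S] by (rule has_bochner_integral_integrable)
  note P = has_bochner_integral_polarization[OF this]
  show ?thesis unfolding has_bochner_integral_integral_eq[OF P] by (rule W)
qed

end

section \<open>Plancherel and inversion for a kernel with the given spectrum\<close>

locale crofton_transform = crofton_density u A for u :: "real^'k \<Rightarrow> real^'k^'l" and A +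
  fixes a :: "real^'k \<Rightarrow> (real^'l) distr"
  assumes spectrum: "AE t in lborel. distr_is_function (distr_fourier (a t)) (\<lambda>\<xi>. A (\<xi>, t))"
begin

lemma A_slice_measurable: "(\<lambda>\<xi>. A (\<xi>, t)) \<in> borel_measurable borel"
  by (rule borel_measurable_Pair_fst[OF A_measurable])

lemma J_transform_wave:
  assumes f: "f \<in> schwartz"
  shows "AE t in lborel. integrable bmu (\<lambda>\<xi>. amplitude f (\<xi>, t)) \<and>
    (\<forall>\<alpha>. J_transform u a f \<alpha> t = wave f (\<alpha>, t))"
  using spectrum
proof eventually_elim
  case (elim t)
  note J = J_transform_eq[where u=u and a=a and t=t and A="\<lambda>\<xi> t. A (\<xi>, t)" and B="\<lambda>\<xi>. A (\<xi>, t)",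
      OF f elim A_slice_measurable]
  show ?case using J by (simp add: wave_def amplitude_slice)
qed

lemma amplitude_integrable: "f \<in> schwartz \<Longrightarrow> AE t in lborel. integrable bmu (\<lambda>\<xi>. amplitude f (\<xi>, t))"
  using J_transform_wave by (auto elim!: eventually_mono)

theorem plancherel:
  assumes f: "f \<in> schwartz" and g: "g \<in> schwartz"
  shows "has_bochner_integral mu (\<lambda>(\<alpha>, t). J_transform u a f \<alpha> t * cnj (J_transform u a g \<alpha> t)) (\<integral>z. f z * cnj (g z) \<partial>mu)"
proof -
  note [measurable] = schwartz_measurable[OF f] schwartz_measurable[OF schwartz_cnj[OF g]]
  have "(\<integral>z. f z * cnj (g z) \<partial>mu) = (\<integral>z. f z * cnj (g z) \<partial>bmu)"
    by (rule integral_mu_eq) measurable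
  moreover have "AE z in lborel. (case z of (\<alpha>, t) \<Rightarrow> J_transform u a f \<alpha> t * cnj (J_transform u a g \<alpha> t)) = wave f z * cnj (wave g z)"
    using AE_lborel_snd[OF J_transform_wave[OF f]] AE_lborel_snd[OF J_transform_wave[OF g]]
    by eventually_elim (auto split: prod.split)
  ultimately show ?thesis
    using has_bochner_integral_mu_AE[OF has_bochner_integral_wave_cnj[OF f g amplitude_integrable]] by simp
qed

text \<open>The pairing for \<open>a t\<close> is conjugated at the test function \<open>m\<close>,
  the conjugate of \<open>ft h\<close>. As \<open>m\<close> is the inverse transform of the
  conjugate of \<open>h\<close>, its transform is that conjugate, exactly the argument prescribed by
  \<open>distr_cnj\<close>.\<close>

lemma kernel_spectrum: "kernel_has_spectrum (\<lambda>t. distr_cnj (a t)) (\<lambda>\<xi> t. cnj (A (\<xi>, t)))"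
  unfolding kernel_has_spectrum_def
proof
  have "(\<lambda>z. cnj (A z)) \<in> borel_measurable borel" by measurable
  then show "(\<lambda>(\<xi>, t). cnj (A (\<xi>, t))) \<in> borel_measurable lebesgue"
    by (auto intro: measurable_completion simp: case_prod_beta')
  have "AE t in lborel. \<forall>h\<in>schwartz. has_bochner_integral mu (\<lambda>\<xi>. cnj (A (\<xi>, t)) * fourier h \<xi>) (distr_cnj (a t) h)"
    using spectrum
  proof eventually_elim
    case (elim t)
    show ?case
    proof
      fix h :: "real^'l \<Rightarrow> complex" assume h: "h \<in> schwartz"
      define m where "m = (\<lambda>\<xi>. cnj (ft h \<xi>))"
      have m: "m \<in> schwartz" unfolding m_def by (intro schwartz_cnj schwartz_ft h)
      have "m = ift (\<lambda>x. cnj (h x))" by (simp add: m_def ift_def ft_cnj fun_eq_iff)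
      then have "ft m = (\<lambda>x. cnj (h x))" by (simp add: schwartz_ft_ift schwartz_cnj h)
      then have "has_bochner_integral mu (\<lambda>\<xi>. A (\<xi>, t) * m \<xi>) (a t (\<lambda>x. cnj (h x)))"
        using elim m unfolding distr_is_function_def distr_fourier_def
        by (metis fourier_eq_ft schwartz_measurable)
      then have "has_bochner_integral mu (\<lambda>\<xi>. cnj (A (\<xi>, t) * m \<xi>)) (cnj (a t (\<lambda>x. cnj (h x))))"
        by (rule has_bochner_integral_cnj)
      then show "has_bochner_integral mu (\<lambda>\<xi>. cnj (A (\<xi>, t)) * fourier h \<xi>) (distr_cnj (a t) h)"
        by (simp add: m_def distr_cnj_def fourier_eq_ft schwartz_measurable h)
    qed
  qed
  then show "AE t in lebesgue. \<forall>h\<in>schwartz. has_bochner_integral mu (\<lambda>\<xi>. cnj (A (\<xi>, t)) * fourier h \<xi>) (distr_cnj (a t) h)"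
    by (simp only: AE_completion_iff)
qed

text \<open>In the kernel integral \<open>A\<close> meets its conjugate, which leaves the density of
  \<open>distr_frequency\<close> times \<open>ift f\<close> and a plane wave, both taken at the
  conormal frequency. Transporting the density yields the ordinary inversion formula for
  \<open>f\<close>.\<close>

theorem inversion:
  assumes f: "f \<in> schwartz"
  shows "has_kernel_integral u (J_transform u a f) (\<lambda>t. distr_cnj (a t)) x y (f (x, y))"
proof -
  define T where "T t h = (\<integral>\<alpha>. J_transform u a f \<alpha> t * h \<alpha> \<partial>mu)" for t h
  \<comment> \<open>The transform is already \<open>ft\<close> of the amplitude, and applying
    \<open>ft\<close> twice reflects; hence the sign. It cancels against the argument -\<xi> in the
    kernel integral.\<close>
  define \<Phi> where "\<Phi> \<xi> t = amplitude f (- \<xi>, t)" for \<xi> t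
  have T_ae: "AE t in lborel. tempered_distribution (T t) \<and> distr_is_function (T t) (\<lambda>\<alpha>. J_transform u a f \<alpha> t) \<and>
      distr_is_function (distr_fourier (T t)) (\<lambda>\<xi>. \<Phi> \<xi> t)"
    using J_transform_wave[OF f]
  proof eventually_elim
    case (elim t)
    define F where "F = (\<lambda>\<xi>. amplitude f (\<xi>, t))"
    have Fi: "integrable bmu F" using elim by (simp add: F_def)
    have J: "J_transform u a f \<alpha> t = ft F \<alpha>" for \<alpha> using elim by (simp add: wave_def F_def)
    have Fm: "ft F \<in> borel_measurable borel" using Fi by (intro ft_measurable) auto
    \<comment> \<open>Integrability of the amplitude slice makes the transform bounded in \<alpha>,
      so it defines a tempered distribution without any decay.\<close>
    have bounded: "norm (ft F \<alpha>) \<le> (\<integral>s. norm (F s) \<partial>bmu)" for \<alpha> by (rule norm_ft_le)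
    note T = bounded_function_tempered[OF Fm bounded] bounded_function_distr[OF Fm bounded]
    have Teq: "T t = (\<lambda>h. \<integral>\<alpha>. ft F \<alpha> * h \<alpha> \<partial>mu)" by (simp add: T_def J fun_eq_iff)
    have "has_bochner_integral mu (\<lambda>\<xi>. \<Phi> \<xi> t * h \<xi>) (T t (fourier h))" if h: "h \<in> schwartz" for h
    proof -
      obtain B where B: "\<And>x. norm (h x) \<le> B" using schwartz_bounded[OF h] by blast
      note [measurable] = schwartz_measurable[OF h] schwartz_measurable[OF schwartz_ft[OF h]]
      have [measurable]: "F \<in> borel_measurable borel" using Fi by auto
      have i: "integrable bmu (\<lambda>\<xi>. F (- \<xi>) * h \<xi>)"
      proof (rule Bochner_Integration.integrable_bound)
        show "integrable bmu (\<lambda>\<xi>. norm (F (- \<xi>)) * B)"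
          by (intro integrable_mult_left integrable_norm integrable_bmu_reflect Fi)
        show "AE \<xi> in bmu. norm (F (- \<xi>) * h \<xi>) \<le> norm (norm (F (- \<xi>)) * B)"
          using B order_trans[OF norm_ge_zero B] by (intro AE_I2) (simp add: norm_mult abs_mult mult_left_mono)
      qed measurable
      have "T t (fourier h) = (\<integral>\<alpha>. ft F \<alpha> * ft h \<alpha> \<partial>bmu)"
        unfolding Teq fourier_eq_ft[OF schwartz_measurable[OF h]]
        using Fm by (intro integral_mu_eq) measurable
      also have "\<dots> = (\<integral>\<xi>. F \<xi> * h (- \<xi>) \<partial>bmu)"
        unfolding integral_ft_mult[OF Fi schwartz_integrable[OF schwartz_ft[OF h]]] schwartz_ft_ft[OF h] ..
      also have "\<dots> = (\<integral>\<xi>. F (- \<xi>) * h \<xi> \<partial>bmu)"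
        by (subst bmu_reflect[symmetric]) simp_all
      finally have "T t (fourier h) = (\<integral>\<xi>. F (- \<xi>) * h \<xi> \<partial>bmu)" .
      then show ?thesis
        using has_bochner_integral_mu[OF has_bochner_integral_integrable[OF i]] by (simp add: \<Phi>_def F_def)
    qed
    then have "distr_is_function (distr_fourier (T t)) (\<lambda>\<xi>. \<Phi> \<xi> t)"
      by (simp add: distr_is_function_def distr_fourier_def)
    then show ?case using T by (simp add: Teq J)
  qed
  have "(\<lambda>(\<xi>, t). \<Phi> \<xi> t) \<in> borel_measurable borel"
  proof -
    have "(\<lambda>z. amplitude f (- fst z, snd z)) \<in> borel_measurable borel"
      by (rule measurable_compose[OF _ amplitude_measurable[OF f]])
        (intro borel_measurable_continuous_onI continuous_intros)
    then show ?thesis by (simp add: \<Phi>_def case_prod_beta')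
  qed
  then have spectrum: "partial_fourier_is_function T \<Phi>"
    unfolding partial_fourier_is_function_def AE_completion_iff
    using T_ae by (auto intro: measurable_completion elim!: eventually_mono)
  have "has_bochner_integral mu
      (\<lambda>(\<xi>, t). \<Phi> (- \<xi>) t * cnj (A (\<xi>, t)) * exp (\<i> * of_real ((y - u t *v x) \<bullet> \<xi>))) (f (x, y))"
  proof -
    have "has_bochner_integral bmu (\<lambda>w. ift f w * ker w (x, y)) (ft (ift f) (x, y))"
      unfolding ft_def
      by (intro has_bochner_integral_integrable integrable_mult_ker schwartz_integrable schwartz_ift f) auto
    then have H: "has_bochner_integral bmu (\<lambda>w. ift f w * ker w (x, y)) (f (x, y))"
      by (simp only: schwartz_ft_ift[OF f])
    have E: "(norm (A (\<xi>, t)))\<^sup>2 *\<^sub>R (ift f (frequency (\<xi>, t)) * ker (frequency (\<xi>, t)) (x, y)) =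
      \<Phi> (- \<xi>) t * cnj (A (\<xi>, t)) * exp (\<i> * of_real ((y - u t *v x) \<bullet> \<xi>))" for \<xi> t
    proof -
      \<comment> \<open>The plane wave at the conormal frequency is the exponential of the kernel
        integral.\<close>
      have "frequency (\<xi>, t) \<bullet> (x, y) = y \<bullet> \<xi> - x \<bullet> (\<xi> v* u t)"
        by (simp add: frequency_def inner_Pair inner_commute)
      also have "\<dots> = (y - u t *v x) \<bullet> \<xi>"
        by (simp only: inner_diff_left inner_mult_vector)
      finally have "frequency (\<xi>, t) \<bullet> (x, y) = (y - u t *v x) \<bullet> \<xi>" .
      then have "ker (frequency (\<xi>, t)) (x, y) = exp (\<i> * of_real ((y - u t *v x) \<bullet> \<xi>))"
        by (simp only: ker_def)
      then show ?thesis
        by (simp add: \<Phi>_def amplitude_def scaleR_conv_of_real complex_norm_square mult_ac del: of_real_power)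
    qed
    have "(\<lambda>z. (norm (A z))\<^sup>2 *\<^sub>R (ift f (frequency z) * ker (frequency z) (x, y))) =
      (\<lambda>(\<xi>, t). \<Phi> (- \<xi>) t * cnj (A (\<xi>, t)) * exp (\<i> * of_real ((y - u t *v x) \<bullet> \<xi>)))"
    proof (rule ext, clarify)
      fix \<xi> t
      show "(norm (A (\<xi>, t)))\<^sup>2 *\<^sub>R (ift f (frequency (\<xi>, t)) * ker (frequency (\<xi>, t)) (x, y)) =
        \<Phi> (- \<xi>) t * cnj (A (\<xi>, t)) * exp (\<i> * of_real ((y - u t *v x) \<bullet> \<xi>))"
        by (rule E)
    qed
    then show ?thesis
      using has_bochner_integral_mu[OF has_bochner_integral_frequency[OF H]] by (simp only:)
  qed
  moreover have "AE t in lebesgue. distr_is_function (T t) (\<lambda>\<alpha>. J_transform u a f \<alpha> t)"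
    unfolding AE_completion_iff using T_ae by (auto elim!: eventually_mono)
  ultimately show ?thesis
    unfolding has_kernel_integral_def using spectrum kernel_spectrum by blast
qed

end

section \<open>From Lebesgue measurable spectra to Borel ones\<close>

lemma lebesgue_measurable_complex_borel:
  fixes f :: "'a::euclidean_space \<Rightarrow> complex"
  assumes "f \<in> borel_measurable lebesgue"
  shows "\<exists>g\<in>borel_measurable borel. AE x in lborel. f x = g x"
proof -
  have "(\<lambda>x. Re (f x)) \<in> borel_measurable lebesgue" "(\<lambda>x. Im (f x)) \<in> borel_measurable lebesgue"
    using assms by measurable
  then obtain r i where ri: "r \<in> borel_measurable lborel" "i \<in> borel_measurable lborel"
      "AE x in lborel. Re (f x) = r x" "AE x in lborel. Im (f x) = i x"
    using completion_ex_borel_measurable_real[of "\<lambda>x. Re (f x)" lborel]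
      completion_ex_borel_measurable_real[of "\<lambda>x. Im (f x)" lborel] by blast
  have "(\<lambda>x. Complex (r x) (i x)) \<in> borel_measurable borel"
    using ri(1,2) unfolding Complex_eq by measurable
  moreover have "AE x in lborel. f x = Complex (r x) (i x)"
    using ri(3,4) by eventually_elim (simp add: complex_eq_iff)
  ultimately show ?thesis by (intro bexI[of _ "\<lambda>x. Complex (r x) (i x)"])
qed

theorem mainTheorem4:
  fixes u :: "real^'k \<Rightarrow> real^'k^'l"
    and a :: "real^'k \<Rightarrow> (real^'l) distr"
    and A :: "real^'l \<Rightarrow> real^'k \<Rightarrow> complex"
    and n :: nat
  assumes "n = CARD('k) + CARD('l)" and "0 < CARD('k)" and "CARD('k) < n - 1"
    and "polynomial_matrix u"
    and "nonsingular_map u"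
    and "AE (\<eta>, \<xi>) in lebesgue. crofton u \<eta> \<xi> \<noteq> \<infinity> \<and> crofton u \<eta> \<xi> \<noteq> 0"
    and "partial_fourier_is_function a A"
    and "AE (\<xi>, t) in lebesgue.
           norm (A \<xi> t) =
             enn2real (crofton u (- (\<xi> v* u t)) \<xi>) powr (- 1 / 2) * \<bar>omega u \<xi> t\<bar> powr (1 / 2)"
  shows "generalized_fourier_transform u a"
proof -
  have "(\<lambda>(\<xi>, t). A \<xi> t) \<in> borel_measurable lebesgue"
    using assms(7) by (simp add: partial_fourier_is_function_def)
  \<comment> \<open>The spectrum is only Lebesgue measurable, and \<open>B\<close> is a Borel
    representative. For almost every t the two agree for almost every \<xi>, so \<open>B\<close>
    still represents the Fourier transform of \<open>a t\<close>.\<close>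
  then obtain B where B: "B \<in> borel_measurable borel" "AE z in lborel. (case z of (\<xi>, t) \<Rightarrow> A \<xi> t) = B z"
    using lebesgue_measurable_complex_borel by blast
  interpret crofton_density u B
  proof
    show "polynomial_matrix u" by fact
    show "AE (\<eta>, \<xi>) in lborel. crofton u \<eta> \<xi> \<noteq> \<infinity> \<and> crofton u \<eta> \<xi> \<noteq> 0"
      using assms(6) by (simp only: AE_completion_iff)
    show "B \<in> borel_measurable borel" by fact
    have "AE (\<xi>, t) in lborel. norm (A \<xi> t) =
             enn2real (crofton u (- (\<xi> v* u t)) \<xi>) powr (- 1 / 2) * \<bar>omega u \<xi> t\<bar> powr (1 / 2)"
      using assms(8) by (simp only: AE_completion_iff)
    with B(2) show "AE (\<xi>, t) in lborel. norm (B (\<xi>, t)) =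
             enn2real (crofton u (- (\<xi> v* u t)) \<xi>) powr (- 1 / 2) * \<bar>omega u \<xi> t\<bar> powr (1 / 2)"
      by eventually_elim (auto simp del: minus_divide_left)
  qed
  interpret crofton_transform u B a
  proof
    have "AE t in lborel. distr_is_function (distr_fourier (a t)) (\<lambda>\<xi>. A \<xi> t)"
      using assms(7) by (auto simp: partial_fourier_is_function_def AE_completion_iff elim!: eventually_mono)
    then show "AE t in lborel. distr_is_function (distr_fourier (a t)) (\<lambda>\<xi>. B (\<xi>, t))"
      using AE_lborel_prod_swap[OF B(2)]
    proof eventually_elim
      case (elim t)
      have "(\<lambda>\<xi>. B (\<xi>, t)) \<in> borel_measurable borel"
        by (rule borel_measurable_Pair_fst[OF B(1)])
      then show ?case
        using distr_is_function_cong_AE[OF elim(1)] elim(2) by simp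
    qed
  qed
  show ?thesis
    unfolding generalized_fourier_transform_def using inversion plancherel by blast
qed

end
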